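(* Let $k$ be a field, let $B$ be a finite-dimensional $\mathbb Z$-graded $k$-algebra, and let $\sigma$ be a grading-preserving $k$-algebra automorphism of $B$. For every finite-dimensional $\mathbb Z$-graded left $B$-module $M$ and every $n\ge 0$, there is a natural isomorphism of $k$-vector spaces $$\operatorname{Ext}_{B^\sigma}^n(F_\sigma M,F_\sigma M)\;\simeq\;\bigoplus_{d\in\mathbb Z}\operatorname{Ext}_{B\text{-}\mathrm{gr}}^n\bigl(M,\ {}^{\sigma^d}\!M(d)\bigr),$$ where the Ext group on the left is computed in the ordinary (ungraded) module category.
   Context: For a finite-dimensional $\mathbb Z$-graded algebra $B$, $B\text{-}\mathrm{gr}$ is the category of finite-dimensional $\mathbb Z$-graded left $B$-modules with degree-zero $B$-linear morphisms, and $\operatorname{Ext}_{B\text{-}\mathrm{gr}}^n$ is Ext in this abelian category; $\operatorname{Ext}_B^n$ is Ext of ordinary left modules. The shift is $U(d)_r=U_{r+d}$. The twisted algebra $B^\sigma$ has the same graded vector space as $B$, with multiplication $a*b=\sigma^t(a)\,b$ for $a\in B_s$, $b\in B_t$, extended bilinearly. For $M\in B\text{-}\mathrm{gr}$, $F_\sigma M\in B^\sigma\text{-}\mathrm{gr}$ has the same graded vector space as $M$, with action $b*m=\sigma^r(b)\,m$ for $b\in B_s$, $m\in M_r$, extended bilinearly; $F_\sigma$ retains the underlying linear map on morphisms. For an automorphism $\alpha$ of $B$, ${}^{\alpha}\!M$ is the module with the same vector space as $M$ and action $b\cdot_\alpha m=\alpha(b)m$. Since $\sigma$ preserves degrees,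 ${}^{\sigma^d}\!M$ is a graded $B$-module with the grading of $M$, and ${}^{\sigma^d}\!M(d)$ is its shift by $d$. *)

theory Defs
  imports "HOL-Algebra.Algebra"
begin

section \<open>Left modules over a ring, and algebras over a field\<close>

text \<open>The library locale for modules requires a commutative ring of scalars, and its locale for
  algebras requires a commutative multiplication.  The two locales below drop commutativity.\<close>

locale left_module = R?: ring R + M?: abelian_group M
  for R :: "('a, 'r) ring_scheme" (structure) and M :: "('a, 'm, 'x) module_scheme" (structure) +
  assumes lsmult_closed: "\<lbrakk>a \<in> carrier R; x \<in> carrier M\<rbrakk> \<Longrightarrow> a \<odot>\<^bsub>M\<^esub> x \<in> carrier M"
    and lsmult_l_distr: "\<lbrakk>a \<in> carrier R; b \<in> carrier R; x \<in> carrier M\<rbrakk>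
      \<Longrightarrow> (a \<oplus>\<^bsub>R\<^esub> b) \<odot>\<^bsub>M\<^esub> x = a \<odot>\<^bsub>M\<^esub> x \<oplus>\<^bsub>M\<^esub> b \<odot>\<^bsub>M\<^esub> x"
    and lsmult_r_distr: "\<lbrakk>a \<in> carrier R; x \<in> carrier M; y \<in> carrier M\<rbrakk>
      \<Longrightarrow> a \<odot>\<^bsub>M\<^esub> (x \<oplus>\<^bsub>M\<^esub> y) = a \<odot>\<^bsub>M\<^esub> x \<oplus>\<^bsub>M\<^esub> a \<odot>\<^bsub>M\<^esub> y"
    and lsmult_assoc: "\<lbrakk>a \<in> carrier R; b \<in> carrier R; x \<in> carrier M\<rbrakk>
      \<Longrightarrow> (a \<otimes>\<^bsub>R\<^esub> b) \<odot>\<^bsub>M\<^esub> x = a \<odot>\<^bsub>M\<^esub> (b \<odot>\<^bsub>M\<^esub> x)"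
    and lsmult_one: "x \<in> carrier M \<Longrightarrow> \<one>\<^bsub>R\<^esub> \<odot>\<^bsub>M\<^esub> x = x"

locale k_algebra = K?: field K + B?: ring B + KB?: module K B
  for K :: "('k, 'r) ring_scheme" (structure) and B :: "('k, 'b, 'x) module_scheme" (structure) +
  assumes scal_assoc_l: "\<lbrakk>c \<in> carrier K; a \<in> carrier B; b \<in> carrier B\<rbrakk>
      \<Longrightarrow> (c \<odot>\<^bsub>B\<^esub> a) \<otimes>\<^bsub>B\<^esub> b = c \<odot>\<^bsub>B\<^esub> (a \<otimes>\<^bsub>B\<^esub> b)"
    and scal_assoc_r: "\<lbrakk>c \<in> carrier K; a \<in> carrier B; b \<in> carrier B\<rbrakk>
      \<Longrightarrow> a \<otimes>\<^bsub>B\<^esub> (c \<odot>\<^bsub>B\<^esub> b) = c \<odot>\<^bsub>B\<^esub> (a \<otimes>\<^bsub>B\<^esub> b)"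

text \<open>Homomorphisms are extensional, so that equal morphisms are equal functions.\<close>

definition lmod_hom ::
  "('a, 'r) ring_scheme \<Rightarrow> ('a, 'm, 'x) module_scheme \<Rightarrow> ('a, 'n, 'y) module_scheme \<Rightarrow> ('m \<Rightarrow> 'n) set"
  where "lmod_hom R M N = {f \<in> carrier M \<rightarrow>\<^sub>E carrier N.
     (\<forall>x\<in>carrier M. \<forall>y\<in>carrier M. f (x \<oplus>\<^bsub>M\<^esub> y) = f x \<oplus>\<^bsub>N\<^esub> f y) \<and>
     (\<forall>a\<in>carrier R. \<forall>x\<in>carrier M. f (a \<odot>\<^bsub>M\<^esub> x) = a \<odot>\<^bsub>N\<^esub> f x)}"

definition lmod_iso ::
  "('a, 'r) ring_scheme \<Rightarrow> ('a, 'm, 'x) module_scheme \<Rightarrow> ('a, 'n, 'y) module_scheme \<Rightarrow> ('m \<Rightarrow> 'n) set"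
  where "lmod_iso R M N = {f \<in> lmod_hom R M N. bij_betw f (carrier M) (carrier N)}"

text \<open>A left module over a \<open>K\<close>-algebra \<open>B\<close> is a \<open>K\<close>-vector space through \<open>c \<mapsto> c 1\<^sub>B\<close>.\<close>

definition restrict_scalars ::
  "('k, 'b, 'x) module_scheme \<Rightarrow> ('b, 'm, 'y) module_scheme \<Rightarrow> ('k, 'm) module"
  where "restrict_scalars B M =
    \<lparr>carrier = carrier M, monoid.mult = monoid.mult M, one = one M,
     ring.zero = ring.zero M, ring.add = ring.add M,
     smult = (\<lambda>c m. (c \<odot>\<^bsub>B\<^esub> \<one>\<^bsub>B\<^esub>) \<odot>\<^bsub>M\<^esub> m)\<rparr>"

definition fin_dim :: "('k, 'r) ring_scheme \<Rightarrow> ('k, 'v, 'x) module_scheme \<Rightarrow> bool"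
  where "fin_dim K V \<longleftrightarrow> (\<exists>S. finite S \<and> S \<subseteq> carrier V \<and>
     (\<forall>v\<in>carrier V. \<exists>c\<in>S \<rightarrow> carrier K. v = (\<Oplus>\<^bsub>V\<^esub>s\<in>S. c s \<odot>\<^bsub>V\<^esub> s)))"

definition hom_module ::
  "('k, 'b, 'x) module_scheme \<Rightarrow> ('b, 'm, 'y) module_scheme \<Rightarrow> ('b, 'n, 'z) module_scheme
     \<Rightarrow> ('k, 'm \<Rightarrow> 'n) module"
  where "hom_module B M N =
    \<lparr>carrier = lmod_hom B M N, monoid.mult = undefined, one = undefined,
     ring.zero = (\<lambda>m\<in>carrier M. \<zero>\<^bsub>N\<^esub>),
     ring.add = (\<lambda>f g. \<lambda>m\<in>carrier M. f m \<oplus>\<^bsub>N\<^esub> g m),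
     smult = (\<lambda>c f. \<lambda>m\<in>carrier M. (c \<odot>\<^bsub>B\<^esub> \<one>\<^bsub>B\<^esub>) \<odot>\<^bsub>N\<^esub> f m)\<rparr>"


section \<open>Graded algebras and graded modules\<close>

record ('a, 'm) graded_module = "('a, 'm) module" +
  grade :: "int \<Rightarrow> 'm set"

definition homog_decomp :: "('a, 'm, 'x) graded_module_scheme \<Rightarrow> 'm \<Rightarrow> (int \<Rightarrow> 'm) \<Rightarrow> bool"
  where "homog_decomp V x f \<longleftrightarrow> (\<forall>i. f i \<in> grade V i) \<and> finite {i. f i \<noteq> \<zero>\<^bsub>V\<^esub>} \<and>
     x = (\<Oplus>\<^bsub>V\<^esub>i\<in>{i. f i \<noteq> \<zero>\<^bsub>V\<^esub>}. f i)"

definition is_grading :: "('a, 'm, 'x) graded_module_scheme \<Rightarrow> bool"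
  where "is_grading V \<longleftrightarrow> (\<forall>i. additive_subgroup (grade V i) V) \<and>
     (\<forall>x\<in>carrier V. \<exists>!f. homog_decomp V x f)"

definition component :: "('a, 'm, 'x) graded_module_scheme \<Rightarrow> 'm \<Rightarrow> int \<Rightarrow> 'm"
  where "component V x = (THE f. homog_decomp V x f)"

definition graded_algebra :: "('k, 'r) ring_scheme \<Rightarrow> ('k, 'b, 'x) graded_module_scheme \<Rightarrow> bool"
  where "graded_algebra K B \<longleftrightarrow> k_algebra K B \<and> is_grading B \<and> (\<forall>i. submodule (grade B i) K B) \<and>
     \<one>\<^bsub>B\<^esub> \<in> grade B 0 \<and>
     (\<forall>i j. \<forall>a\<in>grade B i. \<forall>b\<in>grade B j. a \<otimes>\<^bsub>B\<^esub> b \<in> grade B (i + j))"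

definition graded_left_module ::
  "('k, 'b, 'x) graded_module_scheme \<Rightarrow> ('b, 'm, 'y) graded_module_scheme \<Rightarrow> bool"
  where "graded_left_module B M \<longleftrightarrow> left_module B M \<and> is_grading M \<and>
     (\<forall>i j. \<forall>a\<in>grade B i. \<forall>m\<in>grade M j. a \<odot>\<^bsub>M\<^esub> m \<in> grade M (i + j))"

text \<open>The objects and morphisms of \<open>B\<close>-gr.\<close>

definition gr_obj ::
  "('k, 'r) ring_scheme \<Rightarrow> ('k, 'b, 'x) graded_module_scheme \<Rightarrow> ('b, 'm, 'y) graded_module_scheme \<Rightarrow> bool"
  where "gr_obj K B M \<longleftrightarrow> graded_left_module B M \<and> fin_dim K (restrict_scalars B M)"

definition gr_hom ::
  "('k, 'b, 'x) graded_module_scheme \<Rightarrow> ('b, 'm, 'y) graded_module_scheme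
     \<Rightarrow> ('b, 'n, 'z) graded_module_scheme \<Rightarrow> ('m \<Rightarrow> 'n) set"
  where "gr_hom B M N = {f \<in> lmod_hom B M N. \<forall>i. f ` grade M i \<subseteq> grade N i}"

definition gr_hom_module ::
  "('k, 'b, 'x) graded_module_scheme \<Rightarrow> ('b, 'm, 'y) graded_module_scheme
     \<Rightarrow> ('b, 'n, 'z) graded_module_scheme \<Rightarrow> ('k, 'm \<Rightarrow> 'n) module"
  where "gr_hom_module B M N = (hom_module B M N)\<lparr>carrier := gr_hom B M N\<rparr>"

definition shift ::
  "int \<Rightarrow> ('b, 'm, 'x) graded_module_scheme \<Rightarrow> ('b, 'm, 'x) graded_module_scheme"
  where "shift d U = U\<lparr>grade := (\<lambda>r. grade U (r + d))\<rparr>"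


section \<open>Twists by an automorphism\<close>

definition graded_aut ::
  "('k, 'r) ring_scheme \<Rightarrow> ('k, 'b, 'x) graded_module_scheme \<Rightarrow> ('b \<Rightarrow> 'b) \<Rightarrow> bool"
  where "graded_aut K B \<sigma> \<longleftrightarrow> \<sigma> \<in> ring_iso B B \<and>
     (\<forall>c\<in>carrier K. \<forall>b\<in>carrier B. \<sigma> (c \<odot>\<^bsub>B\<^esub> b) = c \<odot>\<^bsub>B\<^esub> \<sigma> b) \<and>
     (\<forall>i. \<sigma> ` grade B i \<subseteq> grade B i)"

definition aut_pow :: "('a, 'x) ring_scheme \<Rightarrow> ('a \<Rightarrow> 'a) \<Rightarrow> int \<Rightarrow> 'a \<Rightarrow> 'a"
  where "aut_pow B \<sigma> t = (if 0 \<le> t then \<sigma> ^^ nat t else inv_into (carrier B) \<sigma> ^^ nat (- t))"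

text \<open>\<open>B\<^sup>\<sigma>\<close>: since the powers of \<open>\<sigma>\<close> are additive, only the right factor of a product has to be
  decomposed into homogeneous components.\<close>

definition twisted_algebra ::
  "('k, 'b, 'x) graded_module_scheme \<Rightarrow> ('b \<Rightarrow> 'b) \<Rightarrow> ('k, 'b, 'x) graded_module_scheme"
  where "twisted_algebra B \<sigma> = B\<lparr>monoid.mult := (\<lambda>a b.
     \<Oplus>\<^bsub>B\<^esub>t\<in>{t. component B b t \<noteq> \<zero>\<^bsub>B\<^esub>}. aut_pow B \<sigma> t a \<otimes>\<^bsub>B\<^esub> component B b t)\<rparr>"

definition F_twist ::
  "('k, 'b, 'x) graded_module_scheme \<Rightarrow> ('b \<Rightarrow> 'b) \<Rightarrow> ('b, 'm, 'y) graded_module_scheme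
     \<Rightarrow> ('b, 'm, 'y) graded_module_scheme"
  where "F_twist B \<sigma> M = M\<lparr>smult := (\<lambda>b m.
     \<Oplus>\<^bsub>M\<^esub>r\<in>{r. component M m r \<noteq> \<zero>\<^bsub>M\<^esub>}. aut_pow B \<sigma> r b \<odot>\<^bsub>M\<^esub> component M m r)\<rparr>"

definition aut_twist ::
  "('b \<Rightarrow> 'b) \<Rightarrow> ('b, 'm, 'y) graded_module_scheme \<Rightarrow> ('b, 'm, 'y) graded_module_scheme"
  where "aut_twist \<alpha> M = M\<lparr>smult := (\<lambda>b m. \<alpha> b \<odot>\<^bsub>M\<^esub> m)\<rparr>"

definition twist_shift ::
  "('k, 'b, 'x) graded_module_scheme \<Rightarrow> ('b \<Rightarrow> 'b) \<Rightarrow> int \<Rightarrow> ('b, 'm, 'y) graded_module_scheme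
     \<Rightarrow> ('b, 'm, 'y) graded_module_scheme"
  where "twist_shift B \<sigma> d M = shift d (aut_twist (aut_pow B \<sigma> d) M)"


section \<open>Cohomology of complexes of vector spaces\<close>

definition quot_module :: "('k, 'v) module \<Rightarrow> 'v set \<Rightarrow> ('k, 'v set) module"
  where "quot_module V W =
    \<lparr>carrier = a_rcosets\<^bsub>V\<^esub> W, monoid.mult = undefined, one = undefined,
     ring.zero = W, ring.add = set_add V,
     smult = (\<lambda>c U. \<Union>x\<in>U. W +>\<^bsub>V\<^esub> (c \<odot>\<^bsub>V\<^esub> x))\<rparr>"

definition cocycles :: "(nat \<Rightarrow> ('k, 'v) module) \<Rightarrow> (nat \<Rightarrow> 'v \<Rightarrow> 'v) \<Rightarrow> nat \<Rightarrow> 'v set"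
  where "cocycles C \<delta> n = {f \<in> carrier (C n). \<delta> n f = \<zero>\<^bsub>C (Suc n)\<^esub>}"

definition coboundaries :: "(nat \<Rightarrow> ('k, 'v) module) \<Rightarrow> (nat \<Rightarrow> 'v \<Rightarrow> 'v) \<Rightarrow> nat \<Rightarrow> 'v set"
  where "coboundaries C \<delta> n =
    (case n of 0 \<Rightarrow> {\<zero>\<^bsub>C 0\<^esub>} | Suc m \<Rightarrow> \<delta> m ` carrier (C m))"

definition cohomology ::
  "(nat \<Rightarrow> ('k, 'v) module) \<Rightarrow> (nat \<Rightarrow> 'v \<Rightarrow> 'v) \<Rightarrow> nat \<Rightarrow> ('k, 'v set) module"
  where "cohomology C \<delta> n =
    quot_module ((C n)\<lparr>carrier := cocycles C \<delta> n\<rparr>) (coboundaries C \<delta> n)"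

text \<open>The map induced on classes by the degree \<open>n\<close> part \<open>\<phi>\<close> of a cochain map into \<open>(C, \<delta>)\<close>.\<close>

definition cohomology_map ::
  "(nat \<Rightarrow> ('k, 'w) module) \<Rightarrow> (nat \<Rightarrow> 'w \<Rightarrow> 'w) \<Rightarrow> nat \<Rightarrow> ('v \<Rightarrow> 'w) \<Rightarrow> 'v set \<Rightarrow> 'w set"
  where "cohomology_map C \<delta> n \<phi> U = (\<Union>f\<in>U. coboundaries C \<delta> n +>\<^bsub>C n\<^esub> \<phi> f)"

definition direct_sum :: "('i \<Rightarrow> ('k, 'v) module) \<Rightarrow> ('k, 'i \<Rightarrow> 'v) module"
  where "direct_sum V =
    \<lparr>carrier = {s. (\<forall>i. s i \<in> carrier (V i)) \<and> finite {i. s i \<noteq> \<zero>\<^bsub>V i\<^esub>}},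
     monoid.mult = undefined, one = undefined,
     ring.zero = (\<lambda>i. \<zero>\<^bsub>V i\<^esub>),
     ring.add = (\<lambda>s t i. s i \<oplus>\<^bsub>V i\<^esub> t i),
     smult = (\<lambda>c s i. c \<odot>\<^bsub>V i\<^esub> s i)\<rparr>"


section \<open>Projective resolutions\<close>

record ('a, 'u, 'm, 'x) resolution =
  obj :: "nat \<Rightarrow> ('a, 'u, 'x) module_scheme"
  diff :: "nat \<Rightarrow> 'u \<Rightarrow> 'u"
  aug :: "'u \<Rightarrow> 'm"

text \<open>Exactness of \<open>\<dots> \<rightarrow> P\<^sub>1 \<rightarrow> P\<^sub>0 \<rightarrow> M \<rightarrow> 0\<close>; here \<open>diff P n\<close> goes from \<open>P\<^sub>n\<^sub>+\<^sub>1\<close> to \<open>P\<^sub>n\<close>.\<close>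

definition exact_resolution ::
  "('a, 'u, 'm, 'x) resolution \<Rightarrow> ('a, 'm, 'y) module_scheme \<Rightarrow> bool"
  where "exact_resolution P M \<longleftrightarrow>
     aug P ` carrier (obj P 0) = carrier M \<and>
     a_kernel (obj P 0) M (aug P) = diff P 0 ` carrier (obj P 1) \<and>
     (\<forall>n. a_kernel (obj P (Suc n)) (obj P n) (diff P n)
          = diff P (Suc n) ` carrier (obj P (Suc (Suc n))))"

text \<open>A lift of \<open>h : M' \<rightarrow> M\<close> to resolutions \<open>P'\<close>, \<open>P\<close> of \<open>M'\<close>, \<open>M\<close>, where \<open>H n\<close> is the set of morphisms
  \<open>P'\<^sub>n \<rightarrow> P\<^sub>n\<close> of the category in question.\<close>

definition chain_lift ::
  "(nat \<Rightarrow> ('u \<Rightarrow> 'u) set) \<Rightarrow> ('a, 'u, 'm, 'x) resolution \<Rightarrow> ('a, 'u, 'm, 'x) resolution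
     \<Rightarrow> ('m \<Rightarrow> 'm) \<Rightarrow> nat \<Rightarrow> 'u \<Rightarrow> 'u"
  where "chain_lift H P' P h = (SOME \<phi>. (\<forall>n. \<phi> n \<in> H n) \<and>
     (\<forall>p\<in>carrier (obj P' 0). aug P (\<phi> 0 p) = h (aug P' p)) \<and>
     (\<forall>n. \<forall>p\<in>carrier (obj P' (Suc n)). diff P n (\<phi> (Suc n) p) = \<phi> n (diff P' n p)))"

text \<open>Projectivity is tested against modules whose elements have the type \<^typ>\<open>nat \<Rightarrow> 'b\<close>, where
  \<^typ>\<open>'b\<close> is the type of scalars, and resolutions are taken among these modules; a definition in HOL
  cannot quantify over modules on all types.  This restriction loses nothing, up to isomorphism:
  if \<^typ>\<open>'b\<close> has only one element, all modules are zero, and otherwise \<^typ>\<open>nat \<Rightarrow> 'b\<close> is infinite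
  and at least as large as \<^typ>\<open>'b\<close>.  Hence it has room for every finitely generated module and for
  the free module on the underlying set of any module on \<^typ>\<open>nat \<Rightarrow> 'b\<close>, so that a module on
  \<^typ>\<open>nat \<Rightarrow> 'b\<close> has the lifting property below if and only if it is projective in the category of
  all modules, and every finitely generated module has a resolution of this kind.\<close>

definition projective :: "('b, 'r) ring_scheme \<Rightarrow> ('b, nat \<Rightarrow> 'b) module \<Rightarrow> bool"
  where "projective R P \<longleftrightarrow> left_module R P \<and>
     (\<forall>(U :: ('b, nat \<Rightarrow> 'b) module) (V :: ('b, nat \<Rightarrow> 'b) module).
        left_module R U \<and> left_module R V \<longrightarrow>
        (\<forall>g\<in>lmod_hom R U V. \<forall>f\<in>lmod_hom R P V. g ` carrier U = carrier V \<longrightarrow>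
           (\<exists>h\<in>lmod_hom R P U. compose (carrier P) g h = f)))"

definition gr_projective ::
  "('k, 'r) ring_scheme \<Rightarrow> ('k, 'b, 'x) graded_module_scheme \<Rightarrow> ('b, nat \<Rightarrow> 'b) graded_module \<Rightarrow> bool"
  where "gr_projective K B P \<longleftrightarrow> gr_obj K B P \<and>
     (\<forall>(U :: ('b, nat \<Rightarrow> 'b) graded_module) (V :: ('b, nat \<Rightarrow> 'b) graded_module).
        gr_obj K B U \<and> gr_obj K B V \<longrightarrow>
        (\<forall>g\<in>gr_hom B U V. \<forall>f\<in>gr_hom B P V. g ` carrier U = carrier V \<longrightarrow>
           (\<exists>h\<in>gr_hom B P U. compose (carrier P) g h = f)))"

type_synonym ('b, 'm) mod_res = "('b, nat \<Rightarrow> 'b, 'm, unit) resolution"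

type_synonym ('b, 'm) gr_res =
  "('b, nat \<Rightarrow> 'b, 'm, \<lparr>grade :: int \<Rightarrow> (nat \<Rightarrow> 'b) set\<rparr>) resolution"

definition projective_resolution ::
  "('b, 'r) ring_scheme \<Rightarrow> ('b, 'm, 'y) module_scheme \<Rightarrow> ('b, 'm) mod_res \<Rightarrow> bool"
  where "projective_resolution R M P \<longleftrightarrow>
     (\<forall>n. projective R (obj P n)) \<and>
     (\<forall>n. diff P n \<in> lmod_hom R (obj P (Suc n)) (obj P n)) \<and>
     aug P \<in> lmod_hom R (obj P 0) M \<and> exact_resolution P M"

definition gr_projective_resolution ::
  "('k, 'r) ring_scheme \<Rightarrow> ('k, 'b, 'x) graded_module_scheme \<Rightarrow> ('b, 'm, 'y) graded_module_scheme
     \<Rightarrow> ('b, 'm) gr_res \<Rightarrow> bool"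
  where "gr_projective_resolution K B M P \<longleftrightarrow>
     (\<forall>n. gr_projective K B (obj P n)) \<and>
     (\<forall>n. diff P n \<in> gr_hom B (obj P (Suc n)) (obj P n)) \<and>
     aug P \<in> gr_hom B (obj P 0) M \<and> exact_resolution P M"

definition the_res :: "('b, 'r) ring_scheme \<Rightarrow> ('b, 'm, 'y) module_scheme \<Rightarrow> ('b, 'm) mod_res"
  where "the_res R M = (SOME P. projective_resolution R M P)"

definition the_gr_res ::
  "('k, 'r) ring_scheme \<Rightarrow> ('k, 'b, 'x) graded_module_scheme \<Rightarrow> ('b, 'm, 'y) graded_module_scheme
     \<Rightarrow> ('b, 'm) gr_res"
  where "the_gr_res K B M = (SOME P. gr_projective_resolution K B M P)"


section \<open>Ext of ordinary left modules\<close>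

definition ext_cochains ::
  "('k, 'b, 'x) module_scheme \<Rightarrow> ('b, 'm, 'y) module_scheme \<Rightarrow> ('b, 'n, 'z) module_scheme
     \<Rightarrow> nat \<Rightarrow> ('k, (nat \<Rightarrow> 'b) \<Rightarrow> 'n) module"
  where "ext_cochains R M N n = hom_module R (obj (the_res R M) n) N"

definition ext_diff ::
  "('k, 'b, 'x) module_scheme \<Rightarrow> ('b, 'm, 'y) module_scheme
     \<Rightarrow> nat \<Rightarrow> ((nat \<Rightarrow> 'b) \<Rightarrow> 'n) \<Rightarrow> (nat \<Rightarrow> 'b) \<Rightarrow> 'n"
  where "ext_diff R M n f =
     compose (carrier (obj (the_res R M) (Suc n))) f (diff (the_res R M) n)"

definition Ext ::
  "('k, 'b, 'x) module_scheme \<Rightarrow> nat \<Rightarrow> ('b, 'm, 'y) module_scheme \<Rightarrow> ('b, 'n, 'z) module_scheme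
     \<Rightarrow> ('k, ((nat \<Rightarrow> 'b) \<Rightarrow> 'n) set) module"
  where "Ext R n M N = cohomology (ext_cochains R M N) (ext_diff R M) n"

text \<open>The functoriality of Ext: \<open>Ext_covar R n M N' g\<close> is \<open>Ext\<^sup>n(M, g)\<close> for \<open>g : N \<rightarrow> N'\<close>,
  and \<open>Ext_contra R n M' M h N\<close> is \<open>Ext\<^sup>n(h, N)\<close> for \<open>h : M' \<rightarrow> M\<close>.\<close>

definition Ext_covar ::
  "('k, 'b, 'x) module_scheme \<Rightarrow> nat \<Rightarrow> ('b, 'm, 'y) module_scheme \<Rightarrow> ('b, 'n, 'z) module_scheme
     \<Rightarrow> ('n \<Rightarrow> 'n) \<Rightarrow> ((nat \<Rightarrow> 'b) \<Rightarrow> 'n) set \<Rightarrow> ((nat \<Rightarrow> 'b) \<Rightarrow> 'n) set"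
  where "Ext_covar R n M N' g = cohomology_map (ext_cochains R M N') (ext_diff R M) n
     (\<lambda>f. compose (carrier (obj (the_res R M) n)) g f)"

definition Ext_contra ::
  "('k, 'b, 'x) module_scheme \<Rightarrow> nat \<Rightarrow> ('b, 'm, 'y) module_scheme \<Rightarrow> ('b, 'm, 'y) module_scheme
     \<Rightarrow> ('m \<Rightarrow> 'm) \<Rightarrow> ('b, 'n, 'z) module_scheme
     \<Rightarrow> ((nat \<Rightarrow> 'b) \<Rightarrow> 'n) set \<Rightarrow> ((nat \<Rightarrow> 'b) \<Rightarrow> 'n) set"
  where "Ext_contra R n M' M h N = cohomology_map (ext_cochains R M' N) (ext_diff R M') n
     (\<lambda>f. compose (carrier (obj (the_res R M') n)) f
        (chain_lift (\<lambda>i. lmod_hom R (obj (the_res R M') i) (obj (the_res R M) i))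
           (the_res R M') (the_res R M) h n))"


section \<open>Ext in the category of finite-dimensional graded modules\<close>

definition gr_ext_cochains ::
  "('k, 'r) ring_scheme \<Rightarrow> ('k, 'b, 'x) graded_module_scheme \<Rightarrow> ('b, 'm, 'y) graded_module_scheme
     \<Rightarrow> ('b, 'n, 'z) graded_module_scheme \<Rightarrow> nat \<Rightarrow> ('k, (nat \<Rightarrow> 'b) \<Rightarrow> 'n) module"
  where "gr_ext_cochains K B M N n = gr_hom_module B (obj (the_gr_res K B M) n) N"

definition gr_ext_diff ::
  "('k, 'r) ring_scheme \<Rightarrow> ('k, 'b, 'x) graded_module_scheme \<Rightarrow> ('b, 'm, 'y) graded_module_scheme
     \<Rightarrow> nat \<Rightarrow> ((nat \<Rightarrow> 'b) \<Rightarrow> 'n) \<Rightarrow> (nat \<Rightarrow> 'b) \<Rightarrow> 'n"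
  where "gr_ext_diff K B M n f =
     compose (carrier (obj (the_gr_res K B M) (Suc n))) f (diff (the_gr_res K B M) n)"

definition gr_Ext ::
  "('k, 'r) ring_scheme \<Rightarrow> ('k, 'b, 'x) graded_module_scheme \<Rightarrow> nat
     \<Rightarrow> ('b, 'm, 'y) graded_module_scheme \<Rightarrow> ('b, 'n, 'z) graded_module_scheme
     \<Rightarrow> ('k, ((nat \<Rightarrow> 'b) \<Rightarrow> 'n) set) module"
  where "gr_Ext K B n M N = cohomology (gr_ext_cochains K B M N) (gr_ext_diff K B M) n"

definition gr_Ext_covar ::
  "('k, 'r) ring_scheme \<Rightarrow> ('k, 'b, 'x) graded_module_scheme \<Rightarrow> nat
     \<Rightarrow> ('b, 'm, 'y) graded_module_scheme \<Rightarrow> ('b, 'n, 'z) graded_module_scheme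
     \<Rightarrow> ('n \<Rightarrow> 'n) \<Rightarrow> ((nat \<Rightarrow> 'b) \<Rightarrow> 'n) set \<Rightarrow> ((nat \<Rightarrow> 'b) \<Rightarrow> 'n) set"
  where "gr_Ext_covar K B n M N' g = cohomology_map (gr_ext_cochains K B M N') (gr_ext_diff K B M) n
     (\<lambda>f. compose (carrier (obj (the_gr_res K B M) n)) g f)"

definition gr_Ext_contra ::
  "('k, 'r) ring_scheme \<Rightarrow> ('k, 'b, 'x) graded_module_scheme \<Rightarrow> nat
     \<Rightarrow> ('b, 'm, 'y) graded_module_scheme \<Rightarrow> ('b, 'm, 'y) graded_module_scheme
     \<Rightarrow> ('m \<Rightarrow> 'm) \<Rightarrow> ('b, 'n, 'z) graded_module_scheme
     \<Rightarrow> ((nat \<Rightarrow> 'b) \<Rightarrow> 'n) set \<Rightarrow> ((nat \<Rightarrow> 'b) \<Rightarrow> 'n) set"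
  where "gr_Ext_contra K B n M' M h N =
     cohomology_map (gr_ext_cochains K B M' N) (gr_ext_diff K B M') n
     (\<lambda>f. compose (carrier (obj (the_gr_res K B M') n)) f
        (chain_lift (\<lambda>i. gr_hom B (obj (the_gr_res K B M') i) (obj (the_gr_res K B M) i))
           (the_gr_res K B M') (the_gr_res K B M) h n))"


section \<open>The two bifunctors to be compared\<close>

definition Ext_F ::
  "('k, 'b, 'x) graded_module_scheme \<Rightarrow> ('b \<Rightarrow> 'b) \<Rightarrow> nat
     \<Rightarrow> ('b, 'm, 'y) graded_module_scheme \<Rightarrow> ('b, 'n, 'z) graded_module_scheme
     \<Rightarrow> ('k, ((nat \<Rightarrow> 'b) \<Rightarrow> 'n) set) module"
  where "Ext_F B \<sigma> n M N = Ext (twisted_algebra B \<sigma>) n (F_twist B \<sigma> M) (F_twist B \<sigma> N)"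

definition sum_gr_Ext ::
  "('k, 'r) ring_scheme \<Rightarrow> ('k, 'b, 'x) graded_module_scheme \<Rightarrow> ('b \<Rightarrow> 'b) \<Rightarrow> nat
     \<Rightarrow> ('b, 'm, 'y) graded_module_scheme \<Rightarrow> ('b, 'n, 'z) graded_module_scheme
     \<Rightarrow> ('k, int \<Rightarrow> ((nat \<Rightarrow> 'b) \<Rightarrow> 'n) set) module"
  where "sum_gr_Ext K B \<sigma> n M N = direct_sum (\<lambda>d. gr_Ext K B n M (twist_shift B \<sigma> d N))"

text \<open>Naturality in both arguments.  A morphism \<open>g\<close> of \<open>B\<close>-gr has the underlying map \<open>g\<close> again
  after applying \<open>F\<^sub>\<sigma>\<close>, and also as a morphism between the twisted and shifted modules.\<close>

definition natural_family ::
  "('k, 'r) ring_scheme \<Rightarrow> ('k, 'b, 'x) graded_module_scheme \<Rightarrow> ('b \<Rightarrow> 'b) \<Rightarrow> nat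
     \<Rightarrow> (('b, 'm) graded_module \<Rightarrow> ('b, 'm) graded_module
        \<Rightarrow> ((nat \<Rightarrow> 'b) \<Rightarrow> 'm) set \<Rightarrow> int \<Rightarrow> ((nat \<Rightarrow> 'b) \<Rightarrow> 'm) set) \<Rightarrow> bool"
  where "natural_family K B \<sigma> n \<Phi> \<longleftrightarrow>
     (\<forall>M N. gr_obj K B M \<and> gr_obj K B N \<longrightarrow>
        \<Phi> M N \<in> lmod_hom K (Ext_F B \<sigma> n M N) (sum_gr_Ext K B \<sigma> n M N)) \<and>
     (\<forall>M N N'. gr_obj K B M \<and> gr_obj K B N \<and> gr_obj K B N' \<longrightarrow>
        (\<forall>g\<in>gr_hom B N N'. \<forall>x\<in>carrier (Ext_F B \<sigma> n M N).
           \<Phi> M N' (Ext_covar (twisted_algebra B \<sigma>) n (F_twist B \<sigma> M) (F_twist B \<sigma> N') g x)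
           = (\<lambda>d. gr_Ext_covar K B n M (twist_shift B \<sigma> d N') g (\<Phi> M N x d)))) \<and>
     (\<forall>M M' N. gr_obj K B M \<and> gr_obj K B M' \<and> gr_obj K B N \<longrightarrow>
        (\<forall>h\<in>gr_hom B M' M. \<forall>x\<in>carrier (Ext_F B \<sigma> n M N).
           \<Phi> M' N (Ext_contra (twisted_algebra B \<sigma>) n (F_twist B \<sigma> M') (F_twist B \<sigma> M) h
              (F_twist B \<sigma> N) x)
           = (\<lambda>d. gr_Ext_contra K B n M' M h (twist_shift B \<sigma> d N) (\<Phi> M N x d))))"

end

theory Submission
  imports Defs
begin

text \<open>
  Write \<open>F\<close> for \<open>F\<^sub>\<sigma>\<close> and \<open>N\<^sub>d\<close> for the twisted shift of \<open>N\<close> by \<open>d\<close>.  The theorem rests on an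
  observation about homomorphisms.  A map \<open>f : F M \<rightarrow> F N\<close> over \<open>B\<^sup>\<sigma>\<close> need not respect degrees, but it is
  the sum of its homogeneous parts \<open>f\<^sub>d\<close>, where \<open>f\<^sub>d x\<close> is the component of \<open>f x\<close> in degree \<open>r + d\<close> for
  \<open>x \<in> M\<^sub>r\<close>.  Since \<open>b \<in> B\<close> acts on \<open>(F M)\<^sub>r\<close> as \<open>\<sigma>\<^sup>r(b)\<close> acts on \<open>M\<^sub>r\<close>, linearity of \<open>f\<close>, read degree by
  degree, says that \<open>f\<^sub>d (b x) = \<sigma>\<^sup>d(b) f\<^sub>d x\<close>, that is, that \<open>f\<^sub>d\<close> is a morphism \<open>M \<rightarrow> N\<^sub>d\<close> of graded
  modules.  Only finitely many degrees occur in \<open>M\<close> and \<open>N\<close>, so almost all \<open>f\<^sub>d\<close> vanish, and the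
  homomorphisms \<open>F M \<rightarrow> F N\<close> are the direct sum of the spaces of morphisms \<open>M \<rightarrow> N\<^sub>d\<close>
  (\<open>hom_part_gr_hom\<close>, \<open>hom_part_finite\<close>, \<open>hom_parts_determine\<close>, \<open>hom_parts_surjective\<close>).

  To pass from homomorphisms to Ext, let \<open>P\<close> be a graded projective resolution of \<open>M\<close>.  The functor \<open>F\<close> is
  exact because it changes neither spaces nor maps, and it turns graded projective modules into
  projective ones: a graded projective module is a summand of a graded free module, and \<open>F\<close> of a
  graded free module is free over \<open>B\<^sup>\<sigma>\<close> on the same homogeneous basis, since \<open>b * e = \<sigma>\<^sup>r(b) e\<close> for \<open>e\<close> of
  degree \<open>r\<close> and \<open>\<sigma>\<^sup>r\<close> is bijective (\<open>free_F_hom\<close>, \<open>projective_F0\<close>).  Hence \<open>F P\<close> is a projective resolution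
  of \<open>F M\<close>, and taking homogeneous parts identifies the complex of homomorphisms \<open>F P \<rightarrow> F N\<close> with the
  direct sum of the complexes of morphisms \<open>P \<rightarrow> N\<^sub>d\<close>.

  The Ext groups over \<open>B\<^sup>\<sigma>\<close> are defined by an unrelated projective resolution of \<open>F M\<close>.  A chain map from
  \<open>F P\<close> to it over the identity of \<open>F M\<close> exists, is unique up to homotopy, and has a homotopy inverse
  (\<open>projective_chain_lift_exists\<close>, \<open>projective_homotopy\<close>).  The isomorphism \<open>ext_iso\<close> pulls a cocycle back
  along this chain map and then takes homogeneous parts.  The homotopy inverse makes it bijective, and
  uniqueness up to homotopy makes it natural in \<open>M\<close>; naturality in \<open>N\<close> holds for the cochains themselves.
\<close>

section \<open>Homomorphisms of left modules\<close>

lemma (in left_module) lsmult_zero: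
  assumes "a \<in> carrier R" shows "a \<odot>\<^bsub>M\<^esub> \<zero>\<^bsub>M\<^esub> = \<zero>\<^bsub>M\<^esub>"
proof -
  have "a \<odot>\<^bsub>M\<^esub> \<zero>\<^bsub>M\<^esub> \<oplus>\<^bsub>M\<^esub> a \<odot>\<^bsub>M\<^esub> \<zero>\<^bsub>M\<^esub> = a \<odot>\<^bsub>M\<^esub> \<zero>\<^bsub>M\<^esub>"
    using lsmult_r_distr[OF assms M.zero_closed M.zero_closed] M.l_zero[OF M.zero_closed] by simp
  then show ?thesis using lsmult_closed[OF assms M.zero_closed] by (metis M.add.r_cancel_one')
qed

lemma (in left_module) lsmult_minus:
  assumes "a \<in> carrier R" "x \<in> carrier M" shows "a \<odot>\<^bsub>M\<^esub> (\<ominus>\<^bsub>M\<^esub> x) = \<ominus>\<^bsub>M\<^esub> (a \<odot>\<^bsub>M\<^esub> x)"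
proof -
  have "a \<odot>\<^bsub>M\<^esub> (\<ominus>\<^bsub>M\<^esub> x) \<oplus>\<^bsub>M\<^esub> a \<odot>\<^bsub>M\<^esub> x = \<zero>\<^bsub>M\<^esub>"
    using lsmult_r_distr[of a "\<ominus>\<^bsub>M\<^esub> x" x] assms lsmult_zero M.l_neg by simp
  then show ?thesis using assms lsmult_closed M.minus_equality by simp
qed

lemma (in left_module) lsmult_diff:
  assumes "a \<in> carrier R" "x \<in> carrier M" "y \<in> carrier M"
  shows "a \<odot>\<^bsub>M\<^esub> (x \<ominus>\<^bsub>M\<^esub> y) = a \<odot>\<^bsub>M\<^esub> x \<ominus>\<^bsub>M\<^esub> a \<odot>\<^bsub>M\<^esub> y"
  using assms by (simp add: a_minus_def lsmult_r_distr lsmult_minus)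

lemma left_module_abelian_group: "left_module R M \<Longrightarrow> abelian_group M"
  by (auto simp: left_module_def)

lemma lmod_homI:
  assumes "f \<in> extensional (carrier M)" "\<And>x. x \<in> carrier M \<Longrightarrow> f x \<in> carrier N"
    "\<And>x y. \<lbrakk>x \<in> carrier M; y \<in> carrier M\<rbrakk> \<Longrightarrow> f (x \<oplus>\<^bsub>M\<^esub> y) = f x \<oplus>\<^bsub>N\<^esub> f y"
    "\<And>a x. \<lbrakk>a \<in> carrier R; x \<in> carrier M\<rbrakk> \<Longrightarrow> f (a \<odot>\<^bsub>M\<^esub> x) = a \<odot>\<^bsub>N\<^esub> f x"
  shows "f \<in> lmod_hom R M N"
  using assms by (auto simp: lmod_hom_def PiE_def)

lemma lmod_hom_restrictI:
  assumes "left_module R M" "\<And>x. x \<in> carrier M \<Longrightarrow> f x \<in> carrier N"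
    "\<And>x y. \<lbrakk>x \<in> carrier M; y \<in> carrier M\<rbrakk> \<Longrightarrow> f (x \<oplus>\<^bsub>M\<^esub> y) = f x \<oplus>\<^bsub>N\<^esub> f y"
    "\<And>a x. \<lbrakk>a \<in> carrier R; x \<in> carrier M\<rbrakk> \<Longrightarrow> f (a \<odot>\<^bsub>M\<^esub> x) = a \<odot>\<^bsub>N\<^esub> f x"
  shows "restrict f (carrier M) \<in> lmod_hom R M N"
proof -
  interpret M: left_module R M by fact
  show ?thesis using assms(2-4) by (intro lmod_homI) (auto simp: M.lsmult_closed)
qed

lemma lmod_hom_closed: "\<lbrakk>f \<in> lmod_hom R M N; x \<in> carrier M\<rbrakk> \<Longrightarrow> f x \<in> carrier N"
  and lmod_hom_add: "\<lbrakk>f \<in> lmod_hom R M N; x \<in> carrier M; y \<in> carrier M\<rbrakk>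
    \<Longrightarrow> f (x \<oplus>\<^bsub>M\<^esub> y) = f x \<oplus>\<^bsub>N\<^esub> f y"
  and lmod_hom_smult: "\<lbrakk>f \<in> lmod_hom R M N; a \<in> carrier R; x \<in> carrier M\<rbrakk>
    \<Longrightarrow> f (a \<odot>\<^bsub>M\<^esub> x) = a \<odot>\<^bsub>N\<^esub> f x"
  and lmod_hom_extensional: "f \<in> lmod_hom R M N \<Longrightarrow> f \<in> extensional (carrier M)"
  by (auto simp: lmod_hom_def PiE_def)

lemma lmod_hom_zero:
  assumes "f \<in> lmod_hom R M N" "abelian_group M" "abelian_group N"
  shows "f \<zero>\<^bsub>M\<^esub> = \<zero>\<^bsub>N\<^esub>"
proof -
  interpret M: abelian_group M by fact
  interpret N: abelian_group N by fact
  have "f \<zero>\<^bsub>M\<^esub> \<oplus>\<^bsub>N\<^esub> f \<zero>\<^bsub>M\<^esub> = f \<zero>\<^bsub>M\<^esub>"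
    using lmod_hom_add[OF assms(1) M.zero_closed M.zero_closed] by simp
  then show ?thesis using lmod_hom_closed[OF assms(1) M.zero_closed] by (metis N.add.r_cancel_one')
qed

lemma lmod_hom_minus:
  assumes "f \<in> lmod_hom R M N" "abelian_group M" "abelian_group N" "x \<in> carrier M"
  shows "f (\<ominus>\<^bsub>M\<^esub> x) = \<ominus>\<^bsub>N\<^esub> f x"
proof -
  interpret M: abelian_group M by fact
  interpret N: abelian_group N by fact
  have "f (\<ominus>\<^bsub>M\<^esub> x) \<oplus>\<^bsub>N\<^esub> f x = \<zero>\<^bsub>N\<^esub>"
    using lmod_hom_add[OF assms(1), of "\<ominus>\<^bsub>M\<^esub> x" x] assms(4) lmod_hom_zero[OF assms(1-3)]
    by (simp add: M.l_neg)
  then show ?thesis using lmod_hom_closed[OF assms(1)] assms(4) by (simp add: N.minus_equality)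
qed

lemma lmod_hom_diff_elem:
  assumes "f \<in> lmod_hom R M N" "abelian_group M" "abelian_group N" "x \<in> carrier M" "y \<in> carrier M"
  shows "f (x \<ominus>\<^bsub>M\<^esub> y) = f x \<ominus>\<^bsub>N\<^esub> f y"
proof -
  interpret M: abelian_group M by fact
  show ?thesis using assms by (simp add: a_minus_def lmod_hom_add lmod_hom_minus)
qed

lemma lmod_hom_compose:
  assumes "left_module R M" "f \<in> lmod_hom R M N" "g \<in> lmod_hom R N L"
  shows "compose (carrier M) g f \<in> lmod_hom R M L"
  unfolding compose_def
  using assms by (intro lmod_hom_restrictI) (auto simp: lmod_hom_add lmod_hom_smult lmod_hom_closed)

lemma (in abelian_group) diff_add_swap:
  assumes "a \<in> carrier G" "b \<in> carrier G" "c \<in> carrier G" "d \<in> carrier G"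
  shows "(a \<oplus> b) \<ominus> (c \<oplus> d) = (a \<ominus> c) \<oplus> (b \<ominus> d)"
  using assms by (simp add: a_minus_def minus_add a_ac)

lemma lmod_hom_diff:
  assumes "left_module R M" "left_module R N" "f \<in> lmod_hom R M N" "g \<in> lmod_hom R M N"
  shows "(\<lambda>x\<in>carrier M. f x \<ominus>\<^bsub>N\<^esub> g x) \<in> lmod_hom R M N"
proof -
  interpret N: left_module R N by fact
  show ?thesis using assms
    by (intro lmod_hom_restrictI)
      (auto simp: lmod_hom_add lmod_hom_smult lmod_hom_closed N.lsmult_diff intro!: N.M.diff_add_swap)
qed

section \<open>Vector spaces of homomorphisms\<close>

lemma (in k_algebra) kone_closed: "c \<in> carrier K \<Longrightarrow> c \<odot>\<^bsub>B\<^esub> \<one>\<^bsub>B\<^esub> \<in> carrier B"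
  by (simp add: KB.smult_closed)

lemma (in k_algebra) kone_l: "\<lbrakk>c \<in> carrier K; b \<in> carrier B\<rbrakk>
    \<Longrightarrow> (c \<odot>\<^bsub>B\<^esub> \<one>\<^bsub>B\<^esub>) \<otimes>\<^bsub>B\<^esub> b = c \<odot>\<^bsub>B\<^esub> b"
  by (simp add: scal_assoc_l)

lemma (in k_algebra) kone_r: "\<lbrakk>c \<in> carrier K; b \<in> carrier B\<rbrakk>
    \<Longrightarrow> b \<otimes>\<^bsub>B\<^esub> (c \<odot>\<^bsub>B\<^esub> \<one>\<^bsub>B\<^esub>) = c \<odot>\<^bsub>B\<^esub> b"
  by (simp add: scal_assoc_r)

lemma module_restrict_scalars:
  assumes "k_algebra K B" "left_module B M"
  shows "module K (restrict_scalars B M)"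
proof -
  interpret k_algebra K B by fact
  interpret M: left_module B M by fact
  interpret K: field K by unfold_locales
  have cr: "cring K" by unfold_locales
  show ?thesis
  proof (rule moduleI[OF cr])
    show "abelian_group (restrict_scalars B M)"
      by (rule abelian_groupI) (auto simp: restrict_scalars_def M.M.a_ac intro: M.M.l_neg)
  next
    fix a b x assume a: "a \<in> carrier K" and b: "b \<in> carrier K" and x: "x \<in> carrier (restrict_scalars B M)"
    have "(a \<otimes>\<^bsub>K\<^esub> b) \<odot>\<^bsub>B\<^esub> \<one>\<^bsub>B\<^esub> = (a \<odot>\<^bsub>B\<^esub> \<one>\<^bsub>B\<^esub>) \<otimes>\<^bsub>B\<^esub> (b \<odot>\<^bsub>B\<^esub> \<one>\<^bsub>B\<^esub>)"
      using a b by (simp add: kone_l KB.smult_assoc1)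
    then show "(a \<otimes>\<^bsub>K\<^esub> b) \<odot>\<^bsub>restrict_scalars B M\<^esub> x =
       a \<odot>\<^bsub>restrict_scalars B M\<^esub> (b \<odot>\<^bsub>restrict_scalars B M\<^esub> x)"
      using a b x by (simp add: restrict_scalars_def M.lsmult_assoc kone_closed)
  qed (simp_all add: restrict_scalars_def M.lsmult_closed M.lsmult_l_distr M.lsmult_r_distr M.lsmult_one
      KB.smult_l_distr kone_closed)
qed

lemma hom_module_sel:
  "carrier (hom_module B M N) = lmod_hom B M N"
  "\<zero>\<^bsub>hom_module B M N\<^esub> = (\<lambda>m\<in>carrier M. \<zero>\<^bsub>N\<^esub>)"
  "f \<oplus>\<^bsub>hom_module B M N\<^esub> g = (\<lambda>m\<in>carrier M. f m \<oplus>\<^bsub>N\<^esub> g m)"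
  "c \<odot>\<^bsub>hom_module B M N\<^esub> f = (\<lambda>m\<in>carrier M. (c \<odot>\<^bsub>B\<^esub> \<one>\<^bsub>B\<^esub>) \<odot>\<^bsub>N\<^esub> f m)"
  by (simp_all add: hom_module_def)

text \<open>The subset \<open>H\<close> makes this applicable to all linear maps as well as to the degree-preserving ones.\<close>

lemma module_hom_subspace:
  assumes kB: "k_algebra K B" and "left_module B M" and lN: "left_module B N"
    and H: "H \<subseteq> lmod_hom B M N" and H0: "\<zero>\<^bsub>hom_module B M N\<^esub> \<in> H"
    and Ha: "\<And>f g. \<lbrakk>f \<in> H; g \<in> H\<rbrakk> \<Longrightarrow> f \<oplus>\<^bsub>hom_module B M N\<^esub> g \<in> H"
    and Hs: "\<And>c f. \<lbrakk>c \<in> carrier K; f \<in> H\<rbrakk> \<Longrightarrow> c \<odot>\<^bsub>hom_module B M N\<^esub> f \<in> H"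
  shows "module K ((hom_module B M N)\<lparr>carrier := H\<rparr>)"
proof -
  interpret k_algebra K B by fact
  interpret N: left_module B N by fact
  interpret rN: module K "restrict_scalars B N" by (rule module_restrict_scalars[OF kB lN])
  have cr: "cring K" by unfold_locales
  have cl: "f m \<in> carrier N" if "f \<in> H" "m \<in> carrier M" for f m
    using that H by (auto intro: lmod_hom_closed)
  have ex: "f \<in> extensional (carrier M)" if "f \<in> H" for f
    using that H by (auto intro: lmod_hom_extensional)
  have rsel: "carrier (restrict_scalars B N) = carrier N" "ring.add (restrict_scalars B N) = ring.add N"
    "ring.zero (restrict_scalars B N) = ring.zero N"
    "smult (restrict_scalars B N) = (\<lambda>c m. (c \<odot>\<^bsub>B\<^esub> \<one>\<^bsub>B\<^esub>) \<odot>\<^bsub>N\<^esub> m)" by (simp_all add: restrict_scalars_def)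
  have neg: "(\<lambda>m\<in>carrier M. \<ominus>\<^bsub>N\<^esub> f m) \<in> H" if f: "f \<in> H" for f
  proof -
    have "(\<ominus>\<^bsub>K\<^esub> \<one>\<^bsub>K\<^esub>) \<odot>\<^bsub>hom_module B M N\<^esub> f = (\<lambda>m\<in>carrier M. \<ominus>\<^bsub>N\<^esub> f m)"
    proof (rule extensionalityI[of _ "carrier M"])
      fix m assume m: "m \<in> carrier M"
      have "(\<ominus>\<^bsub>K\<^esub> \<one>\<^bsub>K\<^esub>) \<odot>\<^bsub>restrict_scalars B N\<^esub> f m = \<ominus>\<^bsub>restrict_scalars B N\<^esub> f m"
        using rN.smult_l_minus[of "\<one>\<^bsub>K\<^esub>" "f m"] cl[OF f m] rN.smult_one[of "f m"] by (simp add: rsel)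
      moreover have "\<ominus>\<^bsub>restrict_scalars B N\<^esub> f m = \<ominus>\<^bsub>N\<^esub> f m"
        by (simp add: a_inv_def m_inv_def rsel)
      ultimately show "((\<ominus>\<^bsub>K\<^esub> \<one>\<^bsub>K\<^esub>) \<odot>\<^bsub>hom_module B M N\<^esub> f) m = (\<lambda>m\<in>carrier M. \<ominus>\<^bsub>N\<^esub> f m) m"
        using m by (simp add: hom_module_sel rsel)
    qed (simp_all add: hom_module_sel)
    then show ?thesis using Hs[of "\<ominus>\<^bsub>K\<^esub> \<one>\<^bsub>K\<^esub>" f] f by simp
  qed
  let ?H = "(hom_module B M N)\<lparr>carrier := H\<rparr>"
  show ?thesis
  proof (rule moduleI[OF cr])
    show "abelian_group ?H"
    proof (rule abelian_groupI)
      fix f assume f: "f \<in> carrier ?H"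
      then show "\<exists>g\<in>carrier ?H. g \<oplus>\<^bsub>?H\<^esub> f = \<zero>\<^bsub>?H\<^esub>"
        by (intro bexI[of _ "\<lambda>m\<in>carrier M. \<ominus>\<^bsub>N\<^esub> f m"])
          (auto simp: hom_module_sel neg cl N.M.l_neg intro!: restrict_ext)
      show "\<zero>\<^bsub>?H\<^esub> \<oplus>\<^bsub>?H\<^esub> f = f"
        using f by (intro extensionalityI[of _ "carrier M"]) (auto simp: hom_module_sel cl ex)
    qed (use H0 Ha in \<open>auto simp: hom_module_sel cl N.M.a_ac intro!: restrict_ext\<close>)
  next
    fix f assume f: "f \<in> carrier ?H"
    then show "\<one>\<^bsub>K\<^esub> \<odot>\<^bsub>?H\<^esub> f = f"
      using rN.smult_one by (intro extensionalityI[of _ "carrier M"]) (auto simp: hom_module_sel cl ex rsel)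
  next
    fix a b f assume "a \<in> carrier K" "b \<in> carrier K" "f \<in> carrier ?H"
    then show "(a \<otimes>\<^bsub>K\<^esub> b) \<odot>\<^bsub>?H\<^esub> f = a \<odot>\<^bsub>?H\<^esub> (b \<odot>\<^bsub>?H\<^esub> f)"
      using rN.smult_assoc1 by (auto simp: hom_module_sel cl rsel intro!: restrict_ext)
  next
    fix a b f assume "a \<in> carrier K" "b \<in> carrier K" "f \<in> carrier ?H"
    then show "(a \<oplus>\<^bsub>K\<^esub> b) \<odot>\<^bsub>?H\<^esub> f = a \<odot>\<^bsub>?H\<^esub> f \<oplus>\<^bsub>?H\<^esub> b \<odot>\<^bsub>?H\<^esub> f"
      using rN.smult_l_distr by (auto simp: hom_module_sel cl rsel intro!: restrict_ext)
  next
    fix a f g assume "a \<in> carrier K" "f \<in> carrier ?H" "g \<in> carrier ?H"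
    then show "a \<odot>\<^bsub>?H\<^esub> (f \<oplus>\<^bsub>?H\<^esub> g) = a \<odot>\<^bsub>?H\<^esub> f \<oplus>\<^bsub>?H\<^esub> a \<odot>\<^bsub>?H\<^esub> g"
      using rN.smult_r_distr by (auto simp: hom_module_sel cl rsel intro!: restrict_ext)
  qed (use Hs in simp)
qed

text \<open>A scalar multiple of a linear map is again linear because \<open>c 1\<^sub>B\<close> is central in \<open>B\<close>.\<close>

lemma hom_module_closed:
  assumes "k_algebra K B" "left_module B M" "left_module B N"
  shows "\<zero>\<^bsub>hom_module B M N\<^esub> \<in> lmod_hom B M N"
    and "\<lbrakk>f \<in> lmod_hom B M N; g \<in> lmod_hom B M N\<rbrakk> \<Longrightarrow> f \<oplus>\<^bsub>hom_module B M N\<^esub> g \<in> lmod_hom B M N"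
    and "\<lbrakk>c \<in> carrier K; f \<in> lmod_hom B M N\<rbrakk> \<Longrightarrow> c \<odot>\<^bsub>hom_module B M N\<^esub> f \<in> lmod_hom B M N"
proof -
  interpret k_algebra K B by fact
  interpret N: left_module B N by fact
  show "\<zero>\<^bsub>hom_module B M N\<^esub> \<in> lmod_hom B M N"
    unfolding hom_module_sel by (rule lmod_hom_restrictI[OF assms(2)]) (auto simp: N.lsmult_zero)
  show "f \<oplus>\<^bsub>hom_module B M N\<^esub> g \<in> lmod_hom B M N" if "f \<in> lmod_hom B M N" "g \<in> lmod_hom B M N"
    unfolding hom_module_sel using that
    by (intro lmod_hom_restrictI[OF assms(2)])
      (auto simp: lmod_hom_closed lmod_hom_add lmod_hom_smult N.lsmult_r_distr N.M.a_ac)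
  show "c \<odot>\<^bsub>hom_module B M N\<^esub> f \<in> lmod_hom B M N" if "c \<in> carrier K" "f \<in> lmod_hom B M N"
    unfolding hom_module_sel using that kone_l kone_r kone_closed
    by (intro lmod_hom_restrictI[OF assms(2)])
      (auto simp: lmod_hom_closed lmod_hom_add lmod_hom_smult N.lsmult_r_distr N.lsmult_closed
        simp flip: N.lsmult_assoc)
qed

section \<open>Lifting through projective modules\<close>

text \<open>Projectivity is tested by surjections between modules on one fixed type.  It yields liftings against
  a target \<open>V\<close> on any type, along maps \<open>g\<close> that need not be surjective: choosing a preimage under \<open>g\<close> for
  each element of the image of \<open>g\<close> moves this image to the type of \<open>U\<close>.\<close>

lemma projective_lift:
  fixes V :: "('b, 'v, 'y) module_scheme" and U P :: "('b, nat \<Rightarrow> 'b) module"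
  assumes P: "projective R P" and U: "left_module R U" and V: "left_module R V"
    and g: "g \<in> lmod_hom R U V" and f: "f \<in> lmod_hom R P V" and im: "f ` carrier P \<subseteq> g ` carrier U"
  shows "\<exists>h\<in>lmod_hom R P U. \<forall>x\<in>carrier P. g (h x) = f x"
proof -
  interpret U: left_module R U by fact
  interpret V: left_module R V by fact
  define \<iota> where "\<iota> = inv_into (carrier U) g"
  have \<iota>: "g (\<iota> v) = v" "\<iota> v \<in> carrier U" if "v \<in> g ` carrier U" for v
    using that by (auto simp: \<iota>_def f_inv_into_f inv_into_into)
  \<comment> \<open>The image of \<open>g\<close>, with each element replaced by its chosen preimage.\<close>
  define W :: "('b, nat \<Rightarrow> 'b) module" where "W = \<lparr>carrier = \<iota> ` g ` carrier U, monoid.mult = undefined,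
    one = undefined, ring.zero = \<iota> \<zero>\<^bsub>V\<^esub>, ring.add = (\<lambda>v w. \<iota> (g v \<oplus>\<^bsub>V\<^esub> g w)),
    smult = (\<lambda>a v. \<iota> (a \<odot>\<^bsub>V\<^esub> g v))\<rparr>"
  have im0: "\<zero>\<^bsub>V\<^esub> \<in> g ` carrier U"
    using lmod_hom_zero[OF g U.M.abelian_group_axioms V.M.abelian_group_axioms] U.M.zero_closed
    by (metis imageI)
  have ima: "v \<oplus>\<^bsub>V\<^esub> w \<in> g ` carrier U" if "v \<in> g ` carrier U" "w \<in> g ` carrier U" for v w
    using that g by (auto simp flip: lmod_hom_add)
  have ims: "a \<odot>\<^bsub>V\<^esub> v \<in> g ` carrier U" if "a \<in> carrier R" "v \<in> g ` carrier U" for a v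
    using that g by (auto simp: U.lsmult_closed simp flip: lmod_hom_smult)
  have imc: "v \<in> carrier V" if "v \<in> g ` carrier U" for v
    using that g by (auto simp: lmod_hom_closed)
  have imn: "\<ominus>\<^bsub>V\<^esub> v \<in> g ` carrier U" if "v \<in> g ` carrier U" for v
    using that g by (auto simp flip: lmod_hom_minus[OF g U.M.abelian_group_axioms V.M.abelian_group_axioms])
  have Wc: "carrier W = \<iota> ` g ` carrier U" by (simp add: W_def)
  have W: "left_module R W"
  proof (intro left_module.intro left_module_axioms.intro)
    show "ring R" by (rule U.R.ring_axioms)
    show "abelian_group W"
    proof (rule abelian_groupI)
      fix x assume "x \<in> carrier W"
      then obtain v where v: "v \<in> g ` carrier U" "x = \<iota> v" by (auto simp: Wc)
      have "\<iota> (\<ominus>\<^bsub>V\<^esub> v) \<in> carrier W" using imn[OF v(1)] by (simp add: Wc)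
      moreover have "\<iota> (\<ominus>\<^bsub>V\<^esub> v) \<oplus>\<^bsub>W\<^esub> x = \<zero>\<^bsub>W\<^esub>"
        by (simp add: W_def \<iota> v imn V.M.l_neg[OF imc])
      ultimately show "\<exists>y\<in>carrier W. y \<oplus>\<^bsub>W\<^esub> x = \<zero>\<^bsub>W\<^esub>" by blast
    next
      fix x y z assume "x \<in> carrier W" "y \<in> carrier W" "z \<in> carrier W"
      then obtain u v w where "u \<in> g ` carrier U" "v \<in> g ` carrier U" "w \<in> g ` carrier U"
        "x = \<iota> u" "y = \<iota> v" "z = \<iota> w" unfolding Wc by (auto elim!: imageE)
      then show "x \<oplus>\<^bsub>W\<^esub> y \<oplus>\<^bsub>W\<^esub> z = x \<oplus>\<^bsub>W\<^esub> (y \<oplus>\<^bsub>W\<^esub> z)"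
        by (simp add: W_def \<iota>(1) ima V.M.a_assoc imc)
    next
      fix x y assume "x \<in> carrier W" "y \<in> carrier W"
      then obtain u v where "u \<in> g ` carrier U" "v \<in> g ` carrier U"
        "x = \<iota> u" "y = \<iota> v" unfolding Wc by (auto elim!: imageE)
      then show "x \<oplus>\<^bsub>W\<^esub> y = y \<oplus>\<^bsub>W\<^esub> x"  "x \<oplus>\<^bsub>W\<^esub> y \<in> carrier W"
        by (simp_all add: W_def \<iota>(1) ima V.M.a_comm imc)
    next
      fix x assume "x \<in> carrier W"
      then obtain u where "u \<in> g ` carrier U" "x = \<iota> u" unfolding Wc by (auto elim!: imageE)
      then show "\<zero>\<^bsub>W\<^esub> \<oplus>\<^bsub>W\<^esub> x = x"
        by (simp add: W_def \<iota>(1) imc im0)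
    qed (simp add: W_def im0)
    show "\<one>\<^bsub>R\<^esub> \<odot>\<^bsub>W\<^esub> x = x" if "x \<in> carrier W" for x
      using that by (auto simp: W_def \<iota>(1) V.lsmult_one[OF imc])
    fix a b x y
    assume a: "a \<in> carrier R" and x: "x \<in> carrier W"
    then obtain u where u: "u \<in> g ` carrier U" "x = \<iota> u" unfolding Wc by (auto elim!: imageE)
    show "a \<odot>\<^bsub>W\<^esub> x \<in> carrier W" by (simp add: W_def u \<iota>(1) ims a)
    show "(a \<oplus>\<^bsub>R\<^esub> b) \<odot>\<^bsub>W\<^esub> x = a \<odot>\<^bsub>W\<^esub> x \<oplus>\<^bsub>W\<^esub> b \<odot>\<^bsub>W\<^esub> x" if "b \<in> carrier R"
      using that a by (simp add: W_def u \<iota>(1) ims V.lsmult_l_distr imc)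
    show "(a \<otimes>\<^bsub>R\<^esub> b) \<odot>\<^bsub>W\<^esub> x = a \<odot>\<^bsub>W\<^esub> (b \<odot>\<^bsub>W\<^esub> x)" if "b \<in> carrier R"
      using that a by (simp add: W_def u \<iota>(1) ims V.lsmult_assoc imc)
    show "a \<odot>\<^bsub>W\<^esub> (x \<oplus>\<^bsub>W\<^esub> y) = a \<odot>\<^bsub>W\<^esub> x \<oplus>\<^bsub>W\<^esub> a \<odot>\<^bsub>W\<^esub> y" if y: "y \<in> carrier W"
    proof -
      obtain v where v: "v \<in> g ` carrier U" "y = \<iota> v" using y unfolding Wc by (auto elim!: imageE)
      show ?thesis using a by (simp add: W_def u v \<iota>(1) ims ima V.lsmult_r_distr imc)
    qed
  qed
  define g' where "g' = (\<lambda>u\<in>carrier U. \<iota> (g u))"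
  define f' where "f' = (\<lambda>p\<in>carrier P. \<iota> (f p))"
  have lP: "left_module R P" using P by (simp add: projective_def)
  interpret P: left_module R P by fact
  have g': "g' \<in> lmod_hom R U W"
    unfolding g'_def using g by (intro lmod_hom_restrictI[OF U]) (auto simp: W_def \<iota> lmod_hom_add lmod_hom_smult)
  have f': "f' \<in> lmod_hom R P W"
    unfolding f'_def using f im
    by (intro lmod_hom_restrictI[OF lP]) (auto simp: W_def \<iota>(1) lmod_hom_add lmod_hom_smult image_subset_iff)
  have "g' ` carrier U = carrier W" by (auto simp: W_def g'_def image_image)
  then obtain h where h: "h \<in> lmod_hom R P U" "compose (carrier P) g' h = f'"
    using P U W g' f' unfolding projective_def by blast
  have "g (h x) = f x" if x: "x \<in> carrier P" for x
  proof -
    have "\<iota> (g (h x)) = \<iota> (f x)"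
      using fun_cong[OF h(2), of x] x lmod_hom_closed[OF h(1) x] by (simp add: compose_def g'_def f'_def)
    moreover have "f x \<in> g ` carrier U" using im x by auto
    ultimately show ?thesis using \<iota>(1) lmod_hom_closed[OF h(1) x] by (metis imageI)
  qed
  then show ?thesis using h(1) by blast
qed

section \<open>Comparison of resolutions\<close>

text \<open>The property that singles out the values of \<^const>\<open>chain_lift\<close>.\<close>

definition is_chain_lift ::
  "(nat \<Rightarrow> ('u \<Rightarrow> 'u) set) \<Rightarrow> ('a, 'u, 'm, 'x) resolution \<Rightarrow> ('a, 'u, 'm, 'x) resolution
     \<Rightarrow> ('m \<Rightarrow> 'm) \<Rightarrow> (nat \<Rightarrow> 'u \<Rightarrow> 'u) \<Rightarrow> bool"
  where "is_chain_lift H P' P h \<phi> \<longleftrightarrow> (\<forall>n. \<phi> n \<in> H n) \<and>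
     (\<forall>p\<in>carrier (obj P' 0). aug P (\<phi> 0 p) = h (aug P' p)) \<and>
     (\<forall>n. \<forall>p\<in>carrier (obj P' (Suc n)). diff P n (\<phi> (Suc n) p) = \<phi> n (diff P' n p))"

lemma is_chain_lift_chain_lift:
  assumes "is_chain_lift H P' P h \<phi>"
  shows "is_chain_lift H P' P h (chain_lift H P' P h)"
proof -
  have "is_chain_lift H P' P h (SOME \<phi>. is_chain_lift H P' P h \<phi>)"
    using assms by (rule someI[of "is_chain_lift H P' P h"])
  moreover have "chain_lift H P' P h = (SOME \<phi>. is_chain_lift H P' P h \<phi>)"
    unfolding chain_lift_def is_chain_lift_def by (rule refl)
  ultimately show ?thesis by simp
qed

lemma is_chain_liftD:
  assumes "is_chain_lift H P' P h \<phi>"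
  shows "\<phi> n \<in> H n" "p \<in> carrier (obj P' 0) \<Longrightarrow> aug P (\<phi> 0 p) = h (aug P' p)"
    "p \<in> carrier (obj P' (Suc n)) \<Longrightarrow> diff P n (\<phi> (Suc n) p) = \<phi> n (diff P' n p)"
  using assms by (auto simp: is_chain_lift_def)

lemma exact_resolutionD:
  assumes "exact_resolution P M"
  shows "aug P ` carrier (obj P 0) = carrier M"
    "x \<in> carrier (obj P 0) \<Longrightarrow> aug P x = \<zero>\<^bsub>M\<^esub> \<Longrightarrow> x \<in> diff P 0 ` carrier (obj P (Suc 0))"
    "x \<in> carrier (obj P (Suc n)) \<Longrightarrow> diff P n x = \<zero>\<^bsub>obj P n\<^esub> \<Longrightarrow> x \<in> diff P (Suc n) ` carrier (obj P (Suc (Suc n)))"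
    "x \<in> carrier (obj P (Suc 0)) \<Longrightarrow> aug P (diff P 0 x) = \<zero>\<^bsub>M\<^esub>"
    "x \<in> carrier (obj P (Suc (Suc n))) \<Longrightarrow> diff P n (diff P (Suc n) x) = \<zero>\<^bsub>obj P n\<^esub>"
    "x \<in> carrier (obj P (Suc n)) \<Longrightarrow> diff P n x \<in> carrier (obj P n)"
proof -
  have k: "a_kernel (obj P 0) M (aug P) = diff P 0 ` carrier (obj P 1)"
   "\<And>n. a_kernel (obj P (Suc n)) (obj P n) (diff P n) = diff P (Suc n) ` carrier (obj P (Suc (Suc n)))"
    and s: "aug P ` carrier (obj P 0) = carrier M"
    using assms by (auto simp: exact_resolution_def)
  show "aug P ` carrier (obj P 0) = carrier M" by fact
  show "x \<in> carrier (obj P 0) \<Longrightarrow> aug P x = \<zero>\<^bsub>M\<^esub> \<Longrightarrow> x \<in> diff P 0 ` carrier (obj P (Suc 0))"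
    using k(1) by (auto simp: a_kernel_def' simp flip: k)
  show "x \<in> carrier (obj P (Suc n)) \<Longrightarrow> diff P n x = \<zero>\<^bsub>obj P n\<^esub> \<Longrightarrow> x \<in> diff P (Suc n) ` carrier (obj P (Suc (Suc n)))"
    using k(2) by (auto simp: a_kernel_def' simp flip: k)
  show "x \<in> carrier (obj P (Suc 0)) \<Longrightarrow> aug P (diff P 0 x) = \<zero>\<^bsub>M\<^esub>"
    using equalityD2[OF k(1)] by (auto simp: a_kernel_def')
  show "x \<in> carrier (obj P (Suc (Suc n))) \<Longrightarrow> diff P n (diff P (Suc n) x) = \<zero>\<^bsub>obj P n\<^esub>"
    using equalityD2[OF k(2)[of n]] by (auto simp: a_kernel_def')
  show "x \<in> carrier (obj P (Suc n)) \<Longrightarrow> diff P n x \<in> carrier (obj P n)"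
    using equalityD2[OF k(1)] equalityD2[OF k(2)] by (cases n) (auto simp: a_kernel_def' image_subset_iff)
qed

text \<open>The sets \<open>H n\<close> of admissible maps are left open so that the construction serves linear maps and
  degree-preserving maps alike.  Exactness of \<open>P\<close> places every map that has to be lifted in the image of
  the next differential.\<close>

lemma is_chain_lift_exists:
  assumes P: "exact_resolution P M" and P': "exact_resolution P' M'"
    and h: "\<And>x. x \<in> carrier M' \<Longrightarrow> h x \<in> carrier M" "h \<zero>\<^bsub>M'\<^esub> = \<zero>\<^bsub>M\<^esub>"
    and H: "\<And>n f x. \<lbrakk>f \<in> H n; x \<in> carrier (obj P' n)\<rbrakk> \<Longrightarrow> f x \<in> carrier (obj P n)"
      "\<And>n f. f \<in> H n \<Longrightarrow> f \<zero>\<^bsub>obj P' n\<^esub> = \<zero>\<^bsub>obj P n\<^esub>"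
    and lift_aug: "(\<lambda>x. h (aug P' x)) ` carrier (obj P' 0) \<subseteq> aug P ` carrier (obj P 0)
      \<Longrightarrow> \<exists>k\<in>H 0. \<forall>x\<in>carrier (obj P' 0). aug P (k x) = h (aug P' x)"
    and lift_diff: "\<And>n f. \<lbrakk>f \<in> H n;
        (\<lambda>x. f (diff P' n x)) ` carrier (obj P' (Suc n)) \<subseteq> diff P n ` carrier (obj P (Suc n))\<rbrakk>
      \<Longrightarrow> \<exists>k\<in>H (Suc n). \<forall>x\<in>carrier (obj P' (Suc n)). diff P n (k x) = f (diff P' n x)"
  shows "\<exists>\<phi>. is_chain_lift H P' P h \<phi>"
proof -
  note ex = exact_resolutionD[OF P] and ex' = exact_resolutionD[OF P']
  define Q where "Q n f \<longleftrightarrow> f \<in> H n \<and>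
     (n = 0 \<longrightarrow> (\<forall>x\<in>carrier (obj P' 0). aug P (f x) = h (aug P' x))) \<and>
     (\<lambda>x. f (diff P' n x)) ` carrier (obj P' (Suc n)) \<subseteq> diff P n ` carrier (obj P (Suc n))" for n f
  have "\<exists>\<phi>. \<forall>n. Q n (\<phi> n) \<and>
     (\<forall>x\<in>carrier (obj P' (Suc n)). diff P n (\<phi> (Suc n) x) = \<phi> n (diff P' n x))"
  proof (rule dependent_nat_choice)
    have "(\<lambda>x. h (aug P' x)) ` carrier (obj P' 0) \<subseteq> aug P ` carrier (obj P 0)"
      using ex(1) ex'(1) h(1) by auto
    from lift_aug[OF this] obtain f where "f \<in> H 0" "\<forall>x\<in>carrier (obj P' 0). aug P (f x) = h (aug P' x)"
      by blast
    then show "\<exists>f. Q 0 f" using ex(2) ex'(4,6) h(2) H(1) by (auto simp: Q_def image_subset_iff)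
  next
    fix f n assume f: "Q n f"
    then obtain k where "k \<in> H (Suc n)"
      "\<forall>x\<in>carrier (obj P' (Suc n)). diff P n (k x) = f (diff P' n x)"
      using lift_diff[of f n] by (auto simp: Q_def)
    then show "\<exists>k. Q (Suc n) k \<and> (\<forall>x\<in>carrier (obj P' (Suc n)). diff P n (k x) = f (diff P' n x))"
      using f ex(3) ex'(5,6) H by (auto simp: Q_def image_subset_iff)
  qed
  then obtain \<phi> where \<phi>: "\<forall>n. Q n (\<phi> n) \<and>
     (\<forall>x\<in>carrier (obj P' (Suc n)). diff P n (\<phi> (Suc n) x) = \<phi> n (diff P' n x))" by (elim exE)
  then have "is_chain_lift H P' P h \<phi>" by (auto simp: is_chain_lift_def Q_def)
  then show ?thesis by blast
qed

lemma projective_resolutionD: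
  assumes "projective_resolution R M P"
  shows "projective R (obj P n)" "diff P n \<in> lmod_hom R (obj P (Suc n)) (obj P n)"
    "aug P \<in> lmod_hom R (obj P 0) M" "exact_resolution P M" "left_module R (obj P n)"
  using assms by (auto simp: projective_resolution_def projective_def)

lemma projective_chain_lift_exists:
  fixes P P' :: "('b, 'm) mod_res" and M M' :: "('b, 'm, 'y) module_scheme"
  assumes P': "projective_resolution R M' P'" and P: "projective_resolution R M P"
    and M': "left_module R M'" and M: "left_module R M" and h: "h \<in> lmod_hom R M' M"
  shows "\<exists>\<phi>. is_chain_lift (\<lambda>n. lmod_hom R (obj P' n) (obj P n)) P' P h \<phi>"
proof (rule is_chain_lift_exists)
  note pP' = projective_resolutionD[OF P'] and pP = projective_resolutionD[OF P]
  show "exact_resolution P M" "exact_resolution P' M'" by (rule pP(4) pP'(4))+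
  show "h \<zero>\<^bsub>M'\<^esub> = \<zero>\<^bsub>M\<^esub>" by (rule lmod_hom_zero[OF h left_module_abelian_group[OF M'] left_module_abelian_group[OF M]])
  show "f \<zero>\<^bsub>obj P' n\<^esub> = \<zero>\<^bsub>obj P n\<^esub>" if "f \<in> lmod_hom R (obj P' n) (obj P n)" for n f
    by (rule lmod_hom_zero[OF that left_module_abelian_group[OF pP'(5)] left_module_abelian_group[OF pP(5)]])
  have "compose (carrier (obj P' 0)) h (aug P') \<in> lmod_hom R (obj P' 0) M"
    by (rule lmod_hom_compose[OF pP'(5) pP'(3) h])
  from projective_lift[OF pP'(1) pP(5) M pP(3) this]
  show "(\<lambda>x. h (aug P' x)) ` carrier (obj P' 0) \<subseteq> aug P ` carrier (obj P 0) \<Longrightarrow>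
    \<exists>k\<in>lmod_hom R (obj P' 0) (obj P 0). \<forall>x\<in>carrier (obj P' 0). aug P (k x) = h (aug P' x)"
    by (simp add: compose_def image_subset_iff)
  fix n f assume f: "f \<in> lmod_hom R (obj P' n) (obj P n)"
  have "compose (carrier (obj P' (Suc n))) f (diff P' n) \<in> lmod_hom R (obj P' (Suc n)) (obj P n)"
    by (rule lmod_hom_compose[OF pP'(5) pP'(2) f])
  from projective_lift[OF pP'(1) pP(5) pP(5) pP(2) this]
  show "(\<lambda>x. f (diff P' n x)) ` carrier (obj P' (Suc n)) \<subseteq> diff P n ` carrier (obj P (Suc n)) \<Longrightarrow>
    \<exists>k\<in>lmod_hom R (obj P' (Suc n)) (obj P (Suc n)).
      \<forall>x\<in>carrier (obj P' (Suc n)). diff P n (k x) = f (diff P' n x)"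
    by (simp add: compose_def image_subset_iff)
qed (use h in \<open>auto dest: lmod_hom_closed\<close>)

lemma (in abelian_group) add_diff_cancel':
  "\<lbrakk>a \<in> carrier G; b \<in> carrier G\<rbrakk> \<Longrightarrow> b \<oplus> (a \<ominus> b) = a"
  by (simp add: a_minus_def a_lcomm r_neg)

lemma (in abelian_group) add_diff_cancel2:
  "\<lbrakk>a \<in> carrier G; b \<in> carrier G; c \<in> carrier G\<rbrakk> \<Longrightarrow> b \<oplus> ((a \<ominus> b) \<ominus> c) \<oplus> c = a"
  using add_diff_cancel'[of "a \<ominus> b" c] add_diff_cancel'[of a b]
  by (simp add: a_comm a_lcomm a_assoc)

lemma (in abelian_group) diff_self: "a \<in> carrier G \<Longrightarrow> a \<ominus> a = \<zero>"
  by (simp add: a_minus_def r_neg)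

lemma (in abelian_group) diff_zero: "a \<in> carrier G \<Longrightarrow> a \<ominus> \<zero> = a"
  by (simp add: a_minus_def)

text \<open>The difference \<open>\<Delta>\<^sub>0\<close> of the two lifts vanishes under the augmentation, hence factors as \<open>d\<^sub>0 s\<^sub>0\<close>.  Once
  \<open>d\<^sub>n s\<^sub>n\<close> agrees with \<open>\<Delta>\<^sub>n\<close> on boundaries, \<open>\<Delta>\<^sub>n\<^sub>+\<^sub>1 - s\<^sub>n d'\<^sub>n\<close> is a map into the kernel of \<open>d\<^sub>n\<close>, and it
  factors as \<open>d\<^sub>n\<^sub>+\<^sub>1 s\<^sub>n\<^sub>+\<^sub>1\<close>.\<close>

lemma projective_homotopy:
  fixes P P' :: "('b, 'm) mod_res" and M M' :: "('b, 'm, 'y) module_scheme"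
  assumes P': "projective_resolution R M' P'" and P: "projective_resolution R M P"
    and M': "left_module R M'" and M: "left_module R M"
    and \<phi>: "is_chain_lift (\<lambda>n. lmod_hom R (obj P' n) (obj P n)) P' P h \<phi>"
    and \<psi>: "is_chain_lift (\<lambda>n. lmod_hom R (obj P' n) (obj P n)) P' P h \<psi>"
  shows "\<exists>s. (\<forall>n. s n \<in> lmod_hom R (obj P' n) (obj P (Suc n))) \<and>
    (\<forall>p\<in>carrier (obj P' 0). \<phi> 0 p = \<psi> 0 p \<oplus>\<^bsub>obj P 0\<^esub> diff P 0 (s 0 p)) \<and>
    (\<forall>n. \<forall>p\<in>carrier (obj P' (Suc n)). \<phi> (Suc n) p
       = \<psi> (Suc n) p \<oplus>\<^bsub>obj P (Suc n)\<^esub> diff P (Suc n) (s (Suc n) p) \<oplus>\<^bsub>obj P (Suc n)\<^esub> s n (diff P' n p))"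
proof -
  note pP = projective_resolutionD[OF P] and pP' = projective_resolutionD[OF P']
  note ex = exact_resolutionD[OF pP(4)]
  note ex' = exact_resolutionD[OF pP'(4)]
  note L = is_chain_liftD[OF \<phi>] is_chain_liftD[OF \<psi>]
  have ab: "abelian_group (obj P n)" "abelian_group (obj P' n)" "abelian_group M" "abelian_group M'" for n
    using M M' pP(5) pP'(5) by (auto intro: left_module_abelian_group[of R])
  have d'cl: "diff P' n p \<in> carrier (obj P' n)" if "p \<in> carrier (obj P' (Suc n))" for n p
    using that pP'(2) lmod_hom_closed by metis
  have cl: "\<phi> n p \<in> carrier (obj P n)" "\<psi> n p \<in> carrier (obj P n)" if "p \<in> carrier (obj P' n)" for n p
    using that L(1,4) lmod_hom_closed by metis+
  define \<Delta> where "\<Delta> n = (\<lambda>p\<in>carrier (obj P' n). \<phi> n p \<ominus>\<^bsub>obj P n\<^esub> \<psi> n p)" for n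
  have \<Delta>: "\<Delta> n \<in> lmod_hom R (obj P' n) (obj P n)" for n
    unfolding \<Delta>_def using L pP(5) pP'(5) by (intro lmod_hom_diff)
  have \<Delta>v: "\<Delta> n p = \<phi> n p \<ominus>\<^bsub>obj P n\<^esub> \<psi> n p" if "p \<in> carrier (obj P' n)" for n p
    using that by (simp add: \<Delta>_def)
  have dd: "diff P n (\<Delta> (Suc n) p) = \<Delta> n (diff P' n p)" if p: "p \<in> carrier (obj P' (Suc n))" for n p
    using lmod_hom_diff_elem[OF pP(2) ab(1) ab(1) cl[OF p]] L(3,6)[OF p] by (simp add: \<Delta>v p d'cl)
  \<comment> \<open>For \<open>n > 0\<close> the invariant constrains \<open>s\<^sub>n\<close> on boundaries only, where \<open>s\<^sub>n\<^sub>-\<^sub>1 d'\<^sub>n\<^sub>-\<^sub>1\<close> drops out, so that it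
    can be stated without reference to the previous stage.\<close>
  define Q where "Q n s \<longleftrightarrow> s \<in> lmod_hom R (obj P' n) (obj P (Suc n)) \<and>
     (n = 0 \<longrightarrow> (\<forall>p\<in>carrier (obj P' 0). diff P 0 (s p) = \<Delta> 0 p)) \<and>
     (\<forall>p\<in>carrier (obj P' (Suc n)). diff P n (s (diff P' n p)) = \<Delta> n (diff P' n p))" for n s
  define T where "T n s s' \<longleftrightarrow> (\<forall>p\<in>carrier (obj P' (Suc n)).
     diff P (Suc n) (s' p) = \<Delta> (Suc n) p \<ominus>\<^bsub>obj P (Suc n)\<^esub> s (diff P' n p))" for n s s'
  have "\<exists>s. \<forall>n. Q n (s n) \<and> T n (s n) (s (Suc n))"
  proof (rule dependent_nat_choice)
    have "aug P (\<Delta> 0 p) = \<zero>\<^bsub>M\<^esub>" if p: "p \<in> carrier (obj P' 0)" for p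
      using lmod_hom_diff_elem[OF pP(3) ab(1) ab(3) cl[OF p]] L(2,5)[OF p]
        abelian_group.diff_self[OF ab(3)] lmod_hom_closed[OF pP(3) cl(1)[OF p]]
      by (simp add: \<Delta>v p)
    then have "\<Delta> 0 ` carrier (obj P' 0) \<subseteq> diff P 0 ` carrier (obj P (Suc 0))"
      using ex(2) lmod_hom_closed[OF \<Delta>] by blast
    from projective_lift[OF pP'(1) pP(5) pP(5) pP(2) \<Delta> this]
    show "\<exists>s. Q 0 s" using d'cl by (auto simp: Q_def)
  next
    fix s n assume s: "Q n s"
    then have sh: "s \<in> lmod_hom R (obj P' n) (obj P (Suc n))" by (simp add: Q_def)
    have sd: "compose (carrier (obj P' (Suc n))) s (diff P' n) \<in> lmod_hom R (obj P' (Suc n)) (obj P (Suc n))"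
      by (rule lmod_hom_compose[OF pP'(5) pP'(2) sh])
    define f where "f = (\<lambda>p\<in>carrier (obj P' (Suc n)). \<Delta> (Suc n) p \<ominus>\<^bsub>obj P (Suc n)\<^esub>
       (compose (carrier (obj P' (Suc n))) s (diff P' n)) p)"
    have f: "f \<in> lmod_hom R (obj P' (Suc n)) (obj P (Suc n))"
      unfolding f_def by (rule lmod_hom_diff[OF pP'(5) pP(5) \<Delta> sd])
    have "diff P n (f p) = \<zero>\<^bsub>obj P n\<^esub>" if p: "p \<in> carrier (obj P' (Suc n))" for p
      using lmod_hom_diff_elem[OF pP(2) ab(1) ab(1) lmod_hom_closed[OF \<Delta> p] lmod_hom_closed[OF sh d'cl[OF p]]]
         s p dd[OF p] abelian_group.diff_self[OF ab(1) lmod_hom_closed[OF \<Delta> d'cl[OF p]]]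
      by (simp add: f_def compose_def Q_def)
    then have "f ` carrier (obj P' (Suc n)) \<subseteq> diff P (Suc n) ` carrier (obj P (Suc (Suc n)))"
      using ex(3) lmod_hom_closed[OF f] by blast
    from projective_lift[OF pP'(1) pP(5) pP(5) pP(2) f this]
    obtain s' where s': "s' \<in> lmod_hom R (obj P' (Suc n)) (obj P (Suc (Suc n)))"
      "\<And>p. p \<in> carrier (obj P' (Suc n)) \<Longrightarrow> diff P (Suc n) (s' p) = f p" by blast
    have T: "T n s s'" using s'(2) by (simp add: T_def f_def compose_def)
    moreover have "Q (Suc n) s'"
      unfolding Q_def
    proof (intro conjI ballI)
      fix p assume p: "p \<in> carrier (obj P' (Suc (Suc n)))"
      have "s (diff P' n (diff P' (Suc n) p)) = \<zero>\<^bsub>obj P (Suc n)\<^esub>"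
        using ex'(5)[OF p] lmod_hom_zero[OF sh ab(2) ab(1)] by simp
      then show "diff P (Suc n) (s' (diff P' (Suc n) p)) = \<Delta> (Suc n) (diff P' (Suc n) p)"
        using T d'cl[OF p] abelian_group.diff_zero[OF ab(1) lmod_hom_closed[OF \<Delta> d'cl[OF p]]]
        by (simp add: T_def)
    qed (use s' in auto)
    ultimately show "\<exists>s'. Q (Suc n) s' \<and> T n s s'" by blast
  qed
  then obtain s where s: "\<And>n. Q n (s n)" "\<And>n. T n (s n) (s (Suc n))" by blast
  have sh: "s n \<in> lmod_hom R (obj P' n) (obj P (Suc n))" for n using s(1) by (simp add: Q_def)
  have "\<phi> 0 p = \<psi> 0 p \<oplus>\<^bsub>obj P 0\<^esub> diff P 0 (s 0 p)" if p: "p \<in> carrier (obj P' 0)" for p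
    using s(1)[of 0] p cl[OF p] abelian_group.add_diff_cancel'[OF ab(1)] by (simp add: Q_def \<Delta>v)
  moreover have "\<phi> (Suc n) p = \<psi> (Suc n) p \<oplus>\<^bsub>obj P (Suc n)\<^esub> diff P (Suc n) (s (Suc n) p)
      \<oplus>\<^bsub>obj P (Suc n)\<^esub> s n (diff P' n p)" if p: "p \<in> carrier (obj P' (Suc n))" for n p
    using s(2)[of n] p cl[OF p] abelian_group.add_diff_cancel2[OF ab(1)] lmod_hom_closed[OF sh d'cl[OF p]]
    by (simp add: T_def \<Delta>v)
  ultimately show ?thesis using sh by blast
qed

section \<open>Cohomology classes\<close>

locale cochain_complex =
  fixes K :: "('k, 'r) ring_scheme" and C :: "nat \<Rightarrow> ('k, 'v) module" and \<delta> :: "nat \<Rightarrow> 'v \<Rightarrow> 'v"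
  assumes C_module: "module K (C n)"
    and d_closed: "f \<in> carrier (C n) \<Longrightarrow> \<delta> n f \<in> carrier (C (Suc n))"
    and d_add: "\<lbrakk>f \<in> carrier (C n); g \<in> carrier (C n)\<rbrakk> \<Longrightarrow> \<delta> n (f \<oplus>\<^bsub>C n\<^esub> g) = \<delta> n f \<oplus>\<^bsub>C (Suc n)\<^esub> \<delta> n g"
    and d_smult: "\<lbrakk>c \<in> carrier K; f \<in> carrier (C n)\<rbrakk> \<Longrightarrow> \<delta> n (c \<odot>\<^bsub>C n\<^esub> f) = c \<odot>\<^bsub>C (Suc n)\<^esub> \<delta> n f"
    and d_d: "f \<in> carrier (C n) \<Longrightarrow> \<delta> (Suc n) (\<delta> n f) = \<zero>\<^bsub>C (Suc (Suc n))\<^esub>"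

definition cohomology_class :: "(nat \<Rightarrow> ('k, 'v) module) \<Rightarrow> (nat \<Rightarrow> 'v \<Rightarrow> 'v) \<Rightarrow> nat \<Rightarrow> 'v \<Rightarrow> 'v set"
  where "cohomology_class C \<delta> n f = coboundaries C \<delta> n +>\<^bsub>C n\<^esub> f"

lemma cohomology_class_eq: "cohomology_class C \<delta> n f = (\<lambda>w. w \<oplus>\<^bsub>C n\<^esub> f) ` coboundaries C \<delta> n"
  by (auto simp: cohomology_class_def a_r_coset_def')

context cochain_complex
begin

lemma C_group: "abelian_group (C n)"
  using C_module[of n] by (simp add: module_def)

lemma d_zero: "\<delta> n \<zero>\<^bsub>C n\<^esub> = \<zero>\<^bsub>C (Suc n)\<^esub>"
proof -
  interpret A: abelian_group "C n" by (rule C_group)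
  interpret B: abelian_group "C (Suc n)" by (rule C_group)
  show ?thesis using d_add[OF A.zero_closed A.zero_closed] d_closed[OF A.zero_closed]
    by (metis A.l_zero A.zero_closed B.add.r_cancel_one')
qed

lemma cocycles_closed:
  shows "f \<in> cocycles C \<delta> n \<Longrightarrow> f \<in> carrier (C n)"
    and "\<zero>\<^bsub>C n\<^esub> \<in> cocycles C \<delta> n"
    and "\<lbrakk>f \<in> cocycles C \<delta> n; g \<in> cocycles C \<delta> n\<rbrakk> \<Longrightarrow> f \<oplus>\<^bsub>C n\<^esub> g \<in> cocycles C \<delta> n"
    and "\<lbrakk>c \<in> carrier K; f \<in> cocycles C \<delta> n\<rbrakk> \<Longrightarrow> c \<odot>\<^bsub>C n\<^esub> f \<in> cocycles C \<delta> n"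
proof -
  interpret A: module K "C n" by (rule C_module)
  interpret B: module K "C (Suc n)" by (rule C_module)
  show "f \<in> cocycles C \<delta> n \<Longrightarrow> f \<in> carrier (C n)" "\<zero>\<^bsub>C n\<^esub> \<in> cocycles C \<delta> n"
    "\<lbrakk>f \<in> cocycles C \<delta> n; g \<in> cocycles C \<delta> n\<rbrakk> \<Longrightarrow> f \<oplus>\<^bsub>C n\<^esub> g \<in> cocycles C \<delta> n"
    "\<lbrakk>c \<in> carrier K; f \<in> cocycles C \<delta> n\<rbrakk> \<Longrightarrow> c \<odot>\<^bsub>C n\<^esub> f \<in> cocycles C \<delta> n"
    by (auto simp: cocycles_def d_zero d_add d_smult)
qed

lemma coboundaries_closed:
  shows "f \<in> coboundaries C \<delta> n \<Longrightarrow> f \<in> cocycles C \<delta> n"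
    and "\<zero>\<^bsub>C n\<^esub> \<in> coboundaries C \<delta> n"
    and "\<lbrakk>f \<in> coboundaries C \<delta> n; g \<in> coboundaries C \<delta> n\<rbrakk> \<Longrightarrow> f \<oplus>\<^bsub>C n\<^esub> g \<in> coboundaries C \<delta> n"
    and "\<lbrakk>c \<in> carrier K; f \<in> coboundaries C \<delta> n\<rbrakk> \<Longrightarrow> c \<odot>\<^bsub>C n\<^esub> f \<in> coboundaries C \<delta> n"
proof -
  interpret A: module K "C n" for n by (rule C_module)
  show "f \<in> coboundaries C \<delta> n \<Longrightarrow> f \<in> cocycles C \<delta> n" "\<zero>\<^bsub>C n\<^esub> \<in> coboundaries C \<delta> n"
    by (cases n; force simp: cocycles_def coboundaries_def d_zero d_closed d_d
         intro: rev_image_eqI[OF A.M.zero_closed])+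
  show "\<lbrakk>f \<in> coboundaries C \<delta> n; g \<in> coboundaries C \<delta> n\<rbrakk> \<Longrightarrow> f \<oplus>\<^bsub>C n\<^esub> g \<in> coboundaries C \<delta> n"
    by (cases n) (auto simp: coboundaries_def simp flip: d_add)
  show "\<lbrakk>c \<in> carrier K; f \<in> coboundaries C \<delta> n\<rbrakk> \<Longrightarrow> c \<odot>\<^bsub>C n\<^esub> f \<in> coboundaries C \<delta> n"
    by (cases n) (auto simp: coboundaries_def simp flip: d_smult)
qed

lemma coboundaries_uminus: "f \<in> coboundaries C \<delta> n \<Longrightarrow> \<ominus>\<^bsub>C n\<^esub> f \<in> coboundaries C \<delta> n"
proof -
  assume f: "f \<in> coboundaries C \<delta> n"
  interpret A: module K "C n" by (rule C_module)
  have "(\<ominus>\<^bsub>K\<^esub> \<one>\<^bsub>K\<^esub>) \<odot>\<^bsub>C n\<^esub> f = \<ominus>\<^bsub>C n\<^esub> f"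
    using f by (simp add: A.smult_l_minus cocycles_closed(1) coboundaries_closed(1))
  then show ?thesis using coboundaries_closed(4)[OF _ f, of "\<ominus>\<^bsub>K\<^esub> \<one>\<^bsub>K\<^esub>"] by simp
qed

lemma coboundaries_carrier: "f \<in> coboundaries C \<delta> n \<Longrightarrow> f \<in> carrier (C n)"
  by (simp add: cocycles_closed(1) coboundaries_closed(1))

lemma cohomology_class_eqI:
  assumes w: "w \<in> coboundaries C \<delta> n" and g: "g \<in> carrier (C n)"
  shows "cohomology_class C \<delta> n (w \<oplus>\<^bsub>C n\<^esub> g) = cohomology_class C \<delta> n g"
proof -
  interpret A: abelian_group "C n" by (rule C_group)
  note cw = coboundaries_carrier
  show ?thesis
  proof
    show "cohomology_class C \<delta> n (w \<oplus>\<^bsub>C n\<^esub> g) \<subseteq> cohomology_class C \<delta> n g"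
      unfolding cohomology_class_eq using w g cw
      by (auto simp flip: A.a_assoc intro!: imageI coboundaries_closed)
    show "cohomology_class C \<delta> n g \<subseteq> cohomology_class C \<delta> n (w \<oplus>\<^bsub>C n\<^esub> g)"
    proof (clarsimp simp: cohomology_class_eq)
      fix v assume v: "v \<in> coboundaries C \<delta> n"
      have "v \<oplus>\<^bsub>C n\<^esub> g = (v \<oplus>\<^bsub>C n\<^esub> (\<ominus>\<^bsub>C n\<^esub> w)) \<oplus>\<^bsub>C n\<^esub> (w \<oplus>\<^bsub>C n\<^esub> g)"
        using v w g cw by (simp add: A.a_assoc A.r_neg1 A.r_neg2)
      then show "v \<oplus>\<^bsub>C n\<^esub> g \<in> (\<lambda>v. v \<oplus>\<^bsub>C n\<^esub> (w \<oplus>\<^bsub>C n\<^esub> g)) ` coboundaries C \<delta> n"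
        using v w coboundaries_closed(3) coboundaries_uminus by blast
    qed
  qed
qed

lemma cohomology_class_self: "f \<in> carrier (C n) \<Longrightarrow> f \<in> cohomology_class C \<delta> n f"
proof -
  assume f: "f \<in> carrier (C n)"
  interpret A: abelian_group "C n" by (rule C_group)
  show ?thesis unfolding cohomology_class_eq using f coboundaries_closed(2)[of n]
    by (intro rev_image_eqI[of "\<zero>\<^bsub>C n\<^esub>"]) auto
qed

lemma cohomology_class_eqD:
  assumes "cohomology_class C \<delta> n f = cohomology_class C \<delta> n g" "f \<in> carrier (C n)"
  obtains w where "w \<in> coboundaries C \<delta> n" "f = w \<oplus>\<^bsub>C n\<^esub> g"
  using cohomology_class_self[OF assms(2)] assms(1) by (auto simp: cohomology_class_eq)

lemma cohomology_carrier: "carrier (cohomology C \<delta> n) = cohomology_class C \<delta> n ` cocycles C \<delta> n"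
  by (auto simp: cohomology_def quot_module_def A_RCOSETS_def' cohomology_class_def a_r_coset_def')

lemma cohomology_zero: "\<zero>\<^bsub>cohomology C \<delta> n\<^esub> = cohomology_class C \<delta> n \<zero>\<^bsub>C n\<^esub>"
proof -
  interpret A: abelian_group "C n" by (rule C_group)
  show ?thesis using coboundaries_carrier
    by (force simp: cohomology_def quot_module_def cohomology_class_eq image_iff)
qed

lemma cohomology_class_add:
  assumes f: "f \<in> carrier (C n)" and g: "g \<in> carrier (C n)"
  shows "cohomology_class C \<delta> n f \<oplus>\<^bsub>cohomology C \<delta> n\<^esub> cohomology_class C \<delta> n g
    = cohomology_class C \<delta> n (f \<oplus>\<^bsub>C n\<^esub> g)"
proof -
  interpret A: abelian_group "C n" by (rule C_group)
  note cw = coboundaries_carrier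
  have "cohomology_class C \<delta> n f \<oplus>\<^bsub>cohomology C \<delta> n\<^esub> cohomology_class C \<delta> n g
    = (\<Union>v\<in>coboundaries C \<delta> n. \<Union>w\<in>coboundaries C \<delta> n. {(v \<oplus>\<^bsub>C n\<^esub> f) \<oplus>\<^bsub>C n\<^esub> (w \<oplus>\<^bsub>C n\<^esub> g)})"
    by (simp add: cohomology_def quot_module_def set_add_def' cohomology_class_eq)
  also have "\<dots> = (\<Union>v\<in>coboundaries C \<delta> n. \<Union>w\<in>coboundaries C \<delta> n. {(v \<oplus>\<^bsub>C n\<^esub> w) \<oplus>\<^bsub>C n\<^esub> (f \<oplus>\<^bsub>C n\<^esub> g)})"
    using f g cw by (intro SUP_cong refl) (simp add: A.a_ac)
  also have "\<dots> = (\<Union>v\<in>coboundaries C \<delta> n. {v \<oplus>\<^bsub>C n\<^esub> (f \<oplus>\<^bsub>C n\<^esub> g)})" (is "?L = ?R")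
  proof
    show "?L \<subseteq> ?R" using coboundaries_closed(3) by blast
    show "?R \<subseteq> ?L"
    proof
      fix x assume "x \<in> ?R"
      then obtain v where v: "v \<in> coboundaries C \<delta> n" "x = v \<oplus>\<^bsub>C n\<^esub> (f \<oplus>\<^bsub>C n\<^esub> g)" by auto
      then have "x = (v \<oplus>\<^bsub>C n\<^esub> \<zero>\<^bsub>C n\<^esub>) \<oplus>\<^bsub>C n\<^esub> (f \<oplus>\<^bsub>C n\<^esub> g)" using cw by simp
      then show "x \<in> ?L" using v(1) coboundaries_closed(2) by blast
    qed
  qed
  also have "\<dots> = cohomology_class C \<delta> n (f \<oplus>\<^bsub>C n\<^esub> g)" by (auto simp: cohomology_class_eq)
  finally show ?thesis .
qed

lemma cohomology_class_smult:
  assumes f: "f \<in> carrier (C n)" and c: "c \<in> carrier K"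
  shows "c \<odot>\<^bsub>cohomology C \<delta> n\<^esub> cohomology_class C \<delta> n f = cohomology_class C \<delta> n (c \<odot>\<^bsub>C n\<^esub> f)"
proof -
  interpret A: module K "C n" by (rule C_module)
  note cw = coboundaries_carrier
  have "c \<odot>\<^bsub>cohomology C \<delta> n\<^esub> cohomology_class C \<delta> n f
     = (\<Union>x\<in>cohomology_class C \<delta> n f. cohomology_class C \<delta> n (c \<odot>\<^bsub>C n\<^esub> x))"
    by (simp add: cohomology_def quot_module_def cohomology_class_def a_r_coset_def')
  also have "\<dots> = (\<Union>x\<in>cohomology_class C \<delta> n f. cohomology_class C \<delta> n (c \<odot>\<^bsub>C n\<^esub> f))"
  proof (intro SUP_cong refl)
    fix x assume "x \<in> cohomology_class C \<delta> n f"
    then obtain w where "w \<in> coboundaries C \<delta> n" "x = w \<oplus>\<^bsub>C n\<^esub> f" by (auto simp: cohomology_class_eq)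
    then show "cohomology_class C \<delta> n (c \<odot>\<^bsub>C n\<^esub> x) = cohomology_class C \<delta> n (c \<odot>\<^bsub>C n\<^esub> f)"
      using f c cw by (simp add: A.smult_r_distr cohomology_class_eqI coboundaries_closed(4))
  qed
  also have "\<dots> = cohomology_class C \<delta> n (c \<odot>\<^bsub>C n\<^esub> f)" using cohomology_class_self[OF f] by auto
  finally show ?thesis .
qed

end

text \<open>The value of \<^const>\<open>cohomology_map\<close> is a union over all representatives of a class.  They all contribute
  the same class because \<open>\<phi>\<close> preserves coboundaries.\<close>

lemma cohomology_map_class:
  assumes C: "cochain_complex K C \<delta>" and C': "cochain_complex K C' \<delta>'"
    and f: "f \<in> carrier (C n)"
    and cl: "\<And>g. g \<in> carrier (C n) \<Longrightarrow> \<phi> g \<in> carrier (C' n)"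
    and add: "\<And>g h. \<lbrakk>g \<in> carrier (C n); h \<in> carrier (C n)\<rbrakk> \<Longrightarrow> \<phi> (g \<oplus>\<^bsub>C n\<^esub> h) = \<phi> g \<oplus>\<^bsub>C' n\<^esub> \<phi> h"
    and cob: "\<And>g. g \<in> coboundaries C \<delta> n \<Longrightarrow> \<phi> g \<in> coboundaries C' \<delta>' n"
  shows "cohomology_map C' \<delta>' n \<phi> (cohomology_class C \<delta> n f) = cohomology_class C' \<delta>' n (\<phi> f)"
proof -
  interpret C: cochain_complex K C \<delta> by fact
  interpret C': cochain_complex K C' \<delta>' by fact
  have "cohomology_map C' \<delta>' n \<phi> (cohomology_class C \<delta> n f)
    = (\<Union>x\<in>cohomology_class C \<delta> n f. cohomology_class C' \<delta>' n (\<phi> x))"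
    by (simp add: cohomology_map_def cohomology_class_def)
  also have "\<dots> = (\<Union>x\<in>cohomology_class C \<delta> n f. cohomology_class C' \<delta>' n (\<phi> f))"
  proof (intro SUP_cong refl)
    fix x assume "x \<in> cohomology_class C \<delta> n f"
    then obtain w where "w \<in> coboundaries C \<delta> n" "x = w \<oplus>\<^bsub>C n\<^esub> f" by (auto simp: cohomology_class_eq)
    then show "cohomology_class C' \<delta>' n (\<phi> x) = cohomology_class C' \<delta>' n (\<phi> f)"
      using f cl cob by (simp add: add C.coboundaries_carrier C'.cohomology_class_eqI)
  qed
  also have "\<dots> = cohomology_class C' \<delta>' n (\<phi> f)" using C.cohomology_class_self[OF f] by auto
  finally show ?thesis .
qed

section \<open>Homogeneous components\<close>

lemma (in abelian_monoid) finsum_in_submonoid: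
  assumes "H \<subseteq> carrier G" "\<zero> \<in> H" "\<And>x y. \<lbrakk>x \<in> H; y \<in> H\<rbrakk> \<Longrightarrow> x \<oplus> y \<in> H" "\<And>i. i \<in> A \<Longrightarrow> f i \<in> H"
  shows "finsum G f A \<in> H"
proof (cases "finite A")
  case True then show ?thesis using assms
    by (induction A) (auto simp: finsum_insert Pi_iff subset_iff)
qed (use assms(2) finsum_infinite in auto)

lemma (in abelian_monoid) finsum_superset:
  assumes "finite A" "S \<subseteq> A" "\<And>i. i \<in> A - S \<Longrightarrow> f i = \<zero>" "f \<in> A \<rightarrow> carrier G"
  shows "finsum G f S = finsum G f A"
  using assms by (intro add.finprod_mono_neutral_cong_left) auto

locale graded_group = abelian_group M for M :: "('a, 'm, 'x) graded_module_scheme" (structure) +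
  assumes grading: "is_grading M"
begin

lemma grade_subgroup: "additive_subgroup (grade M i) M"
  using grading by (simp add: is_grading_def)

lemma grade_carrier: "x \<in> grade M i \<Longrightarrow> x \<in> carrier M"
  and grade_zero: "\<zero> \<in> grade M i"
  and grade_add: "\<lbrakk>x \<in> grade M i; y \<in> grade M i\<rbrakk> \<Longrightarrow> x \<oplus> y \<in> grade M i"
  and grade_uminus: "x \<in> grade M i \<Longrightarrow> \<ominus> x \<in> grade M i"
  using additive_subgroup.a_Hcarr[OF grade_subgroup] additive_subgroup.zero_closed[OF grade_subgroup]
    additive_subgroup.a_closed[OF grade_subgroup]
    subgroup.m_inv_closed[OF additive_subgroup.a_subgroup[OF grade_subgroup]]
  by (auto simp: a_inv_def)

lemma component_decomp: "x \<in> carrier M \<Longrightarrow> homog_decomp M x (component M x)"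
  using grading unfolding is_grading_def component_def by (metis theI')

lemma component_grade: "x \<in> carrier M \<Longrightarrow> component M x i \<in> grade M i"
  and component_finite: "x \<in> carrier M \<Longrightarrow> finite {i. component M x i \<noteq> \<zero>}"
  and component_sum: "x \<in> carrier M \<Longrightarrow> x = (\<Oplus>i\<in>{i. component M x i \<noteq> \<zero>}. component M x i)"
  using component_decomp by (auto simp: homog_decomp_def)

lemma component_closed: "x \<in> carrier M \<Longrightarrow> component M x i \<in> carrier M"
  using component_grade grade_carrier by blast

lemma component_eqI:
  assumes f: "\<And>i. f i \<in> grade M i" and A: "finite A" "\<And>i. i \<notin> A \<Longrightarrow> f i = \<zero>" and x: "x = (\<Oplus>i\<in>A. f i)"
  shows "component M x = f"
proof -
  have fc: "f i \<in> carrier M" for i using f grade_carrier by blast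
  have xc: "x \<in> carrier M" unfolding x using fc by (simp add: finsum_closed Pi_iff)
  have "x = (\<Oplus>i\<in>{i. f i \<noteq> \<zero>}. f i)"
    unfolding x using A fc by (intro finsum_superset[symmetric]) auto
  moreover have "finite {i. f i \<noteq> \<zero>}" using A by (auto intro: finite_subset[of _ A])
  ultimately have "homog_decomp M x f" using f by (simp add: homog_decomp_def)
  then show ?thesis using component_decomp[OF xc] xc grading unfolding is_grading_def by metis
qed

lemma component_homog: "x \<in> grade M i \<Longrightarrow> component M x j = (if j = i then x else \<zero>)"
proof -
  assume x: "x \<in> grade M i"
  have "component M x = (\<lambda>j. if j = i then x else \<zero>)"
    using x grade_carrier by (intro component_eqI[of _ "{i}"]) (auto simp: grade_zero finsum_insert)
  then show ?thesis by simp
qed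

lemma component_zero: "component M \<zero> i = \<zero>"
  using component_homog[OF grade_zero[of i]] by simp

lemma component_add:
  assumes x: "x \<in> carrier M" and y: "y \<in> carrier M"
  shows "component M (x \<oplus> y) i = component M x i \<oplus> component M y i"
proof -
  let ?A = "{i. component M x i \<noteq> \<zero>} \<union> {i. component M y i \<noteq> \<zero>}"
  note cc = component_closed[OF x] component_closed[OF y]
  have fin: "finite ?A" using x y component_finite by simp
  have "x = (\<Oplus>i\<in>?A. component M x i)" "y = (\<Oplus>i\<in>?A. component M y i)"
    using fin cc by (auto intro!: trans[OF component_sum[OF x] finsum_superset]
        trans[OF component_sum[OF y] finsum_superset])
  then have "x \<oplus> y = (\<Oplus>i\<in>?A. component M x i \<oplus> component M y i)"
    using cc by (simp add: finsum_addf)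
  then have "component M (x \<oplus> y) = (\<lambda>i. component M x i \<oplus> component M y i)"
    using x y fin by (intro component_eqI[of _ ?A]) (auto simp: grade_add component_grade)
  then show ?thesis by simp
qed

text \<open>An identity between additive expressions needs to be checked on homogeneous elements only; with this
  rule, most arguments below never mention a sum of components.\<close>

lemma homog_induct [consumes 1, case_names zero homog add]:
  assumes x: "x \<in> carrier M" and zero: "P \<zero>" and homog: "\<And>i x. x \<in> grade M i \<Longrightarrow> P x"
    and add: "\<And>x y. \<lbrakk>x \<in> carrier M; y \<in> carrier M; P x; P y\<rbrakk> \<Longrightarrow> P (x \<oplus> y)"
  shows "P x"
proof -
  have "(\<Oplus>i\<in>{i. component M x i \<noteq> \<zero>}. component M x i) \<in> {y \<in> carrier M. P y}"
    by (rule finsum_in_submonoid) (auto simp: x component_closed zero add intro!: homog component_grade[OF x])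
  then show ?thesis using component_sum[OF x] by simp
qed

lemma component_ext:
  assumes "x \<in> carrier M" "y \<in> carrier M" "\<And>i. component M x i = component M y i"
  shows "x = y"
  using component_sum[OF assms(1)] component_sum[OF assms(2)] assms(3) by simp

end

text \<open>The additive map that is \<open>\<phi> r\<close> in degree \<open>r\<close>.  The action on \<open>F\<^sub>\<sigma> M\<close>, the multiplication of \<open>B\<^sup>\<sigma>\<close> and the
  homogeneous parts of a homomorphism all have this form.\<close>

definition gr_ext :: "('a, 'm, 'x) graded_module_scheme \<Rightarrow> ('n, 'y) ring_scheme
    \<Rightarrow> (int \<Rightarrow> 'm \<Rightarrow> 'n) \<Rightarrow> 'm \<Rightarrow> 'n"
  where "gr_ext M N \<phi> x = (\<Oplus>\<^bsub>N\<^esub>r\<in>{r. component M x r \<noteq> \<zero>\<^bsub>M\<^esub>}. \<phi> r (component M x r))"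

lemma
  assumes M: "graded_group M" and N: "abelian_group N"
    and cl: "\<And>r x. x \<in> grade M r \<Longrightarrow> \<phi> r x \<in> carrier N"
    and ad: "\<And>r x y. \<lbrakk>x \<in> grade M r; y \<in> grade M r\<rbrakk> \<Longrightarrow> \<phi> r (x \<oplus>\<^bsub>M\<^esub> y) = \<phi> r x \<oplus>\<^bsub>N\<^esub> \<phi> r y"
  shows gr_ext_closed: "x \<in> carrier M \<Longrightarrow> gr_ext M N \<phi> x \<in> carrier N"
    and gr_ext_add: "\<lbrakk>x \<in> carrier M; y \<in> carrier M\<rbrakk> \<Longrightarrow> gr_ext M N \<phi> (x \<oplus>\<^bsub>M\<^esub> y) = gr_ext M N \<phi> x \<oplus>\<^bsub>N\<^esub> gr_ext M N \<phi> y"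
    and gr_ext_homog: "x \<in> grade M r \<Longrightarrow> gr_ext M N \<phi> x = \<phi> r x"
proof -
  interpret M: graded_group M by fact
  interpret N: abelian_group N by fact
  have z: "\<phi> r \<zero>\<^bsub>M\<^esub> = \<zero>\<^bsub>N\<^esub>" for r
    using ad[OF M.grade_zero M.grade_zero] cl[OF M.grade_zero] by (simp add: N.add.r_cancel_one')
  have cl': "\<phi> r (component M x r) \<in> carrier N" if "x \<in> carrier M" for x r
    using that cl M.component_grade by blast
  have sup: "gr_ext M N \<phi> x = (\<Oplus>\<^bsub>N\<^esub>r\<in>A. \<phi> r (component M x r))"
    if "x \<in> carrier M" "finite A" "{r. component M x r \<noteq> \<zero>\<^bsub>M\<^esub>} \<subseteq> A" for x A
    unfolding gr_ext_def using that z cl' by (intro N.finsum_superset) auto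
  show "x \<in> carrier M \<Longrightarrow> gr_ext M N \<phi> x \<in> carrier N"
    unfolding gr_ext_def using cl' by (intro N.finsum_closed) auto
  show "gr_ext M N \<phi> x = \<phi> r x" if x: "x \<in> grade M r"
  proof -
    have "gr_ext M N \<phi> x = (\<Oplus>\<^bsub>N\<^esub>i\<in>{r}. \<phi> i (component M x i))"
      using x M.grade_carrier[OF x] by (intro sup) (auto simp: M.component_homog)
    then show ?thesis using x cl by (simp add: N.finsum_insert M.component_homog)
  qed
  show "gr_ext M N \<phi> (x \<oplus>\<^bsub>M\<^esub> y) = gr_ext M N \<phi> x \<oplus>\<^bsub>N\<^esub> gr_ext M N \<phi> y"
    if x: "x \<in> carrier M" and y: "y \<in> carrier M"
  proof -
    let ?A = "{r. component M x r \<noteq> \<zero>\<^bsub>M\<^esub>} \<union> {r. component M y r \<noteq> \<zero>\<^bsub>M\<^esub>}"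
    have fin: "finite ?A" using x y by (simp add: M.component_finite)
    have "gr_ext M N \<phi> (x \<oplus>\<^bsub>M\<^esub> y) = (\<Oplus>\<^bsub>N\<^esub>r\<in>?A. \<phi> r (component M (x \<oplus>\<^bsub>M\<^esub> y) r))"
      using x y fin by (intro sup) (auto simp: M.component_add)
    also have "\<dots> = (\<Oplus>\<^bsub>N\<^esub>r\<in>?A. \<phi> r (component M x r) \<oplus>\<^bsub>N\<^esub> \<phi> r (component M y r))"
      using x y cl' by (intro N.finsum_cong') (auto simp: M.component_add M.component_grade ad)
    also have "\<dots> = (\<Oplus>\<^bsub>N\<^esub>r\<in>?A. \<phi> r (component M x r)) \<oplus>\<^bsub>N\<^esub> (\<Oplus>\<^bsub>N\<^esub>r\<in>?A. \<phi> r (component M y r))"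
      using x y cl' by (intro N.finsum_addf) auto
    also have "\<dots> = gr_ext M N \<phi> x \<oplus>\<^bsub>N\<^esub> gr_ext M N \<phi> y"
      using sup[OF x fin] sup[OF y fin] by auto
    finally show ?thesis .
  qed
qed

text \<open>Additive candidates \<open>p i\<close> for the projections recover the summands of a decomposition, which is
  therefore unique.  Every element has one because the elements that have one are closed under addition
  and include the homogeneous ones.\<close>

lemma is_gradingI:
  assumes M: "abelian_group M" and sub: "\<And>i. additive_subgroup (grade M i) M"
    and p_add: "\<And>i x y. \<lbrakk>x \<in> carrier M; y \<in> carrier M\<rbrakk> \<Longrightarrow> p i (x \<oplus>\<^bsub>M\<^esub> y) = p i x \<oplus>\<^bsub>M\<^esub> p i y"
    and p_same: "\<And>i x. x \<in> grade M i \<Longrightarrow> p i x = x"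
    and p_other: "\<And>i j x. \<lbrakk>x \<in> grade M i; i \<noteq> j\<rbrakk> \<Longrightarrow> p j x = \<zero>\<^bsub>M\<^esub>"
    and gen: "\<And>P x. \<lbrakk>x \<in> carrier M; P \<zero>\<^bsub>M\<^esub>; \<And>i x. x \<in> grade M i \<Longrightarrow> P x;
       \<And>x y. \<lbrakk>x \<in> carrier M; y \<in> carrier M; P x; P y\<rbrakk> \<Longrightarrow> P (x \<oplus>\<^bsub>M\<^esub> y)\<rbrakk> \<Longrightarrow> P x"
  shows "is_grading M"
proof -
  interpret M: abelian_group M by fact
  have gc: "x \<in> carrier M" if "x \<in> grade M i" for x i
    using additive_subgroup.a_Hcarr[OF sub that] .
  have gz: "\<zero>\<^bsub>M\<^esub> \<in> grade M i" for i using additive_subgroup.zero_closed[OF sub] .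
  have psum: "p j (\<Oplus>\<^bsub>M\<^esub>i\<in>A. f i) = (if j \<in> A then f j else \<zero>\<^bsub>M\<^esub>)"
    if "finite A" "\<And>i. f i \<in> grade M i" for A f j
    using that
  proof (induction A)
    case empty then show ?case using p_same[OF gz, of j] by simp
  next
    case (insert a A)
    have "f \<in> A \<rightarrow> carrier M" using gc insert.prems by blast
    then have "p j (\<Oplus>\<^bsub>M\<^esub>i\<in>insert a A. f i) = p j (f a) \<oplus>\<^bsub>M\<^esub> p j (\<Oplus>\<^bsub>M\<^esub>i\<in>A. f i)"
      using insert gc[OF insert.prems] by (simp add: M.finsum_insert p_add)
    then show ?case using insert gc[OF insert.prems] p_same[OF insert.prems, of a] p_other[OF insert.prems, of a j]
      by (cases "a = j") auto
  qed
  have "\<exists>f. homog_decomp M x f" if x: "x \<in> carrier M" for x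
  proof -
    have "\<exists>f A. (\<forall>i. f i \<in> grade M i) \<and> finite A \<and> (\<forall>i. i \<notin> A \<longrightarrow> f i = \<zero>\<^bsub>M\<^esub>) \<and> x = (\<Oplus>\<^bsub>M\<^esub>i\<in>A. f i)"
    proof (rule gen[OF x])
      show "\<exists>f A. (\<forall>i. f i \<in> grade M i) \<and> finite A \<and> (\<forall>i. i \<notin> A \<longrightarrow> f i = \<zero>\<^bsub>M\<^esub>) \<and> \<zero>\<^bsub>M\<^esub> = (\<Oplus>\<^bsub>M\<^esub>i\<in>A. f i)"
        using gz by (intro exI[of _ "\<lambda>_. \<zero>\<^bsub>M\<^esub>"] exI[of _ "{}"]) simp
    next
      fix i x assume x: "x \<in> grade M i"
      show "\<exists>f A. (\<forall>i. f i \<in> grade M i) \<and> finite A \<and> (\<forall>i. i \<notin> A \<longrightarrow> f i = \<zero>\<^bsub>M\<^esub>) \<and> x = (\<Oplus>\<^bsub>M\<^esub>i\<in>A. f i)"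
        using x gz gc by (intro exI[of _ "\<lambda>j. if j = i then x else \<zero>\<^bsub>M\<^esub>"] exI[of _ "{i}"])
          (auto simp: M.finsum_insert)
    next
      fix x y assume "\<exists>f A. (\<forall>i. f i \<in> grade M i) \<and> finite A \<and> (\<forall>i. i \<notin> A \<longrightarrow> f i = \<zero>\<^bsub>M\<^esub>) \<and> x = (\<Oplus>\<^bsub>M\<^esub>i\<in>A. f i)"
        "\<exists>f A. (\<forall>i. f i \<in> grade M i) \<and> finite A \<and> (\<forall>i. i \<notin> A \<longrightarrow> f i = \<zero>\<^bsub>M\<^esub>) \<and> y = (\<Oplus>\<^bsub>M\<^esub>i\<in>A. f i)"
      then obtain f A g B where f: "\<And>i. f i \<in> grade M i" "finite A" "\<And>i. i \<notin> A \<Longrightarrow> f i = \<zero>\<^bsub>M\<^esub>" "x = (\<Oplus>\<^bsub>M\<^esub>i\<in>A. f i)"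
        and g: "\<And>i. g i \<in> grade M i" "finite B" "\<And>i. i \<notin> B \<Longrightarrow> g i = \<zero>\<^bsub>M\<^esub>" "y = (\<Oplus>\<^bsub>M\<^esub>i\<in>B. g i)" by metis
      have "f \<in> Pi J (\<lambda>_. carrier M)" "g \<in> Pi J (\<lambda>_. carrier M)" for J using gc f(1) g(1) by blast+
      then have "x \<oplus>\<^bsub>M\<^esub> y = (\<Oplus>\<^bsub>M\<^esub>i\<in>A \<union> B. f i) \<oplus>\<^bsub>M\<^esub> (\<Oplus>\<^bsub>M\<^esub>i\<in>A \<union> B. g i)"
        using M.finsum_superset[of "A \<union> B" A f] M.finsum_superset[of "A \<union> B" B g] f g by auto
      also have "\<dots> = (\<Oplus>\<^bsub>M\<^esub>i\<in>A \<union> B. f i \<oplus>\<^bsub>M\<^esub> g i)"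
        using gc f(1) g(1) by (intro M.finsum_addf[symmetric]) blast+
      finally show "\<exists>f A. (\<forall>i. f i \<in> grade M i) \<and> finite A \<and> (\<forall>i. i \<notin> A \<longrightarrow> f i = \<zero>\<^bsub>M\<^esub>) \<and> x \<oplus>\<^bsub>M\<^esub> y = (\<Oplus>\<^bsub>M\<^esub>i\<in>A. f i)"
        using f g by (intro exI[of _ "\<lambda>i. f i \<oplus>\<^bsub>M\<^esub> g i"] exI[of _ "A \<union> B"])
          (auto simp: additive_subgroup.a_closed[OF sub])
    qed
    then obtain f A where f: "\<And>i. f i \<in> grade M i" "finite A" "\<And>i. i \<notin> A \<Longrightarrow> f i = \<zero>\<^bsub>M\<^esub>" "x = (\<Oplus>\<^bsub>M\<^esub>i\<in>A. f i)" by metis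
    have "f \<in> A \<rightarrow> carrier M" using gc f(1) by blast
    then have "x = (\<Oplus>\<^bsub>M\<^esub>i\<in>{i. f i \<noteq> \<zero>\<^bsub>M\<^esub>}. f i)"
      unfolding f(4) using f(2,3) by (intro M.finsum_superset[symmetric]) auto
    moreover have "finite {i. f i \<noteq> \<zero>\<^bsub>M\<^esub>}" using f(2,3) by (auto intro: finite_subset[of _ A])
    ultimately show ?thesis using f(1) by (auto simp: homog_decomp_def)
  qed
  moreover have "f = g" if "homog_decomp M x f" "homog_decomp M x g" for x f g
  proof
    fix j show "f j = g j"
      using psum[of "{i. f i \<noteq> \<zero>\<^bsub>M\<^esub>}" f j] psum[of "{i. g i \<noteq> \<zero>\<^bsub>M\<^esub>}" g j] that
      by (auto simp: homog_decomp_def split: if_splits)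
  qed
  ultimately show ?thesis using sub unfolding is_grading_def by blast
qed

locale graded_lmod = left_module B M for B :: "('k, 'b, 'x) graded_module_scheme" (structure)
    and M :: "('b, 'm, 'y) graded_module_scheme" (structure) +
  assumes M_grading: "is_grading M"
    and smult_grade: "\<lbrakk>a \<in> grade B i; m \<in> grade M j\<rbrakk> \<Longrightarrow> a \<odot>\<^bsub>M\<^esub> m \<in> grade M (i + j)"

lemma graded_lmod_iff: "graded_left_module B M \<longleftrightarrow> graded_lmod B M"
  by (auto simp: graded_left_module_def graded_lmod_def graded_lmod_axioms_def)

sublocale graded_lmod \<subseteq> G: graded_group M
  by (intro graded_group.intro graded_group_axioms.intro M_grading M.abelian_group_axioms)

lemma graded_lmod_abelian_group: "graded_lmod B M \<Longrightarrow> abelian_group M"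
  by (rule left_module_abelian_group[OF graded_lmod.axioms(1)])

lemma (in graded_lmod) component_smult:
  assumes a: "a \<in> grade B s" "a \<in> carrier B" and x: "x \<in> carrier M"
  shows "component M (a \<odot>\<^bsub>M\<^esub> x) (s + i) = a \<odot>\<^bsub>M\<^esub> component M x i"
  using x
proof (induction x rule: G.homog_induct)
  case zero then show ?case using a by (simp add: lsmult_zero G.component_zero)
next
  case (homog j x) then show ?case using a smult_grade[OF a(1) homog]
    by (simp add: G.component_homog lsmult_zero)
next
  case (add x y) then show ?case using a
    by (simp add: lsmult_r_distr G.component_add lsmult_closed G.component_closed)
qed

lemma gr_hom_lmod_hom: "f \<in> gr_hom R M N \<Longrightarrow> f \<in> lmod_hom R M N"
  and gr_hom_grade: "f \<in> gr_hom R M N \<Longrightarrow> x \<in> grade M i \<Longrightarrow> f x \<in> grade N i"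
  by (auto simp: gr_hom_def)

section \<open>Spans and finite dimension\<close>

text \<open>An inductive description of the linear span: it allows induction in place of computations with
  coefficient functions.\<close>

inductive_set kspan :: "('k, 'r) ring_scheme \<Rightarrow> ('k, 'v, 'x) module_scheme \<Rightarrow> 'v set \<Rightarrow> 'v set"
  for K V S where
    kspan_zero: "\<zero>\<^bsub>V\<^esub> \<in> kspan K V S"
  | kspan_base: "s \<in> S \<Longrightarrow> s \<in> kspan K V S"
  | kspan_add: "\<lbrakk>x \<in> kspan K V S; y \<in> kspan K V S\<rbrakk> \<Longrightarrow> x \<oplus>\<^bsub>V\<^esub> y \<in> kspan K V S"
  | kspan_smult: "\<lbrakk>c \<in> carrier K; x \<in> kspan K V S\<rbrakk> \<Longrightarrow> c \<odot>\<^bsub>V\<^esub> x \<in> kspan K V S"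

lemma (in module) kspan_closed:
  assumes "S \<subseteq> carrier M" "x \<in> kspan R M S" shows "x \<in> carrier M"
  using assms(2) by induction (use assms(1) in auto)

lemma kspan_mono: assumes "S \<subseteq> T" "x \<in> kspan K V S" shows "x \<in> kspan K V T"
  using assms(2) by induction (use assms(1) in \<open>auto intro: kspan.intros\<close>)

lemma (in module) kspan_combination:
  assumes S: "finite S" "S \<subseteq> carrier M" and x: "x \<in> kspan R M S"
  shows "\<exists>c\<in>S \<rightarrow> carrier R. x = (\<Oplus>\<^bsub>M\<^esub>s\<in>S. c s \<odot>\<^bsub>M\<^esub> s)"
  using x
proof induction
  case kspan_zero
  have "(\<Oplus>\<^bsub>M\<^esub>s\<in>S. \<zero> \<odot>\<^bsub>M\<^esub> s) \<in> {\<zero>\<^bsub>M\<^esub>}"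
    using S by (intro M.finsum_in_submonoid) auto
  then show ?case by (intro bexI[of _ "\<lambda>_. \<zero>"]) auto
next
  case (kspan_base s)
  have "(\<Oplus>\<^bsub>M\<^esub>t\<in>S. (if t = s then \<one> else \<zero>) \<odot>\<^bsub>M\<^esub> t) = (\<Oplus>\<^bsub>M\<^esub>t\<in>{s}. (if t = s then \<one> else \<zero>) \<odot>\<^bsub>M\<^esub> t)"
    using S kspan_base by (intro M.finsum_superset[symmetric]) (auto simp: subset_iff)
  also have "\<dots> = s" using S kspan_base by (auto simp: M.finsum_insert)
  finally show ?case by (intro bexI[of _ "\<lambda>t. if t = s then \<one> else \<zero>"]) auto
next
  case (kspan_add x y)
  then obtain c d where c: "c \<in> S \<rightarrow> carrier R" "x = (\<Oplus>\<^bsub>M\<^esub>s\<in>S. c s \<odot>\<^bsub>M\<^esub> s)"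
    and d: "d \<in> S \<rightarrow> carrier R" "y = (\<Oplus>\<^bsub>M\<^esub>s\<in>S. d s \<odot>\<^bsub>M\<^esub> s)" by blast
  have "x \<oplus>\<^bsub>M\<^esub> y = (\<Oplus>\<^bsub>M\<^esub>s\<in>S. c s \<odot>\<^bsub>M\<^esub> s \<oplus>\<^bsub>M\<^esub> d s \<odot>\<^bsub>M\<^esub> s)"
    unfolding c d using S c(1) d(1) by (intro M.finsum_addf[symmetric]) (auto simp: Pi_iff subset_iff)
  also have "\<dots> = (\<Oplus>\<^bsub>M\<^esub>s\<in>S. (c s \<oplus> d s) \<odot>\<^bsub>M\<^esub> s)"
    using S c(1) d(1) by (intro M.finsum_cong') (auto simp: smult_l_distr Pi_iff subset_iff)
  finally show ?case using c(1) d(1) by (intro bexI[of _ "\<lambda>s. c s \<oplus> d s"]) auto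
next
  case (kspan_smult a x)
  then obtain c where c: "c \<in> S \<rightarrow> carrier R" "x = (\<Oplus>\<^bsub>M\<^esub>s\<in>S. c s \<odot>\<^bsub>M\<^esub> s)" by blast
  have "a \<odot>\<^bsub>M\<^esub> x = (\<Oplus>\<^bsub>M\<^esub>s\<in>S. a \<odot>\<^bsub>M\<^esub> (c s \<odot>\<^bsub>M\<^esub> s))"
    unfolding c using S c(1) kspan_smult(1) by (intro finsum_smult_ldistr) (auto simp: Pi_iff subset_iff)
  also have "\<dots> = (\<Oplus>\<^bsub>M\<^esub>s\<in>S. (a \<otimes> c s) \<odot>\<^bsub>M\<^esub> s)"
    using S c(1) kspan_smult(1) by (intro M.finsum_cong') (auto simp: smult_assoc1 Pi_iff subset_iff)
  finally show ?case using c(1) kspan_smult(1) by (intro bexI[of _ "\<lambda>s. a \<otimes> c s"]) auto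
qed

lemma (in module) fin_dim_iff_kspan:
  "fin_dim R M \<longleftrightarrow> (\<exists>S. finite S \<and> S \<subseteq> carrier M \<and> carrier M \<subseteq> kspan R M S)"
proof
  assume "fin_dim R M"
  then obtain S where S: "finite S" "S \<subseteq> carrier M"
    "\<And>v. v \<in> carrier M \<Longrightarrow> \<exists>c\<in>S \<rightarrow> carrier R. v = (\<Oplus>\<^bsub>M\<^esub>s\<in>S. c s \<odot>\<^bsub>M\<^esub> s)" unfolding fin_dim_def by blast
  have "v \<in> kspan R M S" if v: "v \<in> carrier M" for v
  proof -
    obtain c where c: "c \<in> S \<rightarrow> carrier R" "v = (\<Oplus>\<^bsub>M\<^esub>s\<in>S. c s \<odot>\<^bsub>M\<^esub> s)" using S(3)[OF v] by blast
    have "(\<Oplus>\<^bsub>M\<^esub>s\<in>S. c s \<odot>\<^bsub>M\<^esub> s) \<in> kspan R M S"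
      using S c(1) kspan_closed[OF S(2)]
      by (intro M.finsum_in_submonoid) (auto intro: kspan.intros)
    then show ?thesis using c by simp
  qed
  then show "\<exists>S. finite S \<and> S \<subseteq> carrier M \<and> carrier M \<subseteq> kspan R M S" using S by blast
next
  assume "\<exists>S. finite S \<and> S \<subseteq> carrier M \<and> carrier M \<subseteq> kspan R M S"
  then show "fin_dim R M" unfolding fin_dim_def using kspan_combination by (meson subsetD)
qed

lemma (in module) kspan_insert_decomp:
  assumes s: "s \<in> carrier M" and S: "S \<subseteq> carrier M" and x: "x \<in> kspan R M (insert s S)"
  shows "\<exists>c\<in>carrier R. \<exists>v\<in>kspan R M S. x = c \<odot>\<^bsub>M\<^esub> s \<oplus>\<^bsub>M\<^esub> v"
  using x
proof induction
  case kspan_zero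
  then show ?case using s by (intro bexI[of _ \<zero>] bexI[of _ "\<zero>\<^bsub>M\<^esub>"]) (auto intro: kspan.intros)
next
  case (kspan_base t)
  then consider "t = s" | "t \<in> S" by blast
  then show ?case
  proof cases
    case 1 then show ?thesis using s by (intro bexI[of _ \<one>] bexI[of _ "\<zero>\<^bsub>M\<^esub>"]) (auto intro: kspan.intros)
  next
    case 2 then show ?thesis using s S by (intro bexI[of _ \<zero>] bexI[of _ t]) (auto intro: kspan.intros)
  qed
next
  case (kspan_add x y)
  then obtain c v d w where cd: "c \<in> carrier R" "d \<in> carrier R" "v \<in> kspan R M S" "w \<in> kspan R M S"
    "x = c \<odot>\<^bsub>M\<^esub> s \<oplus>\<^bsub>M\<^esub> v" "y = d \<odot>\<^bsub>M\<^esub> s \<oplus>\<^bsub>M\<^esub> w" by blast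
  then have "x \<oplus>\<^bsub>M\<^esub> y = (c \<oplus> d) \<odot>\<^bsub>M\<^esub> s \<oplus>\<^bsub>M\<^esub> (v \<oplus>\<^bsub>M\<^esub> w)"
    using s kspan_closed[OF S] by (simp add: smult_l_distr M.a_ac)
  then show ?case using cd by (intro bexI[of _ "c \<oplus> d"] bexI[of _ "v \<oplus>\<^bsub>M\<^esub> w"]) (auto intro: kspan.intros)
next
  case (kspan_smult a x)
  then obtain c v where c: "c \<in> carrier R" "v \<in> kspan R M S" "x = c \<odot>\<^bsub>M\<^esub> s \<oplus>\<^bsub>M\<^esub> v" by blast
  then have "a \<odot>\<^bsub>M\<^esub> x = (a \<otimes> c) \<odot>\<^bsub>M\<^esub> s \<oplus>\<^bsub>M\<^esub> a \<odot>\<^bsub>M\<^esub> v"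
    using s kspan_smult kspan_closed[OF S] by (simp add: smult_r_distr smult_assoc1)
  then show ?case using c kspan_smult by (intro bexI[of _ "a \<otimes> c"] bexI[of _ "a \<odot>\<^bsub>M\<^esub> v"]) (auto intro: kspan.intros)
qed

text \<open>By induction on the spanning set \<open>S \<union> {s}\<close>: if \<open>W\<close> is not contained in the span of \<open>S\<close>, some \<open>w \<in> W\<close> has a
  nonzero coefficient at \<open>s\<close>, and subtracting a multiple of \<open>w\<close> moves any element of \<open>W\<close> into the
  intersection of \<open>W\<close> with the span of \<open>S\<close>, to which the induction hypothesis applies.\<close>

lemma subspace_finitely_spanned:
  assumes K: "field K" and V: "module K V" and S: "finite S" "S \<subseteq> carrier V"
    and W: "W \<subseteq> kspan K V S" "\<zero>\<^bsub>V\<^esub> \<in> W" "\<And>x y. \<lbrakk>x \<in> W; y \<in> W\<rbrakk> \<Longrightarrow> x \<oplus>\<^bsub>V\<^esub> y \<in> W"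
      "\<And>c x. \<lbrakk>c \<in> carrier K; x \<in> W\<rbrakk> \<Longrightarrow> c \<odot>\<^bsub>V\<^esub> x \<in> W"
  shows "\<exists>T. finite T \<and> T \<subseteq> W \<and> W \<subseteq> kspan K V T"
  using S W
proof (induction S arbitrary: W rule: finite_induct)
  case empty
  interpret module K V by fact
  have "x = \<zero>\<^bsub>V\<^esub>" if "x \<in> kspan K V {}" for x using that by induction auto
  then show ?case using empty.prems by (intro exI[of _ "{}"]) (auto intro: kspan_zero)
next
  case (insert s S)
  interpret field K by fact
  interpret module K V by fact
  have s: "s \<in> carrier V" and S: "S \<subseteq> carrier V" using insert.prems(1) by auto
  have sS: "insert s S \<subseteq> carrier V" using s S by blast
  show ?case
  proof (cases "W \<subseteq> kspan K V S")
    case True then show ?thesis using insert.IH[of W] S insert.prems by auto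
  next
    case False
    then obtain w where w: "w \<in> W" "w \<notin> kspan K V S" by blast
    obtain c v where c: "c \<in> carrier K" "v \<in> kspan K V S" "w = c \<odot>\<^bsub>V\<^esub> s \<oplus>\<^bsub>V\<^esub> v"
      using kspan_insert_decomp[OF s S] w(1) insert.prems(2) by blast
    have c0: "c \<noteq> \<zero>\<^bsub>K\<^esub>" using w(2) c s kspan_closed[OF S c(2)] by auto
    then have cu: "c \<in> Units K" using c(1) field_Units by blast
    have "\<exists>T. finite T \<and> T \<subseteq> W \<inter> kspan K V S \<and> W \<inter> kspan K V S \<subseteq> kspan K V T"
      using insert.prems by (intro insert.IH S) (auto intro: kspan.intros)
    then obtain T where T: "finite T" "T \<subseteq> W \<inter> kspan K V S" "W \<inter> kspan K V S \<subseteq> kspan K V T" by blast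
    have "x \<in> kspan K V (insert w T)" if x: "x \<in> W" for x
    proof -
      obtain d u where d: "d \<in> carrier K" "u \<in> kspan K V S" "x = d \<odot>\<^bsub>V\<^esub> s \<oplus>\<^bsub>V\<^esub> u"
        using kspan_insert_decomp[OF s S] x insert.prems(2) by blast
      define e where "e = d \<otimes>\<^bsub>K\<^esub> inv\<^bsub>K\<^esub> c"
      have e: "e \<in> carrier K" "e \<otimes>\<^bsub>K\<^esub> c = d" using d cu c(1) by (simp_all add: e_def m_assoc)
      note cl = w(1) kspan_closed[OF S d(2)] kspan_closed[OF S c(2)] c(1) d(1) e(1) s
      have ew: "e \<odot>\<^bsub>V\<^esub> w = d \<odot>\<^bsub>V\<^esub> s \<oplus>\<^bsub>V\<^esub> e \<odot>\<^bsub>V\<^esub> v"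
        using c(3) cl e(2) by (simp add: smult_r_distr flip: smult_assoc1)
      define y where "y = x \<oplus>\<^bsub>V\<^esub> (\<ominus>\<^bsub>K\<^esub> e) \<odot>\<^bsub>V\<^esub> w"
      have wc: "w \<in> carrier V" using c cl by simp
      have "y = u \<oplus>\<^bsub>V\<^esub> (\<ominus>\<^bsub>K\<^esub> e) \<odot>\<^bsub>V\<^esub> v"
      proof -
        have "y = (d \<odot>\<^bsub>V\<^esub> s \<oplus>\<^bsub>V\<^esub> u) \<oplus>\<^bsub>V\<^esub> (\<ominus>\<^bsub>V\<^esub> (d \<odot>\<^bsub>V\<^esub> s) \<oplus>\<^bsub>V\<^esub> \<ominus>\<^bsub>V\<^esub> (e \<odot>\<^bsub>V\<^esub> v))"
          using cl wc by (simp add: y_def d(3) smult_l_minus ew M.minus_add)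
        also have "\<dots> = (d \<odot>\<^bsub>V\<^esub> s \<oplus>\<^bsub>V\<^esub> \<ominus>\<^bsub>V\<^esub> (d \<odot>\<^bsub>V\<^esub> s)) \<oplus>\<^bsub>V\<^esub> (u \<oplus>\<^bsub>V\<^esub> \<ominus>\<^bsub>V\<^esub> (e \<odot>\<^bsub>V\<^esub> v))"
          using cl by (simp add: M.a_ac)
        finally show ?thesis using cl by (simp add: M.r_neg smult_l_minus)
      qed
      then have "y \<in> kspan K V S" using d c e by (auto intro!: kspan_add kspan_smult)
      moreover have "y \<in> W" unfolding y_def using insert.prems(4,5) x w(1) e(1) by simp
      ultimately have "y \<in> kspan K V (insert w T)" using T(3) kspan_mono[of T "insert w T"] by blast
      then have "y \<oplus>\<^bsub>V\<^esub> e \<odot>\<^bsub>V\<^esub> w \<in> kspan K V (insert w T)"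
        using e by (auto intro: kspan.intros)
      moreover have "y \<oplus>\<^bsub>V\<^esub> e \<odot>\<^bsub>V\<^esub> w = x"
        using cl wc d by (simp add: y_def smult_l_minus M.a_assoc M.l_neg)
      ultimately show ?thesis by simp
    qed
    then show ?thesis using T w(1) by (intro exI[of _ "insert w T"]) auto
  qed
qed

section \<open>The twisted algebra and the twisting functor\<close>

text \<open>Twisting a module, forgetting its grading and passing to \<open>B\<^sup>\<sigma>\<close> leave the underlying group unchanged.  Sums
  depend on this group only, and components depend on the grading in addition.\<close>

lemma finsum_cong_struct:
  assumes "carrier V = carrier W" "ring.add V = ring.add W" "ring.zero V = ring.zero W"
  shows "finsum V = finsum W"
  by (rule ext)+ (simp add: finsum_def finprod_def assms)

lemma homog_decomp_cong_struct:
  assumes "carrier V = carrier W" "ring.add V = ring.add W" "ring.zero V = ring.zero W" "grade V = grade W"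
  shows "homog_decomp V = homog_decomp W"
  using assms finsum_cong_struct[OF assms(1-3)] by (auto simp: homog_decomp_def fun_eq_iff)

lemma component_cong_struct:
  assumes "carrier V = carrier W" "ring.add V = ring.add W" "ring.zero V = ring.zero W" "grade V = grade W"
  shows "component V = component W"
  using homog_decomp_cong_struct[OF assms] by (simp add: component_def fun_eq_iff)

lemma abelian_group_cong_struct:
  assumes "abelian_group W" "carrier V = carrier W" "ring.add V = ring.add W" "ring.zero V = ring.zero W"
  shows "abelian_group V"
proof -
  interpret W: abelian_group W by fact
  show ?thesis using assms(2-4) by (intro abelian_groupI) (auto simp: W.a_ac intro: W.l_neg)
qed

lemma is_grading_cong_struct:
  assumes "is_grading W" "carrier V = carrier W" "ring.add V = ring.add W" "ring.zero V = ring.zero W" "grade V = grade W"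
  shows "is_grading V"
proof -
  have "additive_subgroup H V = additive_subgroup H W" for H
    by (simp add: additive_subgroup_def subgroup_def m_inv_def assms)
  then show ?thesis using assms homog_decomp_cong_struct[OF assms(2-5)] by (simp add: is_grading_def)
qed

text \<open>Multiplication in \<open>B\<^sup>\<sigma>\<close> is the action of \<open>B\<close> on \<open>F\<^sub>\<sigma>\<close> of this module, so that the ring laws of \<open>B\<^sup>\<sigma>\<close> are
  special cases of the module laws of \<open>F\<^sub>\<sigma> M\<close>.\<close>

definition regular_module :: "('k, 'b, 'x) graded_module_scheme \<Rightarrow> ('b, 'b) graded_module"
  where "regular_module B = \<lparr>carrier = carrier B, monoid.mult = monoid.mult B, one = one B,
    ring.zero = ring.zero B, ring.add = ring.add B, smult = monoid.mult B, grade = grade B\<rparr>"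

locale twist =
  fixes K :: "('k, 'r) ring_scheme" and B :: "('k, 'b, 'x) graded_module_scheme" and \<sigma> :: "'b \<Rightarrow> 'b"
  assumes field_K: "field K" and B_graded: "graded_algebra K B" and B_fin_dim: "fin_dim K B"
    and aut: "graded_aut K B \<sigma>"
begin

abbreviation "B\<sigma> \<equiv> twisted_algebra B \<sigma>"
abbreviation "F \<equiv> F_twist B \<sigma>"
abbreviation "spow \<equiv> aut_pow B \<sigma>"

sublocale A: k_algebra K B
  using B_graded by (simp add: graded_algebra_def)

sublocale BG: graded_group B
  using B_graded
  by (auto simp: graded_algebra_def graded_group_def graded_group_axioms_def intro: A.B.abelian_group_axioms)

lemma one_grade: "\<one>\<^bsub>B\<^esub> \<in> grade B 0"
  and mult_grade: "\<lbrakk>a \<in> grade B i; b \<in> grade B j\<rbrakk> \<Longrightarrow> a \<otimes>\<^bsub>B\<^esub> b \<in> grade B (i + j)"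
  and scal_grade: "\<lbrakk>c \<in> carrier K; b \<in> grade B j\<rbrakk> \<Longrightarrow> c \<odot>\<^bsub>B\<^esub> b \<in> grade B j"
  using B_graded submodule.smult_closed[of "grade B j" K B c b] by (auto simp: graded_algebra_def)

lemma kone_grade: "c \<in> carrier K \<Longrightarrow> c \<odot>\<^bsub>B\<^esub> \<one>\<^bsub>B\<^esub> \<in> grade B 0"
  by (simp add: scal_grade one_grade)

text \<open>The properties that \<open>\<sigma>\<close> passes on to its inverse and to all its powers.\<close>

definition graded_endo :: "('b \<Rightarrow> 'b) \<Rightarrow> bool" where
  "graded_endo f \<longleftrightarrow> (\<forall>b\<in>carrier B. f b \<in> carrier B) \<and> (\<forall>a\<in>carrier B. \<forall>b\<in>carrier B. f (a \<oplus>\<^bsub>B\<^esub> b) = f a \<oplus>\<^bsub>B\<^esub> f b)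
   \<and> (\<forall>a\<in>carrier B. \<forall>b\<in>carrier B. f (a \<otimes>\<^bsub>B\<^esub> b) = f a \<otimes>\<^bsub>B\<^esub> f b) \<and> f \<one>\<^bsub>B\<^esub> = \<one>\<^bsub>B\<^esub>
   \<and> (\<forall>c\<in>carrier K. \<forall>b\<in>carrier B. f (c \<odot>\<^bsub>B\<^esub> b) = c \<odot>\<^bsub>B\<^esub> f b) \<and> (\<forall>i. \<forall>b\<in>grade B i. f b \<in> grade B i)"

lemma graded_endo_sigma: "graded_endo \<sigma>"
  using aut by (auto simp: graded_endo_def graded_aut_def ring_iso_def ring_hom_def image_subset_iff)

lemma graded_endo_component:
  assumes f: "graded_endo f" and b: "b \<in> carrier B"
  shows "component B (f b) i = f (component B b i)"
  using b
proof (induction b rule: BG.homog_induct)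
  case zero
  have "f \<zero>\<^bsub>B\<^esub> \<in> grade B (i + 1)" "f \<zero>\<^bsub>B\<^esub> \<in> grade B i"
    using f BG.grade_zero by (auto simp: graded_endo_def)
  from BG.component_homog[OF this(1), of i] BG.component_homog[OF this(2), of i] show ?case
    by (simp add: BG.component_zero)
next
  case (homog j b)
  have "f \<zero>\<^bsub>B\<^esub> \<in> grade B (i + 1)" "f \<zero>\<^bsub>B\<^esub> \<in> grade B i"
    using f BG.grade_zero by (auto simp: graded_endo_def)
  from BG.component_homog[OF this(1), of i] BG.component_homog[OF this(2), of i]
  have "f \<zero>\<^bsub>B\<^esub> = \<zero>\<^bsub>B\<^esub>" by simp
  moreover have "f b \<in> grade B j" using f homog by (auto simp: graded_endo_def)
  ultimately show ?case using homog by (simp add: BG.component_homog)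
next
  case (add x y)
  then show ?case using f by (simp add: graded_endo_def BG.component_add BG.component_closed)
qed

definition sinv where "sinv = inv_into (carrier B) \<sigma>"

lemma sinv: "b \<in> carrier B \<Longrightarrow> sinv (\<sigma> b) = b" "b \<in> carrier B \<Longrightarrow> \<sigma> (sinv b) = b"
   "b \<in> carrier B \<Longrightarrow> sinv b \<in> carrier B"
proof -
  have "bij_betw \<sigma> (carrier B) (carrier B)" using aut by (simp add: graded_aut_def ring_iso_def)
  then show "b \<in> carrier B \<Longrightarrow> sinv (\<sigma> b) = b" "b \<in> carrier B \<Longrightarrow> \<sigma> (sinv b) = b"
   "b \<in> carrier B \<Longrightarrow> sinv b \<in> carrier B"
    by (auto simp: sinv_def bij_betw_def inv_into_f_f f_inv_into_f inv_into_into)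
qed

text \<open>Degrees are preserved because \<open>\<sigma>\<close> commutes with taking components: if \<open>b\<close> is homogeneous of degree \<open>i\<close>, then
  \<open>\<sigma>\<close> sends \<open>\<sigma>\<^sup>-\<^sup>1 b\<close> and its component in degree \<open>i\<close> to the same element.\<close>

lemma graded_endo_sinv: "graded_endo sinv"
proof -
  have inj: "a = b" if "\<sigma> a = \<sigma> b" "a \<in> carrier B" "b \<in> carrier B" for a b
    using that sinv(1) by metis
  have s: "\<And>b. b \<in> carrier B \<Longrightarrow> \<sigma> b \<in> carrier B"
    "\<And>a b. a \<in> carrier B \<Longrightarrow> b \<in> carrier B \<Longrightarrow> \<sigma> (a \<oplus>\<^bsub>B\<^esub> b) = \<sigma> a \<oplus>\<^bsub>B\<^esub> \<sigma> b"
    "\<And>a b. a \<in> carrier B \<Longrightarrow> b \<in> carrier B \<Longrightarrow> \<sigma> (a \<otimes>\<^bsub>B\<^esub> b) = \<sigma> a \<otimes>\<^bsub>B\<^esub> \<sigma> b"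
    "\<sigma> \<one>\<^bsub>B\<^esub> = \<one>\<^bsub>B\<^esub>"
    "\<And>c b. c \<in> carrier K \<Longrightarrow> b \<in> carrier B \<Longrightarrow> \<sigma> (c \<odot>\<^bsub>B\<^esub> b) = c \<odot>\<^bsub>B\<^esub> \<sigma> b"
    using graded_endo_sigma by (auto simp: graded_endo_def)
  have "sinv b \<in> grade B i" if b: "b \<in> grade B i" for b i
  proof -
    have bc: "b \<in> carrier B" using b by (rule BG.grade_carrier)
    have "\<sigma> (component B (sinv b) i) = component B (\<sigma> (sinv b)) i"
      using graded_endo_component[OF graded_endo_sigma sinv(3)[OF bc]] by simp
    also have "\<dots> = \<sigma> (sinv b)" using b bc by (simp add: sinv BG.component_homog)
    finally have "component B (sinv b) i = sinv b"
      using inj sinv(3)[OF bc] BG.component_closed by blast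
    then show ?thesis using BG.component_grade[OF sinv(3)[OF bc]] by metis
  qed
  moreover have "sinv (a \<oplus>\<^bsub>B\<^esub> b) = sinv a \<oplus>\<^bsub>B\<^esub> sinv b" "sinv (a \<otimes>\<^bsub>B\<^esub> b) = sinv a \<otimes>\<^bsub>B\<^esub> sinv b"
    if "a \<in> carrier B" "b \<in> carrier B" for a b
    by (rule inj; use that in \<open>simp add: s sinv\<close>)+
  moreover have "sinv (c \<odot>\<^bsub>B\<^esub> b) = c \<odot>\<^bsub>B\<^esub> sinv b" if "c \<in> carrier K" "b \<in> carrier B" for b c
    by (rule inj; use that in \<open>simp add: s sinv\<close>)
  moreover have "sinv \<one>\<^bsub>B\<^esub> = \<one>\<^bsub>B\<^esub>" by (rule inj; simp add: s sinv)
  ultimately show ?thesis using sinv(3) by (simp add: graded_endo_def)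
qed

lemma graded_endo_funpow: "graded_endo f \<Longrightarrow> graded_endo (f ^^ n)"
  by (induction n) (auto simp: graded_endo_def)

lemma graded_endo_spow: "graded_endo (spow t)"
  using graded_endo_funpow[OF graded_endo_sigma] graded_endo_funpow[OF graded_endo_sinv]
  by (simp add: aut_pow_def sinv_def)

lemma spow_closed [simp]: "b \<in> carrier B \<Longrightarrow> spow t b \<in> carrier B"
  and spow_plus: "\<lbrakk>a \<in> carrier B; b \<in> carrier B\<rbrakk> \<Longrightarrow> spow t (a \<oplus>\<^bsub>B\<^esub> b) = spow t a \<oplus>\<^bsub>B\<^esub> spow t b"
  and spow_mult: "\<lbrakk>a \<in> carrier B; b \<in> carrier B\<rbrakk> \<Longrightarrow> spow t (a \<otimes>\<^bsub>B\<^esub> b) = spow t a \<otimes>\<^bsub>B\<^esub> spow t b"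
  and spow_one: "spow t \<one>\<^bsub>B\<^esub> = \<one>\<^bsub>B\<^esub>"
  and spow_scal: "\<lbrakk>c \<in> carrier K; b \<in> carrier B\<rbrakk> \<Longrightarrow> spow t (c \<odot>\<^bsub>B\<^esub> b) = c \<odot>\<^bsub>B\<^esub> spow t b"
  and spow_grade: "b \<in> grade B i \<Longrightarrow> spow t b \<in> grade B i"
  using graded_endo_spow[of t] by (auto simp: graded_endo_def)

lemma spow_kone: "c \<in> carrier K \<Longrightarrow> spow t (c \<odot>\<^bsub>B\<^esub> \<one>\<^bsub>B\<^esub>) = c \<odot>\<^bsub>B\<^esub> \<one>\<^bsub>B\<^esub>"
  by (simp add: spow_scal spow_one)

lemma spow_0: "spow 0 b = b"
  by (simp add: aut_pow_def)

lemma spow_Suc: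
  assumes b: "b \<in> carrier B" shows "spow (t + 1) b = \<sigma> (spow t b)"
proof (cases "0 \<le> t")
  case True
  then have "nat (t + 1) = Suc (nat t)" by simp
  then show ?thesis using True by (simp add: aut_pow_def)
next
  case False
  define m where "m = nat (- t - 1)"
  have m: "nat (- t) = Suc m" "nat (-1 - t) = m" "nat (- t - 1) = m" using False by (auto simp: m_def)
  have "(sinv ^^ m) b \<in> carrier B" using graded_endo_funpow[OF graded_endo_sinv, of m] b by (simp add: graded_endo_def)
  then have "\<sigma> (spow t b) = (sinv ^^ m) b" using False by (simp add: aut_pow_def m sinv flip: sinv_def)
  moreover have "spow (t + 1) b = (sinv ^^ m) b"
  proof (cases "t = -1")
    case True then show ?thesis by (simp add: m_def aut_pow_def)
  next
    case f: False then show ?thesis using False by (simp add: aut_pow_def m flip: sinv_def)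
  qed
  ultimately show ?thesis by simp
qed

lemma spow_add:
  assumes b: "b \<in> carrier B" shows "spow s (spow t b) = spow (s + t) b"
proof (induction s rule: int_induct[where k = 0])
  case base then show ?case by (simp add: spow_0)
next
  case (step1 i) then show ?case using b spow_Suc[of "spow t b" i] spow_Suc[of b "i + t"]
    by (simp add: algebra_simps)
next
  case (step2 i)
  have e: "\<sigma> (spow (i - 1) (spow t b)) = \<sigma> (spow (i - 1 + t) b)"
    using b spow_Suc[of "spow t b" "i - 1"] spow_Suc[of b "i - 1 + t"] step2 by (simp add: algebra_simps)
  have "spow (i - 1) (spow t b) = sinv (\<sigma> (spow (i - 1) (spow t b)))" using b by (simp add: sinv(1))
  also have "\<dots> = spow (i - 1 + t) b" unfolding e using b by (simp add: sinv(1))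
  finally show ?case .
qed

lemma F_sel [simp]:
  "carrier (F M) = carrier M" "ring.add (F M) = ring.add M" "ring.zero (F M) = ring.zero M" "grade (F M) = grade M"
  by (simp_all add: F_twist_def)

lemma component_F: "component (F M) = component M"
  by (rule component_cong_struct) simp_all

lemma F_smult: "b \<odot>\<^bsub>F M\<^esub> m = gr_ext M M (\<lambda>r m. spow r b \<odot>\<^bsub>M\<^esub> m) m"
  by (simp add: F_twist_def gr_ext_def)

lemma Bs_sel [simp]:
  "carrier B\<sigma> = carrier B" "ring.add B\<sigma> = ring.add B" "ring.zero B\<sigma> = ring.zero B" "grade B\<sigma> = grade B"
  "one B\<sigma> = one B" "smult B\<sigma> = smult B"
  by (simp_all add: twisted_algebra_def)

lemma Bs_mult: "a \<otimes>\<^bsub>B\<sigma>\<^esub> b = a \<odot>\<^bsub>F (regular_module B)\<^esub> b"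
proof -
  have "component (regular_module B) = component B"
    "(finsum (regular_module B) :: (int \<Rightarrow> 'b) \<Rightarrow> _) = finsum B"
    by (rule component_cong_struct finsum_cong_struct; simp add: regular_module_def)+
  then show ?thesis by (simp add: twisted_algebra_def F_twist_def) (simp add: regular_module_def)
qed

lemma graded_lmod_regular: "graded_lmod B (regular_module B)"
proof (intro graded_lmod.intro left_module.intro left_module_axioms.intro graded_lmod_axioms.intro)
  show "abelian_group (regular_module B)"
    by (rule abelian_group_cong_struct[OF A.B.abelian_group_axioms]) (simp_all add: regular_module_def)
  show "is_grading (regular_module B)"
    by (rule is_grading_cong_struct[OF BG.grading]) (simp_all add: regular_module_def)
qed (auto simp: regular_module_def A.B.l_distr A.B.r_distr A.B.m_assoc mult_grade A.B.ring_axioms)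

context
  fixes M :: "('b, 'm, 'y) graded_module_scheme"
  assumes M: "graded_lmod B M"
begin

interpretation M: graded_lmod B M by (rule M)

private lemma F_prems: "graded_group M" "abelian_group M"
  "b \<in> carrier B \<Longrightarrow> x \<in> grade M r \<Longrightarrow> spow r b \<odot>\<^bsub>M\<^esub> x \<in> carrier M"
  "b \<in> carrier B \<Longrightarrow> x \<in> grade M r \<Longrightarrow> y \<in> grade M r \<Longrightarrow>
    spow r b \<odot>\<^bsub>M\<^esub> (x \<oplus>\<^bsub>M\<^esub> y) = spow r b \<odot>\<^bsub>M\<^esub> x \<oplus>\<^bsub>M\<^esub> spow r b \<odot>\<^bsub>M\<^esub> y"
  by (simp_all add: M.G.graded_group_axioms M.M.abelian_group_axioms M.lsmult_closed M.G.grade_carrier M.lsmult_r_distr)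

lemma F_smult_closed: "\<lbrakk>b \<in> carrier B; m \<in> carrier M\<rbrakk> \<Longrightarrow> b \<odot>\<^bsub>F M\<^esub> m \<in> carrier M"
  unfolding F_smult by (rule gr_ext_closed) (use F_prems in blast)+

lemma F_smult_r_distr: "\<lbrakk>b \<in> carrier B; m \<in> carrier M; m' \<in> carrier M\<rbrakk>
    \<Longrightarrow> b \<odot>\<^bsub>F M\<^esub> (m \<oplus>\<^bsub>M\<^esub> m') = b \<odot>\<^bsub>F M\<^esub> m \<oplus>\<^bsub>M\<^esub> b \<odot>\<^bsub>F M\<^esub> m'"
  unfolding F_smult by (rule gr_ext_add) (use F_prems in blast)+

lemma F_smult_homog: "\<lbrakk>b \<in> carrier B; m \<in> grade M r\<rbrakk> \<Longrightarrow> b \<odot>\<^bsub>F M\<^esub> m = spow r b \<odot>\<^bsub>M\<^esub> m"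
  unfolding F_smult by (rule gr_ext_homog) (use F_prems in blast)+

lemma F_smult_zero: "b \<in> carrier B \<Longrightarrow> b \<odot>\<^bsub>F M\<^esub> \<zero>\<^bsub>M\<^esub> = \<zero>\<^bsub>M\<^esub>"
  using F_smult_homog[OF _ M.G.grade_zero[of 0]] by (simp add: spow_0 M.lsmult_zero)

lemma F_smult_l_distr:
  assumes "a \<in> carrier B" "b \<in> carrier B" "m \<in> carrier M"
  shows "(a \<oplus>\<^bsub>B\<^esub> b) \<odot>\<^bsub>F M\<^esub> m = a \<odot>\<^bsub>F M\<^esub> m \<oplus>\<^bsub>M\<^esub> b \<odot>\<^bsub>F M\<^esub> m"
  using assms(3)
proof (induction m rule: M.G.homog_induct)
  case zero then show ?case using assms by (simp add: F_smult_zero)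
next
  case (homog i x) then show ?case using assms by (simp add: F_smult_homog spow_plus M.lsmult_l_distr M.G.grade_carrier)
next
  case (add x y) then show ?case using assms by (simp add: F_smult_r_distr F_smult_closed M.M.a_ac)
qed

lemma F_smult_grade: "\<lbrakk>b \<in> grade B s; m \<in> grade M r\<rbrakk> \<Longrightarrow> b \<odot>\<^bsub>F M\<^esub> m \<in> grade M (s + r)"
  by (simp add: F_smult_homog BG.grade_carrier spow_grade M.smult_grade)

lemma F_smult_one:
  assumes "m \<in> carrier M" shows "\<one>\<^bsub>B\<^esub> \<odot>\<^bsub>F M\<^esub> m = m"
  using assms
proof (induction m rule: M.G.homog_induct)
  case zero then show ?case by (simp add: F_smult_zero)
next
  case (homog i x) then show ?case by (simp add: F_smult_homog spow_one M.lsmult_one M.G.grade_carrier)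
next
  case (add x y) then show ?case by (simp add: F_smult_r_distr)
qed

lemma F_smult_kone:
  assumes "c \<in> carrier K" "m \<in> carrier M" shows "(c \<odot>\<^bsub>B\<^esub> \<one>\<^bsub>B\<^esub>) \<odot>\<^bsub>F M\<^esub> m = (c \<odot>\<^bsub>B\<^esub> \<one>\<^bsub>B\<^esub>) \<odot>\<^bsub>M\<^esub> m"
  using assms(2)
proof (induction m rule: M.G.homog_induct)
  case zero then show ?case using assms(1) by (simp add: F_smult_zero A.kone_closed M.lsmult_zero)
next
  case (homog i x) then show ?case using assms(1) by (simp add: F_smult_homog spow_kone A.kone_closed)
next
  case (add x y) then show ?case using assms(1) by (simp add: F_smult_r_distr A.kone_closed M.lsmult_r_distr)
qed

end

lemma Bs_mult_homog: "\<lbrakk>a \<in> carrier B; b \<in> grade B t\<rbrakk> \<Longrightarrow> a \<otimes>\<^bsub>B\<sigma>\<^esub> b = spow t a \<otimes>\<^bsub>B\<^esub> b"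
  unfolding Bs_mult using F_smult_homog[OF graded_lmod_regular, of a b t] by (simp add: regular_module_def)

lemma Bs_mult_closed: "\<lbrakk>a \<in> carrier B; b \<in> carrier B\<rbrakk> \<Longrightarrow> a \<otimes>\<^bsub>B\<sigma>\<^esub> b \<in> carrier B"
  unfolding Bs_mult using F_smult_closed[OF graded_lmod_regular, of a b] by (simp add: regular_module_def)

lemma Bs_mult_l_distr: "\<lbrakk>a \<in> carrier B; b \<in> carrier B; c \<in> carrier B\<rbrakk>
    \<Longrightarrow> (a \<oplus>\<^bsub>B\<^esub> b) \<otimes>\<^bsub>B\<sigma>\<^esub> c = a \<otimes>\<^bsub>B\<sigma>\<^esub> c \<oplus>\<^bsub>B\<^esub> b \<otimes>\<^bsub>B\<sigma>\<^esub> c"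
  unfolding Bs_mult using F_smult_l_distr[OF graded_lmod_regular, of a b c] by (simp add: regular_module_def)

lemma Bs_mult_r_distr: "\<lbrakk>a \<in> carrier B; b \<in> carrier B; c \<in> carrier B\<rbrakk>
    \<Longrightarrow> a \<otimes>\<^bsub>B\<sigma>\<^esub> (b \<oplus>\<^bsub>B\<^esub> c) = a \<otimes>\<^bsub>B\<sigma>\<^esub> b \<oplus>\<^bsub>B\<^esub> a \<otimes>\<^bsub>B\<sigma>\<^esub> c"
  unfolding Bs_mult using F_smult_r_distr[OF graded_lmod_regular, of a b c] by (simp add: regular_module_def)

lemma Bs_mult_zero: "a \<in> carrier B \<Longrightarrow> a \<otimes>\<^bsub>B\<sigma>\<^esub> \<zero>\<^bsub>B\<^esub> = \<zero>\<^bsub>B\<^esub>"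
  using Bs_mult_homog[OF _ BG.grade_zero] by simp

text \<open>If \<open>b\<close> and \<open>m\<close> are homogeneous of degrees \<open>s\<close> and \<open>r\<close>, both sides are \<open>\<sigma>\<^sup>r\<^sup>+\<^sup>s(a) \<sigma>\<^sup>r(b) m\<close>: on the right,
  \<open>a\<close> acts on an element of degree \<open>s + r\<close>.\<close>

lemma F_smult_assoc:
  assumes M: "graded_lmod B M" and a: "a \<in> carrier B" and b: "b \<in> carrier B" and m: "m \<in> carrier M"
  shows "(a \<otimes>\<^bsub>B\<sigma>\<^esub> b) \<odot>\<^bsub>F M\<^esub> m = a \<odot>\<^bsub>F M\<^esub> (b \<odot>\<^bsub>F M\<^esub> m)"
proof -
  interpret M: graded_lmod B M by fact
  note [simp] = Bs_mult_closed F_smult_closed[OF M]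
  show ?thesis using m
  proof (induction m rule: M.G.homog_induct)
    case zero then show ?case using a b by (simp add: F_smult_zero[OF M])
  next
    case (homog r m)
    then have m: "m \<in> carrier M" by (rule M.G.grade_carrier)
    show ?case using b
    proof (induction b rule: BG.homog_induct)
      case zero
      have z: "\<zero>\<^bsub>B\<^esub> \<odot>\<^bsub>F M\<^esub> m = \<zero>\<^bsub>M\<^esub>"
        using F_smult_l_distr[OF M A.B.zero_closed A.B.zero_closed m] m by (simp add: M.M.add.r_cancel_one')
      then show ?case using a m by (simp add: Bs_mult_zero F_smult_zero[OF M])
    next
      case (homog s b)
      then have b: "b \<in> carrier B" by (rule BG.grade_carrier)
      have "(a \<otimes>\<^bsub>B\<sigma>\<^esub> b) \<odot>\<^bsub>F M\<^esub> m = spow r (spow s a \<otimes>\<^bsub>B\<^esub> b) \<odot>\<^bsub>M\<^esub> m"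
        using a b homog \<open>m \<in> grade M r\<close> by (simp add: F_smult_homog[OF M] Bs_mult_homog[OF a homog])
      also have "\<dots> = spow (s + r) a \<odot>\<^bsub>M\<^esub> (spow r b \<odot>\<^bsub>M\<^esub> m)"
        using a b m by (simp add: spow_mult spow_add M.lsmult_assoc add.commute)
      also have "\<dots> = a \<odot>\<^bsub>F M\<^esub> (b \<odot>\<^bsub>F M\<^esub> m)"
        using a b F_smult_homog[OF M a F_smult_grade[OF M homog \<open>m \<in> grade M r\<close>]]
          F_smult_homog[OF M b \<open>m \<in> grade M r\<close>] by simp
      finally show ?case .
    next
      case (add x y) then show ?case using a m
        by (simp add: Bs_mult_r_distr F_smult_l_distr[OF M] F_smult_r_distr[OF M])
    qed
  next
    case (add x y) then show ?case using a b by (simp add: F_smult_r_distr[OF M])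
  qed
qed

lemma ring_Bs: "ring B\<sigma>"
proof (rule ringI)
  show "abelian_group B\<sigma>" by (rule abelian_group_cong_struct[OF A.B.abelian_group_axioms]) simp_all
  show "Group.monoid B\<sigma>"
  proof (rule monoidI)
    fix x y z assume "x \<in> carrier B\<sigma>" "y \<in> carrier B\<sigma>" "z \<in> carrier B\<sigma>"
    then show "x \<otimes>\<^bsub>B\<sigma>\<^esub> y \<otimes>\<^bsub>B\<sigma>\<^esub> z = x \<otimes>\<^bsub>B\<sigma>\<^esub> (y \<otimes>\<^bsub>B\<sigma>\<^esub> z)"
      using F_smult_assoc[OF graded_lmod_regular, of x y z] by (simp add: Bs_mult) (simp add: regular_module_def)
  next
    fix x assume x: "x \<in> carrier B\<sigma>"
    show "\<one>\<^bsub>B\<sigma>\<^esub> \<otimes>\<^bsub>B\<sigma>\<^esub> x = x"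
      using F_smult_one[OF graded_lmod_regular, of x] x by (simp add: Bs_mult) (simp add: regular_module_def)
    show "x \<otimes>\<^bsub>B\<sigma>\<^esub> \<one>\<^bsub>B\<sigma>\<^esub> = x" using Bs_mult_homog[OF _ one_grade] x by (simp add: spow_0)
  qed (simp_all add: Bs_mult_closed)
qed (simp_all add: Bs_mult_l_distr Bs_mult_r_distr)

lemma k_algebra_Bs: "k_algebra K B\<sigma>"
proof (intro k_algebra.intro field_K ring_Bs k_algebra_axioms.intro)
  show "module K B\<sigma>"
  proof (rule moduleI)
    show "cring K" using field_K by (simp add: field_def domain_def)
    show "abelian_group B\<sigma>" by (rule abelian_group_cong_struct[OF A.B.abelian_group_axioms]) simp_all
  qed (simp_all add: A.KB.smult_l_distr A.KB.smult_r_distr A.KB.smult_assoc1)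
  fix c a b assume "c \<in> carrier K" "a \<in> carrier B\<sigma>" "b \<in> carrier B\<sigma>"
  then have c: "c \<in> carrier K" and a: "a \<in> carrier B" and b: "b \<in> carrier B" by simp_all
  note [simp] = Bs_mult_closed
  from b show "c \<odot>\<^bsub>B\<sigma>\<^esub> a \<otimes>\<^bsub>B\<sigma>\<^esub> b = c \<odot>\<^bsub>B\<sigma>\<^esub> (a \<otimes>\<^bsub>B\<sigma>\<^esub> b)"
  proof (induction b rule: BG.homog_induct)
    case (homog i x) then show ?case using a c by (simp add: Bs_mult_homog spow_scal A.scal_assoc_l BG.grade_carrier)
  qed (use a c in \<open>simp_all add: Bs_mult_zero Bs_mult_r_distr A.KB.smult_r_distr\<close>)
  from b show "a \<otimes>\<^bsub>B\<sigma>\<^esub> (c \<odot>\<^bsub>B\<sigma>\<^esub> b) = c \<odot>\<^bsub>B\<sigma>\<^esub> (a \<otimes>\<^bsub>B\<sigma>\<^esub> b)"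
  proof (induction b rule: BG.homog_induct)
    case (homog i x) then show ?case using a c Bs_mult_homog[OF a scal_grade[OF c homog]]
      by (simp add: Bs_mult_homog A.scal_assoc_r BG.grade_carrier)
  qed (use a c in \<open>simp_all add: Bs_mult_zero Bs_mult_r_distr A.KB.smult_r_distr\<close>)
qed

lemma graded_lmod_F:
  assumes M: "graded_lmod B M" shows "graded_lmod B\<sigma> (F M)"
proof -
  interpret M: graded_lmod B M by fact
  show ?thesis
  proof (intro graded_lmod.intro left_module.intro left_module_axioms.intro graded_lmod_axioms.intro)
    show "ring B\<sigma>" by (rule ring_Bs)
    show "abelian_group (F M)"
      by (rule abelian_group_cong_struct[OF M.M.abelian_group_axioms]) simp_all
    show "is_grading (F M)"
      by (rule is_grading_cong_struct[OF M.M_grading]) simp_all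
  qed (simp_all add: F_smult_closed[OF M] F_smult_l_distr[OF M] F_smult_r_distr[OF M] F_smult_one[OF M]
      F_smult_assoc[OF M] F_smult_grade[OF M])
qed

lemma left_module_F: "graded_lmod B M \<Longrightarrow> left_module B\<sigma> (F M)"
  by (rule graded_lmod.axioms(1)[OF graded_lmod_F])

section \<open>Twisted shifts\<close>

lemma twist_shift_sel [simp]:
  "carrier (twist_shift B \<sigma> d M) = carrier M" "ring.add (twist_shift B \<sigma> d M) = ring.add M"
  "ring.zero (twist_shift B \<sigma> d M) = ring.zero M" "b \<odot>\<^bsub>twist_shift B \<sigma> d M\<^esub> m = spow d b \<odot>\<^bsub>M\<^esub> m"
  "grade (twist_shift B \<sigma> d M) r = grade M (r + d)"
  by (simp_all add: twist_shift_def shift_def aut_twist_def)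

lemma left_module_twist_shift:
  assumes "left_module B M" shows "left_module B (twist_shift B \<sigma> d M)"
proof -
  interpret M: left_module B M by fact
  show ?thesis
  proof (intro left_module.intro left_module_axioms.intro)
    show "abelian_group (twist_shift B \<sigma> d M)"
      by (rule abelian_group_cong_struct[OF M.M.abelian_group_axioms]) simp_all
  qed (simp_all add: M.lsmult_closed M.lsmult_l_distr M.lsmult_r_distr M.lsmult_assoc M.lsmult_one
     spow_plus spow_mult spow_one A.B.ring_axioms)
qed

lemma twist_shift_0: "twist_shift B \<sigma> 0 M = M"
  by (simp add: twist_shift_def shift_def aut_twist_def aut_pow_def)

text \<open>For \<open>x \<in> M\<^sub>r\<close> one has \<open>u (b * x) = u (\<sigma>\<^sup>r(b) x) = \<sigma>\<^sup>d\<^sup>+\<^sup>r(b) u x\<close>, and this is \<open>b * u x\<close> because \<open>u x\<close> has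
  degree \<open>r + d\<close> in \<open>N\<close>.\<close>

lemma twisted_gr_hom_F:
  assumes M: "graded_lmod B M" and N: "graded_lmod B N" and u: "u \<in> gr_hom B M (twist_shift B \<sigma> d N)"
  shows "u \<in> lmod_hom B\<sigma> (F M) (F N)"
proof -
  interpret M: graded_lmod B M by fact
  interpret N: graded_lmod B N by fact
  note uh = gr_hom_lmod_hom[OF u]
  have ucl: "u x \<in> carrier N" if "x \<in> carrier M" for x using lmod_hom_closed[OF uh that] by simp
  have uadd: "u (x \<oplus>\<^bsub>M\<^esub> y) = u x \<oplus>\<^bsub>N\<^esub> u y" if "x \<in> carrier M" "y \<in> carrier M" for x y
    using lmod_hom_add[OF uh that] by simp
  have uz: "u \<zero>\<^bsub>M\<^esub> = \<zero>\<^bsub>N\<^esub>"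
    using uadd[of "\<zero>\<^bsub>M\<^esub>" "\<zero>\<^bsub>M\<^esub>"] ucl[of "\<zero>\<^bsub>M\<^esub>"] by (simp add: N.M.add.r_cancel_one')
  show ?thesis
  proof (rule lmod_homI)
    fix a x assume "a \<in> carrier B\<sigma>" "x \<in> carrier (F M)"
    then have a: "a \<in> carrier B" and x: "x \<in> carrier M" by simp_all
    from x show "u (a \<odot>\<^bsub>F M\<^esub> x) = a \<odot>\<^bsub>F N\<^esub> u x"
    proof (induction x rule: M.G.homog_induct)
      case zero then show ?case using a by (simp add: F_smult_zero[OF M] F_smult_zero[OF N] uz)
    next
      case (homog r x)
      have "u (a \<odot>\<^bsub>F M\<^esub> x) = spow d (spow r a) \<odot>\<^bsub>N\<^esub> u x"
        using a homog lmod_hom_smult[OF uh, of "spow r a" x] by (simp add: F_smult_homog[OF M] M.G.grade_carrier)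
      moreover have "u x \<in> grade N (r + d)" using gr_hom_grade[OF u homog] by simp
      ultimately show ?case using a by (simp add: F_smult_homog[OF N a] spow_add add.commute)
    next
      case (add x y) then show ?case using a
        by (simp add: F_smult_r_distr[OF M] F_smult_r_distr[OF N] uadd ucl F_smult_closed[OF M])
    qed
  qed (use lmod_hom_extensional[OF uh] in \<open>simp_all add: ucl uadd\<close>)
qed

lemma gr_hom_F:
  "\<lbrakk>graded_lmod B M; graded_lmod B N; u \<in> gr_hom B M N\<rbrakk> \<Longrightarrow> u \<in> lmod_hom B\<sigma> (F M) (F N)"
  using twisted_gr_hom_F[of M N u 0] by (simp add: twist_shift_0)

end

section \<open>Degree-preserving homomorphisms\<close>

lemma (in graded_lmod) id_gr_hom: "(\<lambda>x\<in>carrier M. x) \<in> gr_hom B M M"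
  using lmod_hom_restrictI[OF left_module_axioms, of "\<lambda>x. x" M] G.grade_carrier
  by (auto simp: gr_hom_def)

lemma gr_hom_compose:
  assumes "graded_lmod B M" "f \<in> gr_hom B M N" "g \<in> gr_hom B N L"
  shows "compose (carrier M) g f \<in> gr_hom B M L"
proof -
  interpret M: graded_lmod B M by fact
  have "compose (carrier M) g f \<in> lmod_hom B M L"
    by (rule lmod_hom_compose[OF M.left_module_axioms gr_hom_lmod_hom[OF assms(2)] gr_hom_lmod_hom[OF assms(3)]])
  then show ?thesis using assms gr_hom_grade[OF assms(2)] gr_hom_grade[OF assms(3)]
    by (auto simp: gr_hom_def compose_def M.G.grade_carrier)
qed

lemma gr_hom_component:
  assumes M: "graded_lmod B M" and N: "graded_lmod B N" and f: "f \<in> gr_hom B M N" and x: "x \<in> carrier M"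
  shows "component N (f x) i = f (component M x i)"
proof -
  interpret M: graded_lmod B M by fact
  interpret N: graded_lmod B N by fact
  note fh = gr_hom_lmod_hom[OF f]
  have z: "f \<zero>\<^bsub>M\<^esub> = \<zero>\<^bsub>N\<^esub>" by (rule lmod_hom_zero[OF fh M.M.abelian_group_axioms N.M.abelian_group_axioms])
  show ?thesis using x
  proof (induction x rule: M.G.homog_induct)
    case zero then show ?case by (simp add: z M.G.component_zero N.G.component_zero)
  next
    case (homog j x) then show ?case using gr_hom_grade[OF f homog]
      by (simp add: M.G.component_homog N.G.component_homog z)
  next
    case (add x y) then show ?case
      by (simp add: lmod_hom_add[OF fh] M.G.component_add N.G.component_add lmod_hom_closed[OF fh] M.G.component_closed)
  qed
qed

section \<open>Graded free modules\<close>

context twist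
begin

text \<open>The graded free module with basis \<open>e\<^sub>0, \<dots>, e\<^sub>k\<^sub>-\<^sub>1\<close>, where \<open>e\<^sub>i\<close> has degree \<open>r i\<close>.  Its elements are coordinate
  functions that vanish from \<open>k\<close> on, so that it is one of the modules among which resolutions are taken.\<close>

definition free_gr :: "nat \<Rightarrow> (nat \<Rightarrow> int) \<Rightarrow> ('b, nat \<Rightarrow> 'b) graded_module"
  where "free_gr k r = \<lparr>carrier = {x. (\<forall>i<k. x i \<in> carrier B) \<and> (\<forall>i\<ge>k. x i = \<zero>\<^bsub>B\<^esub>)},
    monoid.mult = undefined, one = undefined, ring.zero = (\<lambda>i. \<zero>\<^bsub>B\<^esub>), ring.add = (\<lambda>x y i. x i \<oplus>\<^bsub>B\<^esub> y i),
    smult = (\<lambda>a x i. a \<otimes>\<^bsub>B\<^esub> x i),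
    grade = (\<lambda>j. {x. (\<forall>i<k. x i \<in> grade B (j - r i)) \<and> (\<forall>i\<ge>k. x i = \<zero>\<^bsub>B\<^esub>)})\<rparr>"

text \<open>The element \<open>b e\<^sub>i\<close>.\<close>

definition single :: "nat \<Rightarrow> 'b \<Rightarrow> nat \<Rightarrow> 'b"
  where "single i b = (\<lambda>j. if j = i then b else \<zero>\<^bsub>B\<^esub>)"

lemma free_gr_coord: "x \<in> carrier (free_gr k r) \<Longrightarrow> x i \<in> carrier B"
  by (cases "i < k") (auto simp: free_gr_def)

lemma free_gr_ops:
  "\<zero>\<^bsub>free_gr k r\<^esub> = (\<lambda>i. \<zero>\<^bsub>B\<^esub>)" "x \<oplus>\<^bsub>free_gr k r\<^esub> y = (\<lambda>i. x i \<oplus>\<^bsub>B\<^esub> y i)"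
  "a \<odot>\<^bsub>free_gr k r\<^esub> x = (\<lambda>i. a \<otimes>\<^bsub>B\<^esub> x i)"
  by (simp_all add: free_gr_def)

lemma single_closed: "\<lbrakk>i < k; b \<in> carrier B\<rbrakk> \<Longrightarrow> single i b \<in> carrier (free_gr k r)"
  and single_grade: "\<lbrakk>i < k; b \<in> grade B s\<rbrakk> \<Longrightarrow> single i b \<in> grade (free_gr k r) (s + r i)"
  by (auto simp: free_gr_def single_def BG.grade_zero)

lemma single_add: "\<lbrakk>b \<in> carrier B; c \<in> carrier B\<rbrakk> \<Longrightarrow> single i (b \<oplus>\<^bsub>B\<^esub> c) = single i b \<oplus>\<^bsub>free_gr k r\<^esub> single i c"
  and single_smult: "a \<in> carrier B \<Longrightarrow> a \<odot>\<^bsub>free_gr k r\<^esub> single i b = single i (a \<otimes>\<^bsub>B\<^esub> b)"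
  and single_zero: "single i \<zero>\<^bsub>B\<^esub> = \<zero>\<^bsub>free_gr k r\<^esub>"
  by (auto simp: free_gr_ops single_def)

lemma abelian_group_free: "abelian_group (free_gr k r)"
proof (rule abelian_groupI)
  fix x assume x: "x \<in> carrier (free_gr k r)"
  show "\<exists>y\<in>carrier (free_gr k r). y \<oplus>\<^bsub>free_gr k r\<^esub> x = \<zero>\<^bsub>free_gr k r\<^esub>"
    using x by (intro bexI[of _ "\<lambda>i. \<ominus>\<^bsub>B\<^esub> x i"])
      (auto simp: free_gr_ops free_gr_coord A.B.l_neg, auto simp: free_gr_def)
qed (auto simp: free_gr_ops free_gr_coord A.B.a_ac, auto simp: free_gr_def)

lemma left_module_free: "left_module B (free_gr k r)"
proof (intro left_module.intro left_module_axioms.intro A.B.ring_axioms abelian_group_free)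
qed (auto simp: free_gr_ops free_gr_coord A.B.l_distr A.B.r_distr A.B.m_assoc, auto simp: free_gr_def)

lemma free_induct [consumes 1, case_names zero single add]:
  assumes x: "x \<in> carrier (free_gr k r)" and z: "P \<zero>\<^bsub>free_gr k r\<^esub>"
    and s: "\<And>i b. \<lbrakk>i < k; b \<in> carrier B\<rbrakk> \<Longrightarrow> P (single i b)"
    and a: "\<And>x y. \<lbrakk>x \<in> carrier (free_gr k r); y \<in> carrier (free_gr k r); P x; P y\<rbrakk> \<Longrightarrow> P (x \<oplus>\<^bsub>free_gr k r\<^esub> y)"
  shows "P x"
proof -
  define t where "t m = (\<lambda>i. if i < m then x i else \<zero>\<^bsub>B\<^esub>)" for m
  have tc: "t m \<in> carrier (free_gr k r)" for m
    using x by (auto simp: t_def free_gr_def)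
  have "m \<le> k \<Longrightarrow> P (t m)" for m
  proof (induction m)
    case 0
    have "t 0 = \<zero>\<^bsub>free_gr k r\<^esub>" by (simp add: t_def free_gr_ops)
    then show ?case using z by simp
  next
    case (Suc m)
    have "t (Suc m) = t m \<oplus>\<^bsub>free_gr k r\<^esub> single m (x m)"
      using free_gr_coord[OF x] by (auto simp: t_def free_gr_ops single_def less_Suc_eq)
    moreover have "x m \<in> carrier B" using free_gr_coord[OF x] .
    ultimately show ?case using Suc tc single_closed[of m k "x m" r] by (auto intro!: a s)
  qed
  moreover have "t k = x" using x by (auto simp: t_def free_gr_def)
  ultimately show ?thesis by force
qed

lemma graded_lmod_free: "graded_lmod B (free_gr k r)"
proof (intro graded_lmod.intro left_module_free graded_lmod_axioms.intro)
  show "is_grading (free_gr k r)"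
  proof (rule is_gradingI[where p = "\<lambda>j x i. component B (x i) (j - r i)"])
    show "additive_subgroup (grade (free_gr k r) i) (free_gr k r)" for i
    proof (intro additive_subgroup.intro group.subgroupI)
      show "Group.group (add_monoid (free_gr k r))"
        using abelian_group_free by (simp add: abelian_group_def abelian_group_axioms_def comm_group_def)
      fix x assume x: "x \<in> grade (free_gr k r) i"
      have xc: "x \<in> carrier (free_gr k r)" using x BG.grade_carrier by (auto simp: free_gr_def)
      interpret Fr: abelian_group "free_gr k r" by (rule abelian_group_free)
      have "(\<lambda>i. \<ominus>\<^bsub>B\<^esub> x i) = \<ominus>\<^bsub>free_gr k r\<^esub> x"
        using xc free_gr_coord[OF xc]
        by (intro Fr.minus_equality[symmetric]) (auto simp: free_gr_ops A.B.l_neg, auto simp: free_gr_def)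
      moreover have "(\<lambda>i. \<ominus>\<^bsub>B\<^esub> x i) \<in> grade (free_gr k r) i"
        using x by (auto simp: free_gr_def BG.grade_uminus)
      ultimately show "inv\<^bsub>add_monoid (free_gr k r)\<^esub> x \<in> grade (free_gr k r) i"
        by (simp add: a_inv_def)
    next
      show "grade (free_gr k r) i \<noteq> {}" using BG.grade_zero
        by (auto simp: free_gr_def intro!: exI[of _ "\<lambda>_. \<zero>\<^bsub>B\<^esub>"])
    qed (auto simp: free_gr_def BG.grade_carrier BG.grade_add)
    show "P x" if x: "x \<in> carrier (free_gr k r)" and z: "P \<zero>\<^bsub>free_gr k r\<^esub>"
      and h: "\<And>i x. x \<in> grade (free_gr k r) i \<Longrightarrow> P x"
      and a: "\<And>x y. \<lbrakk>x \<in> carrier (free_gr k r); y \<in> carrier (free_gr k r); P x; P y\<rbrakk>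
        \<Longrightarrow> P (x \<oplus>\<^bsub>free_gr k r\<^esub> y)" for P x
      using x
    proof (induction x rule: free_induct)
      case (single i b)
      from single(2) show ?case
      proof (induction b rule: BG.homog_induct)
        case zero then show ?case using z by (simp add: single_zero[of _ k r])
      next
        case (homog s b) then show ?case using h single_grade[OF single(1) homog] by blast
      next
        case (add b c) then show ?case using single_closed[OF single(1)] a by (simp add: single_add[of _ _ _ k r])
      qed
    qed (use z a in auto)
    show "(\<lambda>i. component B (x i) (j - r i)) = x" if x: "x \<in> grade (free_gr k r) j" for j x
    proof
      fix i show "component B (x i) (j - r i) = x i"
      proof (cases "i < k")
        case True
        then have "x i \<in> grade B (j - r i)" using x by (simp add: free_gr_def)
        then show ?thesis by (simp add: BG.component_homog)
      qed (use x in \<open>simp add: free_gr_def BG.component_zero\<close>)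
    qed
    show "(\<lambda>i. component B (x i) (j' - r i)) = \<zero>\<^bsub>free_gr k r\<^esub>"
      if x: "x \<in> grade (free_gr k r) j" and "j \<noteq> j'" for j j' x
      unfolding free_gr_ops
    proof
      fix i show "component B (x i) (j' - r i) = \<zero>\<^bsub>B\<^esub>"
      proof (cases "i < k")
        case True
        then have "x i \<in> grade B (j - r i)" using x by (simp add: free_gr_def)
        then show ?thesis using \<open>j \<noteq> j'\<close> by (simp add: BG.component_homog)
      qed (use x in \<open>simp add: free_gr_def BG.component_zero\<close>)
    qed
  qed (auto simp: free_gr_ops free_gr_coord BG.component_add abelian_group_free)
qed (auto simp: free_gr_def A.B.r_null BG.grade_carrier add_diff_eq[symmetric] mult_grade)

text \<open>A family of additive maps \<open>\<theta> i\<close> on \<open>B\<close>, one for each basis element, extends to an additive map on the free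
  module.  The two universal properties below differ only in the choice of this family.\<close>

lemma free_sum:
  assumes N: "abelian_group N" and cl: "\<And>i b. \<lbrakk>i < k; b \<in> carrier B\<rbrakk> \<Longrightarrow> \<theta> i b \<in> carrier N"
    and ad: "\<And>i b c. \<lbrakk>i < k; b \<in> carrier B; c \<in> carrier B\<rbrakk> \<Longrightarrow> \<theta> i (b \<oplus>\<^bsub>B\<^esub> c) = \<theta> i b \<oplus>\<^bsub>N\<^esub> \<theta> i c"
  shows free_sum_closed: "x \<in> carrier (free_gr k r) \<Longrightarrow> (\<Oplus>\<^bsub>N\<^esub>i\<in>{..<k}. \<theta> i (x i)) \<in> carrier N"
    and free_sum_add: "\<lbrakk>x \<in> carrier (free_gr k r); y \<in> carrier (free_gr k r)\<rbrakk>
      \<Longrightarrow> (\<Oplus>\<^bsub>N\<^esub>i\<in>{..<k}. \<theta> i ((x \<oplus>\<^bsub>free_gr k r\<^esub> y) i)) = (\<Oplus>\<^bsub>N\<^esub>i\<in>{..<k}. \<theta> i (x i)) \<oplus>\<^bsub>N\<^esub> (\<Oplus>\<^bsub>N\<^esub>i\<in>{..<k}. \<theta> i (y i))"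
    and free_sum_single: "\<lbrakk>j < k; b \<in> carrier B\<rbrakk> \<Longrightarrow> (\<Oplus>\<^bsub>N\<^esub>i\<in>{..<k}. \<theta> i (single j b i)) = \<theta> j b"
proof -
  interpret N: abelian_group N by fact
  have z: "\<theta> i \<zero>\<^bsub>B\<^esub> = \<zero>\<^bsub>N\<^esub>" if "i < k" for i
    using ad[OF that A.B.zero_closed A.B.zero_closed] cl[OF that A.B.zero_closed] by (simp add: N.add.r_cancel_one')
  show "x \<in> carrier (free_gr k r) \<Longrightarrow> (\<Oplus>\<^bsub>N\<^esub>i\<in>{..<k}. \<theta> i (x i)) \<in> carrier N"
    by (intro N.finsum_closed) (auto simp: cl free_gr_coord)
  show "(\<Oplus>\<^bsub>N\<^esub>i\<in>{..<k}. \<theta> i ((x \<oplus>\<^bsub>free_gr k r\<^esub> y) i)) = (\<Oplus>\<^bsub>N\<^esub>i\<in>{..<k}. \<theta> i (x i)) \<oplus>\<^bsub>N\<^esub> (\<Oplus>\<^bsub>N\<^esub>i\<in>{..<k}. \<theta> i (y i))"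
    if x: "x \<in> carrier (free_gr k r)" and y: "y \<in> carrier (free_gr k r)"
  proof -
    have "(\<Oplus>\<^bsub>N\<^esub>i\<in>{..<k}. \<theta> i ((x \<oplus>\<^bsub>free_gr k r\<^esub> y) i)) = (\<Oplus>\<^bsub>N\<^esub>i\<in>{..<k}. \<theta> i (x i) \<oplus>\<^bsub>N\<^esub> \<theta> i (y i))"
      using x y by (intro N.finsum_cong') (auto simp: free_gr_ops ad free_gr_coord cl)
    also have "\<dots> = (\<Oplus>\<^bsub>N\<^esub>i\<in>{..<k}. \<theta> i (x i)) \<oplus>\<^bsub>N\<^esub> (\<Oplus>\<^bsub>N\<^esub>i\<in>{..<k}. \<theta> i (y i))"
      using x y by (intro N.finsum_addf) (auto simp: cl free_gr_coord)
    finally show ?thesis .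
  qed
  show "(\<Oplus>\<^bsub>N\<^esub>i\<in>{..<k}. \<theta> i (single j b i)) = \<theta> j b" if j: "j < k" and b: "b \<in> carrier B"
  proof -
    have "(\<Oplus>\<^bsub>N\<^esub>i\<in>{..<k}. \<theta> i (single j b i)) = (\<Oplus>\<^bsub>N\<^esub>i\<in>{j}. \<theta> i (single j b i))"
      using j b by (intro N.finsum_superset[symmetric]) (auto simp: single_def z cl)
    then show ?thesis using j b by (simp add: N.finsum_insert cl single_def)
  qed
qed

lemma free_gr_hom:
  assumes N: "graded_lmod B N" and u: "\<And>i. i < k \<Longrightarrow> u i \<in> grade N (r i)"
  shows "\<exists>h\<in>gr_hom B (free_gr k r) N. \<forall>i<k. \<forall>b\<in>carrier B. h (single i b) = b \<odot>\<^bsub>N\<^esub> u i"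
proof -
  interpret N: graded_lmod B N by fact
  have uc: "u i \<in> carrier N" if "i < k" for i using u[OF that] N.G.grade_carrier by blast
  define s where "s x = (\<Oplus>\<^bsub>N\<^esub>i\<in>{..<k}. x i \<odot>\<^bsub>N\<^esub> u i)" for x
  note fs = free_sum[OF N.M.abelian_group_axioms, of k "\<lambda>i b. b \<odot>\<^bsub>N\<^esub> u i", folded s_def]
  have scl: "s x \<in> carrier N" if "x \<in> carrier (free_gr k r)" for x
    using fs(1) that uc by (simp add: N.lsmult_closed N.lsmult_l_distr)
  have sadd: "s (x \<oplus>\<^bsub>free_gr k r\<^esub> y) = s x \<oplus>\<^bsub>N\<^esub> s y" if "x \<in> carrier (free_gr k r)" "y \<in> carrier (free_gr k r)" for x y
    using fs(2) that uc by (simp add: N.lsmult_closed N.lsmult_l_distr)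
  have ss: "s (single i b) = b \<odot>\<^bsub>N\<^esub> u i" if "i < k" "b \<in> carrier B" for i b
    using fs(3) that uc by (simp add: N.lsmult_closed N.lsmult_l_distr)
  interpret Fr: graded_lmod B "free_gr k r" by (rule graded_lmod_free)
  have sz: "s \<zero>\<^bsub>free_gr k r\<^esub> = \<zero>\<^bsub>N\<^esub>"
    using sadd[OF Fr.M.zero_closed Fr.M.zero_closed] scl[OF Fr.M.zero_closed] by (simp add: N.M.add.r_cancel_one')
  have "s (a \<odot>\<^bsub>free_gr k r\<^esub> x) = a \<odot>\<^bsub>N\<^esub> s x" if a: "a \<in> carrier B" and x: "x \<in> carrier (free_gr k r)" for a x
    using x
  proof (induction x rule: free_induct)
    case zero then show ?case using a by (simp add: sz Fr.lsmult_zero N.lsmult_zero)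
  next
    case (single i b) then show ?case using a uc by (simp add: single_smult ss N.lsmult_assoc)
  next
    case (add x y) then show ?case using a by (simp add: Fr.lsmult_r_distr N.lsmult_r_distr sadd scl Fr.lsmult_closed)
  qed
  then have "restrict s (carrier (free_gr k r)) \<in> lmod_hom B (free_gr k r) N"
    by (intro lmod_hom_restrictI left_module_free) (auto simp: scl sadd)
  moreover have "s x \<in> grade N j" if "x \<in> grade (free_gr k r) j" for x j
    unfolding s_def
  proof (rule N.M.finsum_in_submonoid)
    fix i assume i: "i \<in> {..<k}"
    then have "x i \<in> grade B (j - r i)" using that by (simp add: free_gr_def)
    then show "x i \<odot>\<^bsub>N\<^esub> u i \<in> grade N j" using N.smult_grade[OF _ u, of "x i" "j - r i" i] i by simp
  qed (auto simp: N.G.grade_carrier N.G.grade_zero N.G.grade_add)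
  ultimately have "restrict s (carrier (free_gr k r)) \<in> gr_hom B (free_gr k r) N"
    by (auto simp: gr_hom_def Fr.G.grade_carrier)
  then show ?thesis using ss by (intro bexI[of _ "restrict s (carrier (free_gr k r))"]) (auto simp: single_closed)
qed

text \<open>\<open>F\<^sub>\<sigma>\<close> of the graded free module is free over \<open>B\<^sup>\<sigma>\<close> on the same basis.  Its coordinates are different:
  since \<open>e\<^sub>i\<close> has degree \<open>r i\<close>, the element \<open>b e\<^sub>i\<close> is \<open>c * e\<^sub>i\<close> with \<open>c = spow (- r i) b\<close>.\<close>

lemma free_F_hom:
  assumes N: "left_module B\<sigma> N" and u: "\<And>i. i < k \<Longrightarrow> u i \<in> carrier N"
  shows "\<exists>h\<in>lmod_hom B\<sigma> (F (free_gr k r)) N. \<forall>i<k. \<forall>b\<in>carrier B. h (single i b) = spow (- r i) b \<odot>\<^bsub>N\<^esub> u i"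
proof -
  interpret N: left_module B\<sigma> N by fact
  define s where "s x = (\<Oplus>\<^bsub>N\<^esub>i\<in>{..<k}. spow (- r i) (x i) \<odot>\<^bsub>N\<^esub> u i)" for x
  have Ncl: "a \<odot>\<^bsub>N\<^esub> x \<in> carrier N" if "a \<in> carrier B" "x \<in> carrier N" for a x using N.lsmult_closed that by simp
  have Nld: "(a \<oplus>\<^bsub>B\<^esub> b) \<odot>\<^bsub>N\<^esub> x = a \<odot>\<^bsub>N\<^esub> x \<oplus>\<^bsub>N\<^esub> b \<odot>\<^bsub>N\<^esub> x"
    if "a \<in> carrier B" "b \<in> carrier B" "x \<in> carrier N" for a b x using N.lsmult_l_distr[of a b x] that by simp
  have Nrd: "a \<odot>\<^bsub>N\<^esub> (x \<oplus>\<^bsub>N\<^esub> y) = a \<odot>\<^bsub>N\<^esub> x \<oplus>\<^bsub>N\<^esub> a \<odot>\<^bsub>N\<^esub> y"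
    if "a \<in> carrier B" "y \<in> carrier N" "x \<in> carrier N" for a y x using N.lsmult_r_distr[of a x y] that by simp
  note fs = free_sum[OF N.M.abelian_group_axioms, of k "\<lambda>i b. spow (- r i) b \<odot>\<^bsub>N\<^esub> u i", folded s_def]
  have scl: "s x \<in> carrier N" if "x \<in> carrier (free_gr k r)" for x
    using fs(1) that u by (simp add: Ncl Nld spow_plus)
  have sadd: "s (x \<oplus>\<^bsub>free_gr k r\<^esub> y) = s x \<oplus>\<^bsub>N\<^esub> s y" if "x \<in> carrier (free_gr k r)" "y \<in> carrier (free_gr k r)" for x y
    using fs(2) that u by (simp add: Ncl Nld spow_plus)
  have ss: "s (single i b) = spow (- r i) b \<odot>\<^bsub>N\<^esub> u i" if "i < k" "b \<in> carrier B" for i b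
    using fs(3) that u by (simp add: Ncl Nld spow_plus)
  note Fl = graded_lmod_free[of k r]
  interpret Fr: graded_lmod B "free_gr k r" by (rule Fl)
  have sz: "s \<zero>\<^bsub>free_gr k r\<^esub> = \<zero>\<^bsub>N\<^esub>"
    using sadd[OF Fr.M.zero_closed Fr.M.zero_closed] scl[OF Fr.M.zero_closed] by (simp add: N.M.add.r_cancel_one')
  have Nz: "a \<odot>\<^bsub>N\<^esub> \<zero>\<^bsub>N\<^esub> = \<zero>\<^bsub>N\<^esub>" if "a \<in> carrier B" for a using N.lsmult_zero that by simp
  have "s (a \<odot>\<^bsub>F (free_gr k r)\<^esub> x) = a \<odot>\<^bsub>N\<^esub> s x" if a: "a \<in> carrier B" and x: "x \<in> carrier (free_gr k r)" for a x
    using x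
  proof (induction x rule: free_induct)
    case zero then show ?case using a by (simp add: sz F_smult_zero[OF Fl] Nz)
  next
    case (single i b)
    note i = single(1)
    from single(2) show ?case
    proof (induction b rule: BG.homog_induct)
      case zero then show ?case using a by (simp add: single_zero[of _ k r] sz F_smult_zero[OF Fl] Nz)
    next
      case (homog t b)
      then have b: "b \<in> carrier B" by (rule BG.grade_carrier)
      have "s (a \<odot>\<^bsub>F (free_gr k r)\<^esub> single i b) = s (single i (spow (t + r i) a \<otimes>\<^bsub>B\<^esub> b))"
        using F_smult_homog[OF Fl a single_grade[OF i homog]] a by (simp add: single_smult)
      also have "\<dots> = spow (- r i) (spow (t + r i) a \<otimes>\<^bsub>B\<^esub> b) \<odot>\<^bsub>N\<^esub> u i" using a b i by (simp add: ss)
      also have "spow (- r i) (spow (t + r i) a \<otimes>\<^bsub>B\<^esub> b) = a \<otimes>\<^bsub>B\<sigma>\<^esub> spow (- r i) b"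
        using a b Bs_mult_homog[OF a spow_grade[OF homog]] by (simp add: spow_mult spow_add)
      also have "\<dots> \<odot>\<^bsub>N\<^esub> u i = a \<odot>\<^bsub>N\<^esub> s (single i b)"
        using a b i u N.lsmult_assoc[of a "spow (- r i) b" "u i"] by (simp add: ss)
      finally show ?case .
    next
      case (add b c) then show ?case using a i single_closed[of i k _ r]
        by (simp add: single_add[of _ _ _ k r] F_smult_r_distr[OF Fl] F_smult_closed[OF Fl] Nrd sadd scl)
    qed
  next
    case (add x y) then show ?case using a by (simp add: F_smult_r_distr[OF Fl] F_smult_closed[OF Fl] Nrd sadd scl)
  qed
  then have "restrict s (carrier (F (free_gr k r))) \<in> lmod_hom B\<sigma> (F (free_gr k r)) N"
    by (intro lmod_hom_restrictI left_module_F Fl) (auto simp: scl sadd)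
  then show ?thesis using ss by (intro bexI[of _ "restrict s (carrier (F (free_gr k r)))"]) (auto simp: single_closed)
qed

text \<open>The preimage of a basis element can be taken homogeneous of the right degree, since \<open>g\<close> commutes with
  taking components.\<close>

lemma free_gr_lift:
  assumes U: "graded_lmod B U" and V: "graded_lmod B V" and g: "g \<in> gr_hom B U V"
    and f: "f \<in> gr_hom B (free_gr k r) V" and im: "f ` carrier (free_gr k r) \<subseteq> g ` carrier U"
  shows "\<exists>h\<in>gr_hom B (free_gr k r) U. \<forall>x\<in>carrier (free_gr k r). g (h x) = f x"
proof -
  interpret U: graded_lmod B U by fact
  interpret V: graded_lmod B V by fact
  interpret Fr: graded_lmod B "free_gr k r" by (rule graded_lmod_free)
  note gh = gr_hom_lmod_hom[OF g] and fh = gr_hom_lmod_hom[OF f]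
  have "\<exists>u. u \<in> grade U (r i) \<and> g u = f (single i \<one>\<^bsub>B\<^esub>)" if i: "i < k" for i
  proof -
    have sg: "single i \<one>\<^bsub>B\<^esub> \<in> grade (free_gr k r) (r i)" using single_grade[OF i one_grade, of r] by simp
    then obtain u where u: "u \<in> carrier U" "g u = f (single i \<one>\<^bsub>B\<^esub>)"
      using im Fr.G.grade_carrier[OF sg] by (metis image_iff image_subset_iff)
    have "g (component U u (r i)) = f (single i \<one>\<^bsub>B\<^esub>)"
      using gr_hom_component[OF U V g u(1), of "r i"] u(2) V.G.component_homog[OF gr_hom_grade[OF f sg]] by simp
    then show ?thesis using U.G.component_grade[OF u(1)] by blast
  qed
  then obtain u where u: "\<And>i. i < k \<Longrightarrow> u i \<in> grade U (r i)" "\<And>i. i < k \<Longrightarrow> g (u i) = f (single i \<one>\<^bsub>B\<^esub>)" by metis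
  obtain h where h: "h \<in> gr_hom B (free_gr k r) U" "\<And>i b. i < k \<Longrightarrow> b \<in> carrier B \<Longrightarrow> h (single i b) = b \<odot>\<^bsub>U\<^esub> u i"
    using free_gr_hom[OF U, of k u r] u(1) by blast
  note hh = gr_hom_lmod_hom[OF h(1)]
  have "g (h x) = f x" if "x \<in> carrier (free_gr k r)" for x using that
  proof (induction x rule: free_induct)
    case zero then show ?case using lmod_hom_zero[OF hh Fr.M.abelian_group_axioms U.M.abelian_group_axioms]
      lmod_hom_zero[OF fh Fr.M.abelian_group_axioms V.M.abelian_group_axioms]
      lmod_hom_zero[OF gh U.M.abelian_group_axioms V.M.abelian_group_axioms] by simp
  next
    case (single i b)
    then have "f (single i b) = b \<odot>\<^bsub>V\<^esub> f (single i \<one>\<^bsub>B\<^esub>)"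
      using lmod_hom_smult[OF fh, of b "single i \<one>\<^bsub>B\<^esub>"] by (simp add: single_smult single_closed)
    then show ?case using single by (simp add: h(2) lmod_hom_smult[OF gh] U.G.grade_carrier[OF u(1)] u(2))
  next
    case (add x y) then show ?case by (simp add: lmod_hom_add[OF hh] lmod_hom_add[OF fh] lmod_hom_add[OF gh] lmod_hom_closed[OF hh])
  qed
  then show ?thesis using h(1) by blast
qed

lemma free_F_lift:
  assumes U: "left_module B\<sigma> U" and V: "left_module B\<sigma> V" and g: "g \<in> lmod_hom B\<sigma> U V"
    and f: "f \<in> lmod_hom B\<sigma> (F (free_gr k r)) V" and im: "f ` carrier (free_gr k r) \<subseteq> g ` carrier U"
  shows "\<exists>h\<in>lmod_hom B\<sigma> (F (free_gr k r)) U. \<forall>x\<in>carrier (free_gr k r). g (h x) = f x"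
proof -
  interpret U: left_module B\<sigma> U by fact
  interpret V: left_module B\<sigma> V by fact
  note Fl = graded_lmod_free[of k r]
  interpret Fr: left_module B\<sigma> "F (free_gr k r)" by (rule left_module_F[OF Fl])
  have "\<exists>u. u \<in> carrier U \<and> g u = f (single i \<one>\<^bsub>B\<^esub>)" if i: "i < k" for i
    using im single_closed[OF i A.B.one_closed, of r] by (metis image_iff image_subset_iff)
  then obtain u where u: "\<And>i. i < k \<Longrightarrow> u i \<in> carrier U" "\<And>i. i < k \<Longrightarrow> g (u i) = f (single i \<one>\<^bsub>B\<^esub>)" by metis
  obtain h where h: "h \<in> lmod_hom B\<sigma> (F (free_gr k r)) U"
    "\<And>i b. i < k \<Longrightarrow> b \<in> carrier B \<Longrightarrow> h (single i b) = spow (- r i) b \<odot>\<^bsub>U\<^esub> u i"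
    using free_F_hom[OF U, of k u r] u(1) by blast
  have "g (h x) = f x" if "x \<in> carrier (free_gr k r)" for x using that
  proof (induction x rule: free_induct)
    case zero then show ?case using lmod_hom_zero[OF h(1) Fr.M.abelian_group_axioms U.M.abelian_group_axioms]
      lmod_hom_zero[OF f Fr.M.abelian_group_axioms V.M.abelian_group_axioms]
      lmod_hom_zero[OF g U.M.abelian_group_axioms V.M.abelian_group_axioms] by simp
  next
    case (single i b)
    have sg: "single i \<one>\<^bsub>B\<^esub> \<in> grade (free_gr k r) (r i)" using single_grade[OF single(1) one_grade, of r] by simp
    have "spow (- r i) b \<odot>\<^bsub>F (free_gr k r)\<^esub> single i \<one>\<^bsub>B\<^esub> = single i b"
      using F_smult_homog[OF Fl _ sg, of "spow (- r i) b"] single(2) by (simp add: spow_add spow_0 single_smult)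
    then have "f (single i b) = spow (- r i) b \<odot>\<^bsub>V\<^esub> f (single i \<one>\<^bsub>B\<^esub>)"
      using lmod_hom_smult[OF f, of "spow (- r i) b" "single i \<one>\<^bsub>B\<^esub>"] single by (simp add: single_closed)
    then show ?case using single by (simp add: h(2) lmod_hom_smult[OF g] u)
  next
    case (add x y)
    note a = lmod_hom_add[OF h(1), simplified, OF add(1,2)] lmod_hom_add[OF f, simplified, OF add(1,2)]
    show ?case using add lmod_hom_closed[OF h(1)] by (simp add: a lmod_hom_add[OF g])
  qed
  then show ?thesis using h(1) by blast
qed

end

section \<open>Resolutions by graded free modules\<close>

lemma restrict_scalars_sel [simp]:
  "carrier (restrict_scalars B M) = carrier M" "ring.add (restrict_scalars B M) = ring.add M"
  "ring.zero (restrict_scalars B M) = ring.zero M"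
  "c \<odot>\<^bsub>restrict_scalars B M\<^esub> m = (c \<odot>\<^bsub>B\<^esub> \<one>\<^bsub>B\<^esub>) \<odot>\<^bsub>M\<^esub> m"
  by (simp_all add: restrict_scalars_def)

context twist
begin

lemma gr_obj_iff: "gr_obj K B M \<longleftrightarrow> graded_lmod B M \<and> fin_dim K (restrict_scalars B M)"
  by (simp add: gr_obj_def graded_lmod_iff)

lemma gr_obj_lmod: "gr_obj K B M \<Longrightarrow> graded_lmod B M"
  by (simp add: gr_obj_iff)

lemma gr_obj_free: "gr_obj K B (free_gr k r)"
proof -
  interpret V: module K "restrict_scalars B (free_gr k r)"
    by (rule module_restrict_scalars[OF A.k_algebra_axioms left_module_free])
  obtain S where S: "finite S" "S \<subseteq> carrier B" "carrier B \<subseteq> kspan K B S"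
    using B_fin_dim A.KB.fin_dim_iff_kspan by blast
  define T where "T = (\<lambda>(i, s). single i s) ` ({..<k} \<times> S)"
  have T: "finite T" "T \<subseteq> carrier (free_gr k r)"
    using S by (auto simp: T_def intro: single_closed)
  have sp: "single i b \<in> kspan K (restrict_scalars B (free_gr k r)) T" if i: "i < k" and b: "b \<in> kspan K B S" for i b
    using b
  proof induction
    case kspan_zero
    then show ?case using kspan.kspan_zero[of "restrict_scalars B (free_gr k r)" K T]
      by (simp add: single_zero[of _ k r])
  next
    case (kspan_base s) then show ?case using i by (intro kspan.kspan_base) (auto simp: T_def)
  next
    case (kspan_add x y)
    then show ?case using kspan.kspan_add[OF kspan_add.IH] A.KB.kspan_closed[OF S(2)]
      by (simp add: single_add[of _ _ _ k r])
  next
    case (kspan_smult c x)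
    then show ?case using kspan.kspan_smult[OF kspan_smult.hyps(1) kspan_smult.IH] A.KB.kspan_closed[OF S(2)]
      by (simp add: single_smult A.kone_closed A.kone_l)
  qed
  have "x \<in> kspan K (restrict_scalars B (free_gr k r)) T" if "x \<in> carrier (free_gr k r)" for x
    using that
  proof (induction x rule: free_induct)
    case zero
    then show ?case using kspan.kspan_zero[of "restrict_scalars B (free_gr k r)" K T] by simp
  next
    case (single i b) then show ?case using sp S(3) by blast
  next
    case (add x y) then show ?case using kspan.kspan_add[OF add(3,4)] by simp
  qed
  then have "fin_dim K (restrict_scalars B (free_gr k r))"
    using T V.fin_dim_iff_kspan by auto
  then show ?thesis by (simp add: gr_obj_iff graded_lmod_free)
qed

text \<open>As a subspace of a finite-dimensional space, \<open>W\<close> is spanned by finitely many elements, and hence by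
  their homogeneous components, which are finite in number and lie in \<open>W\<close>.  Sending a homogeneous basis to
  these components gives the cover.\<close>

lemma free_cover:
  assumes M: "gr_obj K B M" and W: "W \<subseteq> carrier M" "\<zero>\<^bsub>M\<^esub> \<in> W"
    and W_add: "\<And>x y. \<lbrakk>x \<in> W; y \<in> W\<rbrakk> \<Longrightarrow> x \<oplus>\<^bsub>M\<^esub> y \<in> W"
    and W_smult: "\<And>b x. \<lbrakk>b \<in> carrier B; x \<in> W\<rbrakk> \<Longrightarrow> b \<odot>\<^bsub>M\<^esub> x \<in> W"
    and W_component: "\<And>x i. x \<in> W \<Longrightarrow> component M x i \<in> W"
  shows "\<exists>k r. \<exists>g\<in>gr_hom B (free_gr k r) M. g ` carrier (free_gr k r) = W"
proof -
  have lM: "graded_lmod B M" using M by (rule gr_obj_lmod)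
  interpret M: graded_lmod B M by fact
  interpret V: module K "restrict_scalars B M"
    by (rule module_restrict_scalars[OF A.k_algebra_axioms M.left_module_axioms])
  obtain S where S: "finite S" "S \<subseteq> carrier M" "carrier M \<subseteq> kspan K (restrict_scalars B M) S"
    using M V.fin_dim_iff_kspan by (auto simp: gr_obj_iff)
  have "\<exists>T. finite T \<and> T \<subseteq> W \<and> W \<subseteq> kspan K (restrict_scalars B M) T"
    using S W W_add W_smult A.kone_closed by (intro subspace_finitely_spanned[OF field_K V.module_axioms S(1)]) auto
  then obtain T where T: "finite T" "T \<subseteq> W" "W \<subseteq> kspan K (restrict_scalars B M) T" by blast
  define H where "H = (\<Union>t\<in>T. (\<lambda>i. (component M t i, i)) ` {i. component M t i \<noteq> \<zero>\<^bsub>M\<^esub>})"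
  have "finite H" using T W(1) M.G.component_finite by (auto simp: H_def)
  then obtain k and f :: "nat \<Rightarrow> _" where f: "H = f ` {..<k}"
    by (metis finite_conv_nat_seg_image lessThan_def)
  define u r where "u = fst \<circ> f" and "r = snd \<circ> f"
  have u: "u i \<in> grade M (r i)" "u i \<in> W" if i: "i < k" for i
  proof -
    have "f i \<in> H" using f i by auto
    then obtain t j where t: "t \<in> T" "f i = (component M t j, j)" unfolding H_def by auto
    then have "t \<in> W" using T by blast
    then show "u i \<in> grade M (r i)" "u i \<in> W"
      using W M.G.component_grade[of t j] W_component[of t j] t by (auto simp: u_def r_def)
  qed
  obtain g where g: "g \<in> gr_hom B (free_gr k r) M"
    "\<And>i b. i < k \<Longrightarrow> b \<in> carrier B \<Longrightarrow> g (single i b) = b \<odot>\<^bsub>M\<^esub> u i"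
    using free_gr_hom[OF lM, of k u r] u(1) by blast
  interpret Fr: graded_lmod B "free_gr k r" by (rule graded_lmod_free)
  note gh = gr_hom_lmod_hom[OF g(1)]
  have gz: "g \<zero>\<^bsub>free_gr k r\<^esub> = \<zero>\<^bsub>M\<^esub>"
    by (rule lmod_hom_zero[OF gh Fr.M.abelian_group_axioms M.M.abelian_group_axioms])
  let ?I = "g ` carrier (free_gr k r)"
  have I0: "\<zero>\<^bsub>M\<^esub> \<in> ?I" using gz Fr.M.zero_closed by (metis imageI)
  have Ia: "x \<oplus>\<^bsub>M\<^esub> y \<in> ?I" if "x \<in> ?I" "y \<in> ?I" for x y
    using that by (auto simp flip: lmod_hom_add[OF gh])
  have Is: "b \<odot>\<^bsub>M\<^esub> x \<in> ?I" if "x \<in> ?I" "b \<in> carrier B" for x b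
    using that by (auto simp: Fr.lsmult_closed simp flip: lmod_hom_smult[OF gh])
  have "g x \<in> W" if "x \<in> carrier (free_gr k r)" for x using that
  proof (induction x rule: free_induct)
    case zero then show ?case using gz W by simp
  next
    case (single i b) then show ?case using g(2) u W_smult by simp
  next
    case (add x y) then show ?case using W_add lmod_hom_add[OF gh] by simp
  qed
  moreover have "T \<subseteq> ?I"
  proof
    fix t assume t: "t \<in> T"
    have tc: "t \<in> carrier M" using t T W by blast
    have "component M t i \<in> ?I" for i
    proof (cases "component M t i = \<zero>\<^bsub>M\<^esub>")
      case True then show ?thesis using I0 by simp
    next
      case False
      then have "(component M t i, i) \<in> H" using t by (auto simp: H_def)
      then obtain j where "j < k" "u j = component M t i" using f by (auto simp: u_def image_iff) (metis fst_conv)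
      then have "component M t i = g (single j \<one>\<^bsub>B\<^esub>)" using g(2) M.lsmult_one M.G.component_closed[OF tc] by simp
      then show ?thesis using single_closed[OF \<open>j < k\<close> A.B.one_closed] by blast
    qed
    then have "(\<Oplus>\<^bsub>M\<^esub>i\<in>{i. component M t i \<noteq> \<zero>\<^bsub>M\<^esub>}. component M t i) \<in> ?I"
      using I0 Ia lmod_hom_closed[OF gh] by (intro M.M.finsum_in_submonoid) auto
    then show "t \<in> ?I" using M.G.component_sum[OF tc] by simp
  qed
  moreover have "x \<in> ?I" if "x \<in> kspan K (restrict_scalars B M) T" for x
    using that by induction (use I0 Ia Is A.kone_closed \<open>T \<subseteq> ?I\<close> in auto)
  ultimately show ?thesis using g(1) T(3) by blast
qed

lemma gr_projective_free: "gr_projective K B (free_gr k r)"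
  unfolding gr_projective_def
proof (intro conjI allI impI ballI gr_obj_free)
  fix U V :: "('b, nat \<Rightarrow> 'b) graded_module" and g f
  assume o: "gr_obj K B U \<and> gr_obj K B V" and g: "g \<in> gr_hom B U V" and f: "f \<in> gr_hom B (free_gr k r) V"
    and s: "g ` carrier U = carrier V"
  have "f ` carrier (free_gr k r) \<subseteq> g ` carrier U"
    using s lmod_hom_closed[OF gr_hom_lmod_hom[OF f]] by auto
  then obtain h where h: "h \<in> gr_hom B (free_gr k r) U" "\<forall>x\<in>carrier (free_gr k r). g (h x) = f x"
    using free_gr_lift[OF _ _ g f] o gr_obj_lmod by blast
  have "compose (carrier (free_gr k r)) g h = f"
    using h(2) lmod_hom_extensional[OF gr_hom_lmod_hom[OF f]]
    by (intro extensionalityI[of _ "carrier (free_gr k r)"]) (auto simp: compose_def)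
  then show "\<exists>h\<in>gr_hom B (free_gr k r) U. compose (carrier (free_gr k r)) g h = f" using h(1) by blast
qed

lemma gr_hom_kernel_cover:
  assumes M: "gr_obj K B M" and N: "graded_lmod B N" and f: "f \<in> gr_hom B M N"
  shows "\<exists>k r. \<exists>g\<in>gr_hom B (free_gr k r) M. g ` carrier (free_gr k r) = a_kernel M N f"
proof -
  have lM: "graded_lmod B M" using M by (rule gr_obj_lmod)
  interpret M: graded_lmod B M by fact
  interpret N: graded_lmod B N by fact
  note fh = gr_hom_lmod_hom[OF f]
  have fz: "f \<zero>\<^bsub>M\<^esub> = \<zero>\<^bsub>N\<^esub>"
    by (rule lmod_hom_zero[OF fh M.M.abelian_group_axioms N.M.abelian_group_axioms])
  show ?thesis
    by (rule free_cover[OF M]) (auto simp: a_kernel_def' fz lmod_hom_add[OF fh] lmod_hom_smult[OF fh]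
      N.lsmult_zero M.lsmult_closed M.G.component_closed N.G.component_zero simp flip: gr_hom_component[OF lM N f])
qed

lemma gr_obj_cover:
  assumes M: "gr_obj K B M"
  shows "\<exists>k r. \<exists>g\<in>gr_hom B (free_gr k r) M. g ` carrier (free_gr k r) = carrier M"
proof -
  interpret M: graded_lmod B M using M by (rule gr_obj_lmod)
  show ?thesis by (rule free_cover[OF M]) (auto simp: M.lsmult_closed M.G.component_closed)
qed

text \<open>Successive kernels are covered by graded free modules of finite rank; these are finite-dimensional, so
  the construction can be repeated.\<close>

lemma gr_projective_resolution_exists:
  assumes M: "gr_obj K B M"
  shows "\<exists>P. gr_projective_resolution K B M P"
proof -
  define FR where "FR q = free_gr (fst q) (snd q)" for q :: "nat \<times> (nat \<Rightarrow> int)"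
  obtain q0 e where e: "e \<in> gr_hom B (FR q0) M" "e ` carrier (FR q0) = carrier M"
    using gr_obj_cover[OF M] by (auto simp: FR_def)
  have step: "\<exists>q'. \<exists>d'\<in>gr_hom B (FR q') (FR q). d' ` carrier (FR q') = a_kernel (FR q) (FR p) d"
    if "d \<in> gr_hom B (FR q) (FR p)" for p q d
    using gr_hom_kernel_cover[OF gr_obj_free graded_lmod_free that[unfolded FR_def]] by (auto simp: FR_def)
  obtain q1 d0 where d0: "d0 \<in> gr_hom B (FR q1) (FR q0)" "d0 ` carrier (FR q1) = a_kernel (FR q0) M e"
    using gr_hom_kernel_cover[OF gr_obj_free gr_obj_lmod[OF M] e(1)[unfolded FR_def]] by (auto simp: FR_def)
  \<comment> \<open>A stage consists of two consecutive free modules, given by rank and degrees, and the differential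
    from the second to the first.\<close>
  have "\<exists>Z. \<forall>n. ((case Z n of (p, q, d) \<Rightarrow> d \<in> gr_hom B (FR q) (FR p)) \<and> (n = 0 \<longrightarrow> Z n = (q0, q1, d0))) \<and>
     (case (Z n, Z (Suc n)) of ((p, q, d), (p', q', d')) \<Rightarrow> p' = q \<and>
        d' ` carrier (FR q') = a_kernel (FR q) (FR p) d)"
  proof (rule dependent_nat_choice)
    show "\<exists>x. (case x of (p, q, d) \<Rightarrow> d \<in> gr_hom B (FR q) (FR p)) \<and> (0 = (0::nat) \<longrightarrow> x = (q0, q1, d0))"
      using d0(1) by (intro exI[of _ "(q0, q1, d0)"]) simp
  next
    fix x :: "(nat \<times> (nat \<Rightarrow> int)) \<times> (nat \<times> (nat \<Rightarrow> int)) \<times> ((nat \<Rightarrow> 'b) \<Rightarrow> nat \<Rightarrow> 'b)" and n :: nat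
    assume x: "(case x of (p, q, d) \<Rightarrow> d \<in> gr_hom B (FR q) (FR p)) \<and> (n = 0 \<longrightarrow> x = (q0, q1, d0))"
    obtain p q d where x': "x = (p, q, d)" by (cases x)
    obtain q' d' where "d' \<in> gr_hom B (FR q') (FR q)" "d' ` carrier (FR q') = a_kernel (FR q) (FR p) d"
      using step[of d q p] x x' by auto
    then show "\<exists>y. ((case y of (p, q, d) \<Rightarrow> d \<in> gr_hom B (FR q) (FR p)) \<and> (Suc n = 0 \<longrightarrow> y = (q0, q1, d0))) \<and>
       (case (x, y) of ((p, q, d), (p', q', d')) \<Rightarrow> p' = q \<and> d' ` carrier (FR q') = a_kernel (FR q) (FR p) d)"
      by (intro exI[of _ "(q, q', d')"]) (auto simp: x')
  qed
  then obtain Z where Z0: "\<forall>n. ((case Z n of (p, q, d) \<Rightarrow> d \<in> gr_hom B (FR q) (FR p)) \<and> (n = 0 \<longrightarrow> Z n = (q0, q1, d0))) \<and>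
     (case (Z n, Z (Suc n)) of ((p, q, d), (p', q', d')) \<Rightarrow> p' = q \<and>
        d' ` carrier (FR q') = a_kernel (FR q) (FR p) d)" by (elim exE)
  have Z: "case Z n of (p, q, d) \<Rightarrow> d \<in> gr_hom B (FR q) (FR p)" "Z 0 = (q0, q1, d0)"
    "case (Z n, Z (Suc n)) of ((p, q, d), (p', q', d')) \<Rightarrow> p' = q \<and>
        d' ` carrier (FR q') = a_kernel (FR q) (FR p) d" for n
    by (rule spec[OF Z0, THEN conjunct1, THEN conjunct1] spec[OF Z0, THEN conjunct2]
       mp[OF spec[OF Z0, THEN conjunct1, THEN conjunct2] refl])+
  define P :: "('b, _) gr_res" where "P = \<lparr>obj = (\<lambda>n. FR (fst (Z n))), diff = (\<lambda>n. snd (snd (Z n))), aug = e\<rparr>"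
  have q: "fst (snd (Z n)) = fst (Z (Suc n))" for n using Z(3)[of n] by (simp add: case_prod_unfold)
  have d: "snd (snd (Z n)) \<in> gr_hom B (FR (fst (Z (Suc n)))) (FR (fst (Z n)))" for n
    using Z(1)[of n] by (simp add: case_prod_unfold q)
  have k: "snd (snd (Z (Suc n))) ` carrier (FR (fst (Z (Suc (Suc n))))) =
      a_kernel (FR (fst (Z (Suc n)))) (FR (fst (Z n))) (snd (snd (Z n)))" for n
    using Z(3)[of n] by (simp add: case_prod_unfold q)
  have "gr_projective_resolution K B M P"
    unfolding gr_projective_resolution_def exact_resolution_def
  proof (intro conjI allI)
    show "gr_projective K B (obj P n)" for n by (simp add: P_def FR_def gr_projective_free)
    show "diff P n \<in> gr_hom B (obj P (Suc n)) (obj P n)" for n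
      using d by (simp add: P_def)
    show "aug P \<in> gr_hom B (obj P 0) M" using e(1) by (simp add: P_def Z(2))
    show "aug P ` carrier (obj P 0) = carrier M" using e(2) by (simp add: P_def Z(2))
    show "a_kernel (obj P 0) M (aug P) = diff P 0 ` carrier (obj P 1)"
      using d0(2) q[of 0] by (simp add: P_def Z(2))
    show "a_kernel (obj P (Suc n)) (obj P n) (diff P n) = diff P (Suc n) ` carrier (obj P (Suc (Suc n)))" for n
      using k by (simp add: P_def)
  qed
  then show ?thesis by blast
qed

lemma the_gr_res: "gr_obj K B M \<Longrightarrow> gr_projective_resolution K B M (the_gr_res K B M)"
  unfolding the_gr_res_def by (rule someI_ex[OF gr_projective_resolution_exists])

section \<open>Graded projective modules are summands of graded free modules\<close>

lemma gr_projective_summand: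
  assumes P: "gr_projective K B P"
  shows "\<exists>k r. \<exists>\<pi>\<in>gr_hom B (free_gr k r) P. \<exists>s\<in>gr_hom B P (free_gr k r). \<forall>x\<in>carrier P. \<pi> (s x) = x"
proof -
  have oP: "gr_obj K B P" using P by (simp add: gr_projective_def)
  interpret P: graded_lmod B P using oP by (rule gr_obj_lmod)
  obtain k r \<pi> where \<pi>: "\<pi> \<in> gr_hom B (free_gr k r) P" "\<pi> ` carrier (free_gr k r) = carrier P"
    using gr_obj_cover[OF oP] by blast
  then obtain s where s: "s \<in> gr_hom B P (free_gr k r)" "compose (carrier P) \<pi> s = (\<lambda>x\<in>carrier P. x)"
    using P P.id_gr_hom oP gr_obj_free unfolding gr_projective_def by metis
  have "\<pi> (s x) = x" if "x \<in> carrier P" for x using fun_cong[OF s(2), of x] that by (simp add: compose_def)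
  then show ?thesis using \<pi>(1) s(1) by blast
qed

text \<open>Passing through a graded free module extends the lifting property to modules on any type and to maps
  \<open>g\<close> that reach the image of \<open>f\<close> without being surjective.\<close>

lemma gr_projective_lift:
  assumes P: "gr_projective K B P" and U: "graded_lmod B U" and V: "graded_lmod B V"
    and g: "g \<in> gr_hom B U V" and f: "f \<in> gr_hom B P V" and im: "f ` carrier P \<subseteq> g ` carrier U"
  shows "\<exists>h\<in>gr_hom B P U. \<forall>x\<in>carrier P. g (h x) = f x"
proof -
  have lP: "graded_lmod B P" using P by (simp add: gr_projective_def gr_obj_lmod)
  obtain k r \<pi> s where \<pi>: "\<pi> \<in> gr_hom B (free_gr k r) P" and s: "s \<in> gr_hom B P (free_gr k r)"
     "\<And>x. x \<in> carrier P \<Longrightarrow> \<pi> (s x) = x"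
    using gr_projective_summand[OF P] by blast
  note cl = lmod_hom_closed[OF gr_hom_lmod_hom[OF \<pi>]] lmod_hom_closed[OF gr_hom_lmod_hom[OF s(1)]]
  have "compose (carrier (free_gr k r)) f \<pi> ` carrier (free_gr k r) \<subseteq> g ` carrier U"
    using im cl by (auto simp: compose_def)
  then obtain h where h: "h \<in> gr_hom B (free_gr k r) U"
      "\<And>x. x \<in> carrier (free_gr k r) \<Longrightarrow> g (h x) = compose (carrier (free_gr k r)) f \<pi> x"
    using free_gr_lift[OF U V g gr_hom_compose[OF graded_lmod_free \<pi> f]] by blast
  have "g (compose (carrier P) h s x) = f x" if "x \<in> carrier P" for x
    using that h(2)[of "s x"] cl s(2) by (simp add: compose_def)
  then show ?thesis using gr_hom_compose[OF lP s(1) h(1)] by blast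
qed

text \<open>\<open>F\<^sub>\<sigma> P\<close> with its grading forgotten, an object of ordinary resolutions.\<close>

abbreviation "F0 P \<equiv> module.truncate (F P)"

lemma F0_sel [simp]:
  "carrier (F0 P) = carrier P" "ring.add (F0 P) = ring.add P" "ring.zero (F0 P) = ring.zero P"
  "smult (F0 P) = smult (F P)"
  by (simp_all add: module.truncate_def)

lemma left_module_F0:
  assumes "graded_lmod B M" shows "left_module B\<sigma> (F0 M)"
proof -
  interpret M: left_module B\<sigma> "F M" by (rule left_module_F[OF assms])
  show ?thesis
  proof (intro left_module.intro left_module_axioms.intro)
    show "abelian_group (F0 M)"
      by (rule abelian_group_cong_struct[OF M.M.abelian_group_axioms]) simp_all
  qed (use M.lsmult_closed M.lsmult_l_distr M.lsmult_r_distr M.lsmult_assoc M.lsmult_one ring_Bs in simp_all)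
qed

lemma lmod_hom_F0:
  "lmod_hom B\<sigma> (F0 M) N = lmod_hom B\<sigma> (F M) N" "lmod_hom B\<sigma> N (F0 M) = lmod_hom B\<sigma> N (F M)"
  by (simp_all add: lmod_hom_def)

text \<open>A splitting of a graded cover \<open>\<pi>\<close> by a free module is also a splitting over \<open>B\<^sup>\<sigma>\<close>, so a lift of \<open>f \<pi>\<close>
  through the free module \<open>F\<^sub>\<sigma>\<close> of the cover restricts to a lift of \<open>f\<close>.\<close>

lemma projective_F0:
  assumes P: "gr_projective K B P"
  shows "projective B\<sigma> (F0 P)"
proof -
  have lP: "graded_lmod B P" using P by (simp add: gr_projective_def gr_obj_lmod)
  obtain k r \<pi> s where \<pi>: "\<pi> \<in> gr_hom B (free_gr k r) P" and s: "s \<in> gr_hom B P (free_gr k r)"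
     "\<And>x. x \<in> carrier P \<Longrightarrow> \<pi> (s x) = x"
    using gr_projective_summand[OF P] by blast
  note Fl = graded_lmod_free[of k r]
  note \<pi>' = gr_hom_F[OF Fl lP \<pi>] and s' = gr_hom_F[OF lP Fl s(1)]
  note cl = lmod_hom_closed[OF \<pi>', simplified] lmod_hom_closed[OF s', simplified]
  show ?thesis
    unfolding projective_def
  proof (intro conjI allI impI ballI left_module_F0[OF lP])
    fix U V :: "('b, nat \<Rightarrow> 'b) module" and g f
    assume o: "left_module B\<sigma> U \<and> left_module B\<sigma> V" and g: "g \<in> lmod_hom B\<sigma> U V"
      and f: "f \<in> lmod_hom B\<sigma> (F0 P) V" and im: "g ` carrier U = carrier V"
    have f': "f \<in> lmod_hom B\<sigma> (F P) V" using f by (simp add: lmod_hom_F0)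
    have fp: "compose (carrier (F (free_gr k r))) f \<pi> \<in> lmod_hom B\<sigma> (F (free_gr k r)) V"
      by (rule lmod_hom_compose[OF left_module_F[OF Fl] \<pi>' f'])
    have "compose (carrier (F (free_gr k r))) f \<pi> ` carrier (free_gr k r) \<subseteq> g ` carrier U"
      using im lmod_hom_closed[OF fp] by auto
    then obtain h where h: "h \<in> lmod_hom B\<sigma> (F (free_gr k r)) U"
        "\<And>x. x \<in> carrier (free_gr k r) \<Longrightarrow> g (h x) = compose (carrier (F (free_gr k r))) f \<pi> x"
      using free_F_lift[OF _ _ g fp] o by blast
    have "compose (carrier (F P)) h s \<in> lmod_hom B\<sigma> (F P) U"
      by (rule lmod_hom_compose[OF left_module_F[OF lP] s' h(1)])
    moreover have "compose (carrier (F0 P)) g (compose (carrier (F P)) h s) = f"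
    proof (rule extensionalityI[of _ "carrier (F0 P)"])
      fix x assume "x \<in> carrier (F0 P)"
      then show "compose (carrier (F0 P)) g (compose (carrier (F P)) h s) x = f x"
        using h(2)[of "s x"] cl s(2) by (simp add: compose_def)
    qed (use lmod_hom_extensional[OF f] in simp_all)
    ultimately show "\<exists>h\<in>lmod_hom B\<sigma> (F0 P) U. compose (carrier (F0 P)) g h = f"
      by (auto simp: lmod_hom_F0)
  qed
qed

definition F_res :: "('b, 'm) gr_res \<Rightarrow> ('b, 'm) mod_res" where
  "F_res P = \<lparr>obj = (\<lambda>n. F0 (obj P n)), diff = diff P, aug = aug P\<rparr>"

lemma F_res_sel [simp]: "obj (F_res P) n = F0 (obj P n)" "diff (F_res P) = diff P" "aug (F_res P) = aug P"
  by (simp_all add: F_res_def)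

lemma gr_projective_resolutionD:
  assumes "gr_projective_resolution K B M P"
  shows "gr_projective K B (obj P n)" "diff P n \<in> gr_hom B (obj P (Suc n)) (obj P n)"
    "aug P \<in> gr_hom B (obj P 0) M" "exact_resolution P M" "graded_lmod B (obj P n)"
    "gr_obj K B (obj P n)"
  using assms by (auto simp: gr_projective_resolution_def gr_projective_def gr_obj_iff)

lemma projective_resolution_F:
  assumes M: "graded_lmod B M" and P: "gr_projective_resolution K B M P"
  shows "projective_resolution B\<sigma> (F M) (F_res P)"
proof -
  note pP = gr_projective_resolutionD[OF P]
  have "exact_resolution (F_res P) (F M)"
    using pP(4) by (simp add: exact_resolution_def a_kernel_def')
  then show ?thesis
    using projective_F0[OF pP(1)] gr_hom_F[OF pP(5) pP(5) pP(2)] gr_hom_F[OF pP(5) M pP(3)]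
    by (simp add: projective_resolution_def lmod_hom_F0)
qed

lemma the_res_F:
  assumes M: "gr_obj K B M" shows "projective_resolution B\<sigma> (F M) (the_res B\<sigma> (F M))"
  unfolding the_res_def
  by (rule someI_ex) (use projective_resolution_F[OF gr_obj_lmod[OF M] the_gr_res[OF M]] in blast)

lemma gr_chain_lift_exists:
  assumes P': "gr_projective_resolution K B M' P'" and P: "gr_projective_resolution K B M P"
    and M': "graded_lmod B M'" and M: "graded_lmod B M" and h: "h \<in> gr_hom B M' M"
  shows "\<exists>\<phi>. is_chain_lift (\<lambda>n. gr_hom B (obj P' n) (obj P n)) P' P h \<phi>"
proof (rule is_chain_lift_exists)
  note pP' = gr_projective_resolutionD[OF P'] and pP = gr_projective_resolutionD[OF P]
  show "exact_resolution P M" "exact_resolution P' M'" by (rule pP(4) pP'(4))+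
  show "h \<zero>\<^bsub>M'\<^esub> = \<zero>\<^bsub>M\<^esub>" by (rule lmod_hom_zero[OF gr_hom_lmod_hom[OF h] graded_lmod_abelian_group[OF M'] graded_lmod_abelian_group[OF M]])
  show "f \<zero>\<^bsub>obj P' n\<^esub> = \<zero>\<^bsub>obj P n\<^esub>" if "f \<in> gr_hom B (obj P' n) (obj P n)" for n f
    by (rule lmod_hom_zero[OF gr_hom_lmod_hom[OF that] graded_lmod_abelian_group[OF pP'(5)] graded_lmod_abelian_group[OF pP(5)]])
  have "compose (carrier (obj P' 0)) h (aug P') \<in> gr_hom B (obj P' 0) M"
    by (rule gr_hom_compose[OF pP'(5) pP'(3) h])
  from gr_projective_lift[OF pP'(1) pP(5) M pP(3) this]
  show "(\<lambda>x. h (aug P' x)) ` carrier (obj P' 0) \<subseteq> aug P ` carrier (obj P 0) \<Longrightarrow>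
    \<exists>k\<in>gr_hom B (obj P' 0) (obj P 0). \<forall>x\<in>carrier (obj P' 0). aug P (k x) = h (aug P' x)"
    by (simp add: compose_def image_subset_iff)
  fix n f assume f: "f \<in> gr_hom B (obj P' n) (obj P n)"
  have "compose (carrier (obj P' (Suc n))) f (diff P' n) \<in> gr_hom B (obj P' (Suc n)) (obj P n)"
    by (rule gr_hom_compose[OF pP'(5) pP'(2) f])
  from gr_projective_lift[OF pP'(1) pP(5) pP(5) pP(2) this]
  show "(\<lambda>x. f (diff P' n x)) ` carrier (obj P' (Suc n)) \<subseteq> diff P n ` carrier (obj P (Suc n)) \<Longrightarrow>
    \<exists>k\<in>gr_hom B (obj P' (Suc n)) (obj P (Suc n)).
      \<forall>x\<in>carrier (obj P' (Suc n)). diff P n (k x) = f (diff P' n x)"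
    by (simp add: compose_def image_subset_iff)
qed (use h in \<open>auto dest!: gr_hom_lmod_hom dest: lmod_hom_closed\<close>)

end

section \<open>Homogeneous parts of homomorphisms over the twisted algebra\<close>

lemma (in graded_group) additive_eqI:
  assumes "f \<in> extensional (carrier M)" "g \<in> extensional (carrier M)"
    and N: "abelian_group N" and cl: "\<And>x. x \<in> carrier M \<Longrightarrow> f x \<in> carrier N" "\<And>x. x \<in> carrier M \<Longrightarrow> g x \<in> carrier N"
    and f: "\<And>x y. \<lbrakk>x \<in> carrier M; y \<in> carrier M\<rbrakk> \<Longrightarrow> f (x \<oplus> y) = f x \<oplus>\<^bsub>N\<^esub> f y"
    and g: "\<And>x y. \<lbrakk>x \<in> carrier M; y \<in> carrier M\<rbrakk> \<Longrightarrow> g (x \<oplus> y) = g x \<oplus>\<^bsub>N\<^esub> g y"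
    and eq: "\<And>i x. x \<in> grade M i \<Longrightarrow> f x = g x"
  shows "f = g"
proof (rule extensionalityI[OF assms(1,2)])
  interpret N: abelian_group N by fact
  fix x assume "x \<in> carrier M"
  then show "f x = g x"
    by (induction x rule: homog_induct) (use eq[OF grade_zero] eq in \<open>auto simp: f g\<close>)
qed

text \<open>The part of \<open>f\<close> that raises degrees by \<open>d\<close>.\<close>

definition hom_part :: "('a, 'm, 'x) graded_module_scheme \<Rightarrow> ('c, 'n, 'y) graded_module_scheme
    \<Rightarrow> int \<Rightarrow> ('m \<Rightarrow> 'n) \<Rightarrow> 'm \<Rightarrow> 'n"
  where "hom_part M N d f = (\<lambda>x\<in>carrier M. gr_ext M N (\<lambda>r x. component N (f x) (r + d)) x)"

context twist
begin

text \<open>Linearity into the twisted shift has to be checked for homogeneous scalars and elements only.\<close>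

lemma gr_hom_twist_shiftI:
  assumes M: "graded_lmod B M" and N: "graded_lmod B N" and ex: "u \<in> extensional (carrier M)"
    and add: "\<And>x y. \<lbrakk>x \<in> carrier M; y \<in> carrier M\<rbrakk> \<Longrightarrow> u (x \<oplus>\<^bsub>M\<^esub> y) = u x \<oplus>\<^bsub>N\<^esub> u y"
    and grade: "\<And>r x. x \<in> grade M r \<Longrightarrow> u x \<in> grade N (r + d)"
    and smult: "\<And>s b r x. \<lbrakk>b \<in> grade B s; x \<in> grade M r\<rbrakk> \<Longrightarrow> u (b \<odot>\<^bsub>M\<^esub> x) = spow d b \<odot>\<^bsub>N\<^esub> u x"
  shows "u \<in> gr_hom B M (twist_shift B \<sigma> d N)"
proof -
  interpret M: graded_lmod B M by fact
  interpret N: graded_lmod B N by fact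
  have cl: "u x \<in> carrier N" if "x \<in> carrier M" for x
    using that
  proof (induction x rule: M.G.homog_induct)
    case zero then show ?case using grade[OF M.G.grade_zero] N.G.grade_carrier by blast
  next
    case (homog i x) then show ?case using grade N.G.grade_carrier by blast
  next
    case (add x y) then show ?case using assms(4) by simp
  qed
  have z: "u \<zero>\<^bsub>M\<^esub> = \<zero>\<^bsub>N\<^esub>"
    using add[of "\<zero>\<^bsub>M\<^esub>" "\<zero>\<^bsub>M\<^esub>"] cl[of "\<zero>\<^bsub>M\<^esub>"] by (simp add: N.M.add.r_cancel_one')
  have "u (b \<odot>\<^bsub>M\<^esub> x) = spow d b \<odot>\<^bsub>N\<^esub> u x" if b: "b \<in> carrier B" and x: "x \<in> carrier M" for b x
    using x
  proof (induction x rule: M.G.homog_induct)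
    case zero then show ?case using b by (simp add: z M.lsmult_zero N.lsmult_zero)
  next
    case (homog r x)
    then have x: "x \<in> carrier M" by (rule M.G.grade_carrier)
    from b show ?case
    proof (induction b rule: BG.homog_induct)
      case zero
      show ?case using smult[OF BG.grade_zero homog] .
    next
      case (homog s b) then show ?case using smult \<open>x \<in> grade M r\<close> by blast
    next
      case (add b c) then show ?case using x cl
        by (simp add: M.lsmult_l_distr N.lsmult_l_distr spow_plus assms(4) M.lsmult_closed)
    qed
  next
    case (add x y) then show ?case using b cl by (simp add: M.lsmult_r_distr N.lsmult_r_distr assms(4) M.lsmult_closed)
  qed
  then have "u \<in> lmod_hom B M (twist_shift B \<sigma> d N)"
    by (intro lmod_homI ex) (simp_all add: cl add)
  then show ?thesis using grade by (auto simp: gr_hom_def)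
qed

context
  fixes M :: "('b, 'm, 'y) graded_module_scheme" and N :: "('b, 'n, 'z) graded_module_scheme"
  assumes M: "graded_lmod B M" and N: "graded_lmod B N"
begin

interpretation M: graded_lmod B M by (rule M)
interpretation N: graded_lmod B N by (rule N)
interpretation FM: graded_lmod B\<sigma> "F M" by (rule graded_lmod_F[OF M])
interpretation FN: graded_lmod B\<sigma> "F N" by (rule graded_lmod_F[OF N])

lemma gr_hom_homog_eqI:
  assumes "u \<in> gr_hom B M (twist_shift B \<sigma> d N)" "v \<in> gr_hom B M (twist_shift B \<sigma> d N)"
    "\<And>r x. x \<in> grade M r \<Longrightarrow> u x = v x"
  shows "u = v"
  using assms(1,2)[THEN gr_hom_lmod_hom] assms(3)
  by (intro M.G.additive_eqI[of u v N])
    (auto dest: lmod_hom_extensional lmod_hom_closed lmod_hom_add intro: N.M.abelian_group_axioms)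

context
  fixes f assumes f: "f \<in> lmod_hom B\<sigma> (F M) (F N)"
begin

lemma F_hom_closed: "x \<in> carrier M \<Longrightarrow> f x \<in> carrier N"
  using lmod_hom_closed[OF f] by simp

lemma F_hom_add: "\<lbrakk>x \<in> carrier M; y \<in> carrier M\<rbrakk> \<Longrightarrow> f (x \<oplus>\<^bsub>M\<^esub> y) = f x \<oplus>\<^bsub>N\<^esub> f y"
  using lmod_hom_add[OF f] by simp

private lemma part_prems: "graded_group M" "abelian_group N"
  "x \<in> grade M r \<Longrightarrow> component N (f x) (r + d) \<in> carrier N"
  "x \<in> grade M r \<Longrightarrow> y \<in> grade M r \<Longrightarrow> component N (f (x \<oplus>\<^bsub>M\<^esub> y)) (r + d) =
    component N (f x) (r + d) \<oplus>\<^bsub>N\<^esub> component N (f y) (r + d)"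
  by (simp_all add: M.G.graded_group_axioms N.M.abelian_group_axioms N.G.component_closed F_hom_closed F_hom_add
      M.G.grade_carrier N.G.component_add)

lemma hom_part_homog: "x \<in> grade M r \<Longrightarrow> hom_part M N d f x = component N (f x) (r + d)"
  using gr_ext_homog[of M N "\<lambda>r x. component N (f x) (r + d)", OF part_prems]
  by (simp add: hom_part_def M.G.grade_carrier)

text \<open>Let \<open>b \<in> B\<^sub>s\<close> and \<open>x \<in> M\<^sub>r\<close>, and write \<open>b = \<sigma>\<^sup>r(c)\<close>.  Then \<open>b x = c * x\<close>, so \<open>f (b x) = c * f x\<close>, whose component
  in degree \<open>s + r + d\<close> is \<open>c\<close> times the component of \<open>f x\<close> in degree \<open>r + d\<close>; on that degree, \<open>c\<close> acts as
  \<open>\<sigma>\<^sup>r\<^sup>+\<^sup>d(c) = \<sigma>\<^sup>d(b)\<close>.\<close>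

lemma hom_part_gr_hom: "hom_part M N d f \<in> gr_hom B M (twist_shift B \<sigma> d N)"
proof (rule gr_hom_twist_shiftI[OF M N])
  show "hom_part M N d f \<in> extensional (carrier M)" by (simp add: hom_part_def)
  show "hom_part M N d f (x \<oplus>\<^bsub>M\<^esub> y) = hom_part M N d f x \<oplus>\<^bsub>N\<^esub> hom_part M N d f y"
    if "x \<in> carrier M" "y \<in> carrier M" for x y
    using gr_ext_add[of M N "\<lambda>r x. component N (f x) (r + d)", OF part_prems] that by (simp add: hom_part_def)
  show "hom_part M N d f x \<in> grade N (r + d)" if "x \<in> grade M r" for x r
    using that by (simp add: hom_part_homog N.G.component_grade F_hom_closed M.G.grade_carrier)
  fix s b r x assume b: "b \<in> grade B s" and x: "x \<in> grade M r"
  define c where "c = spow (- r) b"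
  have bc: "b \<in> carrier B" and xc: "x \<in> carrier M" using b x by (auto intro: BG.grade_carrier M.G.grade_carrier)
  have c: "c \<in> grade B s" "c \<in> carrier B" "spow r c = b" "spow (r + d) c = spow d b"
    using b bc by (auto simp: c_def spow_grade spow_add spow_0)
  have "b \<odot>\<^bsub>M\<^esub> x = c \<odot>\<^bsub>F M\<^esub> x" using F_smult_homog[OF M c(2) x] c(3) by simp
  then have "f (b \<odot>\<^bsub>M\<^esub> x) = c \<odot>\<^bsub>F N\<^esub> f x" using lmod_hom_smult[OF f, of c x] c xc by simp
  moreover have "component N (c \<odot>\<^bsub>F N\<^esub> f x) (s + (r + d)) = c \<odot>\<^bsub>F N\<^esub> component N (f x) (r + d)"
    using FN.component_smult[of c s "f x" "r + d"] c F_hom_closed[OF xc] by (simp add: component_F)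
  moreover have "\<dots> = spow d b \<odot>\<^bsub>N\<^esub> component N (f x) (r + d)"
    using F_smult_homog[OF N c(2) N.G.component_grade[OF F_hom_closed[OF xc], of "r + d"]] c(4) by simp
  ultimately show "hom_part M N d f (b \<odot>\<^bsub>M\<^esub> x) = spow d b \<odot>\<^bsub>N\<^esub> hom_part M N d f x"
    using hom_part_homog[OF M.smult_grade[OF b x]] hom_part_homog[OF x] by (simp add: add.assoc)
qed

lemma hom_part_eqI:
  assumes "u \<in> gr_hom B M (twist_shift B \<sigma> d N)" "\<And>r x. x \<in> grade M r \<Longrightarrow> u x = component N (f x) (r + d)"
  shows "hom_part M N d f = u"
  using assms hom_part_gr_hom by (intro gr_hom_homog_eqI) (auto simp: hom_part_homog)

end

lemma hom_parts_determine:
  assumes f: "f \<in> lmod_hom B\<sigma> (F M) (F N)" and g: "g \<in> lmod_hom B\<sigma> (F M) (F N)"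
    and eq: "\<And>d. hom_part M N d f = hom_part M N d g"
  shows "f = g"
proof (rule M.G.additive_eqI[of f g N])
  fix r x assume x: "x \<in> grade M r"
  have xc: "x \<in> carrier M" using x by (rule M.G.grade_carrier)
  show "f x = g x"
  proof (rule N.G.component_ext)
    fix i show "component N (f x) i = component N (g x) i"
      using fun_cong[OF eq[of "i - r"], of x] hom_part_homog[OF f x, of "i - r"] hom_part_homog[OF g x, of "i - r"]
      by simp
  qed (use F_hom_closed f g xc in auto)
qed (use f g F_hom_closed F_hom_add N.M.abelian_group_axioms lmod_hom_extensional[OF f] lmod_hom_extensional[OF g] in auto)

lemma hom_part_add:
  assumes f: "f \<in> lmod_hom B\<sigma> (F M) (F N)" and g: "g \<in> lmod_hom B\<sigma> (F M) (F N)"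
  shows "hom_part M N d (\<lambda>x\<in>carrier M. f x \<oplus>\<^bsub>N\<^esub> g x) = (\<lambda>x\<in>carrier M. hom_part M N d f x \<oplus>\<^bsub>N\<^esub> hom_part M N d g x)"
proof (rule hom_part_eqI)
  show "(\<lambda>x\<in>carrier M. f x \<oplus>\<^bsub>N\<^esub> g x) \<in> lmod_hom B\<sigma> (F M) (F N)"
    using hom_module_closed(2)[OF k_algebra_Bs FM.left_module_axioms FN.left_module_axioms f g]
    by (simp add: hom_module_sel)
  have "(\<lambda>x\<in>carrier M. hom_part M N d f x \<oplus>\<^bsub>N\<^esub> hom_part M N d g x) \<in> lmod_hom B M (twist_shift B \<sigma> d N)"
    using hom_module_closed(2)[OF A.k_algebra_axioms M.left_module_axioms left_module_twist_shift[OF N.left_module_axioms]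
      gr_hom_lmod_hom[OF hom_part_gr_hom[OF f]] gr_hom_lmod_hom[OF hom_part_gr_hom[OF g]]]
    by (simp add: hom_module_sel)
  then show "(\<lambda>x\<in>carrier M. hom_part M N d f x \<oplus>\<^bsub>N\<^esub> hom_part M N d g x) \<in> gr_hom B M (twist_shift B \<sigma> d N)"
    using gr_hom_grade[OF hom_part_gr_hom[OF f]] gr_hom_grade[OF hom_part_gr_hom[OF g]]
    by (auto simp: gr_hom_def M.G.grade_carrier N.G.grade_add)
qed (use F_hom_closed[OF f] F_hom_closed[OF g] f g in \<open>auto simp: hom_part_homog M.G.grade_carrier N.G.component_add\<close>)

lemma hom_part_smult:
  assumes f: "f \<in> lmod_hom B\<sigma> (F M) (F N)" and c: "c \<in> carrier K"
  shows "hom_part M N d (\<lambda>x\<in>carrier M. (c \<odot>\<^bsub>B\<^esub> \<one>\<^bsub>B\<^esub>) \<odot>\<^bsub>N\<^esub> f x)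
    = (\<lambda>x\<in>carrier M. (c \<odot>\<^bsub>B\<^esub> \<one>\<^bsub>B\<^esub>) \<odot>\<^bsub>N\<^esub> hom_part M N d f x)"
proof (rule hom_part_eqI)
  have "(\<lambda>x\<in>carrier M. (c \<odot>\<^bsub>B\<^esub> \<one>\<^bsub>B\<^esub>) \<odot>\<^bsub>N\<^esub> f x) = (\<lambda>x\<in>carrier M. (c \<odot>\<^bsub>B\<^esub> \<one>\<^bsub>B\<^esub>) \<odot>\<^bsub>F N\<^esub> f x)"
    using F_hom_closed[OF f] c by (intro restrict_ext) (simp add: F_smult_kone[OF N])
  then show "(\<lambda>x\<in>carrier M. (c \<odot>\<^bsub>B\<^esub> \<one>\<^bsub>B\<^esub>) \<odot>\<^bsub>N\<^esub> f x) \<in> lmod_hom B\<sigma> (F M) (F N)"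
    using hom_module_closed(3)[OF k_algebra_Bs FM.left_module_axioms FN.left_module_axioms c f]
    by (simp add: hom_module_sel)
  have "(\<lambda>x\<in>carrier M. (c \<odot>\<^bsub>B\<^esub> \<one>\<^bsub>B\<^esub>) \<odot>\<^bsub>N\<^esub> hom_part M N d f x) \<in> lmod_hom B M (twist_shift B \<sigma> d N)"
    using hom_module_closed(3)[OF A.k_algebra_axioms M.left_module_axioms left_module_twist_shift[OF N.left_module_axioms]
      c gr_hom_lmod_hom[OF hom_part_gr_hom[OF f]], of d] c
    by (simp add: hom_module_sel spow_kone)
  then show "(\<lambda>x\<in>carrier M. (c \<odot>\<^bsub>B\<^esub> \<one>\<^bsub>B\<^esub>) \<odot>\<^bsub>N\<^esub> hom_part M N d f x) \<in> gr_hom B M (twist_shift B \<sigma> d N)"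
    using gr_hom_grade[OF hom_part_gr_hom[OF f], of _ _ d] N.smult_grade[OF kone_grade[OF c]]
    by (auto simp: gr_hom_def M.G.grade_carrier)
  fix r x assume x: "x \<in> grade M r"
  then show "(\<lambda>x\<in>carrier M. (c \<odot>\<^bsub>B\<^esub> \<one>\<^bsub>B\<^esub>) \<odot>\<^bsub>N\<^esub> hom_part M N d f x) x =
     component N ((\<lambda>x\<in>carrier M. (c \<odot>\<^bsub>B\<^esub> \<one>\<^bsub>B\<^esub>) \<odot>\<^bsub>N\<^esub> f x) x) (r + d)"
    using N.component_smult[OF kone_grade[OF c] A.kone_closed[OF c] F_hom_closed[OF f], of x "r + d"]
    by (simp add: hom_part_homog[OF f] M.G.grade_carrier)
qed

lemma zero_gr_hom: "(\<lambda>x\<in>carrier M. \<zero>\<^bsub>N\<^esub>) \<in> gr_hom B M (twist_shift B \<sigma> d N)"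
  using hom_module_closed(1)[OF A.k_algebra_axioms M.left_module_axioms left_module_twist_shift[OF N.left_module_axioms], of d]
  by (auto simp: hom_module_sel gr_hom_def M.G.grade_carrier N.G.grade_zero)

lemma hom_part_of_gr_hom:
  assumes u: "u \<in> gr_hom B M (twist_shift B \<sigma> d N)"
  shows "hom_part M N e u = (if e = d then u else (\<lambda>x\<in>carrier M. \<zero>\<^bsub>N\<^esub>))"
proof (rule hom_part_eqI[OF twisted_gr_hom_F[OF M N u]])
  fix r x assume x: "x \<in> grade M r"
  then have "u x \<in> grade N (r + d)" using gr_hom_grade[OF u] by simp
  from N.G.component_homog[OF this]
  show "(if e = d then u else (\<lambda>x\<in>carrier M. \<zero>\<^bsub>N\<^esub>)) x = component N (u x) (r + e)"
    by (simp add: M.G.grade_carrier[OF x])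
qed (simp add: u zero_gr_hom)

lemma hom_part_zero: "hom_part M N d (\<lambda>x\<in>carrier M. \<zero>\<^bsub>N\<^esub>) = (\<lambda>x\<in>carrier M. \<zero>\<^bsub>N\<^esub>)"
  using hom_part_of_gr_hom[OF zero_gr_hom[of d], of d] by simp

text \<open>A morphism \<open>u d\<close> is linear over \<open>B\<^sup>\<sigma>\<close> by itself and is its own only nonzero part.  Adding the nonzero \<open>u d\<close> one
  at a time gives the required homomorphism.\<close>

lemma hom_parts_surjective:
  assumes fin: "finite {d. u d \<noteq> (\<lambda>x\<in>carrier M. \<zero>\<^bsub>N\<^esub>)}"
    and u: "\<And>d. u d \<in> gr_hom B M (twist_shift B \<sigma> d N)"
  shows "\<exists>f\<in>lmod_hom B\<sigma> (F M) (F N). \<forall>d. hom_part M N d f = u d"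
proof -
  let ?z = "\<lambda>x\<in>carrier M. \<zero>\<^bsub>N\<^esub>"
  have "\<exists>f\<in>lmod_hom B\<sigma> (F M) (F N). \<forall>d. hom_part M N d f = (if d \<in> D then u d else ?z)"
    if "finite D" for D
    using that
  proof induction
    case empty
    show ?case using twisted_gr_hom_F[OF M N zero_gr_hom[of 0]] hom_part_zero
      by (intro bexI[of _ ?z]) (simp_all only: empty_iff if_False simp_thms)
  next
    case (insert e D)
    then obtain f where f: "f \<in> lmod_hom B\<sigma> (F M) (F N)" "\<And>d. hom_part M N d f = (if d \<in> D then u d else ?z)" by blast
    have ue: "u e \<in> lmod_hom B\<sigma> (F M) (F N)" by (rule twisted_gr_hom_F[OF M N u])
    let ?g = "\<lambda>x\<in>carrier M. f x \<oplus>\<^bsub>N\<^esub> u e x"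
    have "?g \<in> lmod_hom B\<sigma> (F M) (F N)"
      using hom_module_closed(2)[OF k_algebra_Bs FM.left_module_axioms FN.left_module_axioms f(1) ue]
      by (simp add: hom_module_sel)
    moreover have "hom_part M N d ?g = (if d \<in> insert e D then u d else ?z)" for d
    proof (rule extensionalityI[of _ "carrier M"])
      fix x assume x: "x \<in> carrier M"
      have "u d x \<in> carrier N" for d using lmod_hom_closed[OF gr_hom_lmod_hom[OF u] x] by simp
      then show "hom_part M N d ?g x = (if d \<in> insert e D then u d else ?z) x"
        using x insert.hyps by (auto simp: hom_part_add[OF f(1) ue] f(2) hom_part_of_gr_hom[OF u])
    qed (use lmod_hom_extensional[OF gr_hom_lmod_hom[OF u]] in \<open>auto simp: hom_part_def\<close>)
    ultimately show ?case by blast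
  qed
  from this[OF fin] obtain f where f: "f \<in> lmod_hom B\<sigma> (F M) (F N)"
    "\<And>d. hom_part M N d f = (if d \<in> {d. u d \<noteq> ?z} then u d else ?z)" by blast
  have "hom_part M N d f = u d" for d
    by (cases "u d = ?z") (simp_all only: f(2) mem_Collect_eq simp_thms if_False if_True)
  then show ?thesis using f(1) by blast
qed

end

lemma finite_degrees:
  assumes M: "gr_obj K B M"
  shows "\<exists>I. finite I \<and> (\<forall>x\<in>carrier M. \<forall>i. i \<notin> I \<longrightarrow> component M x i = \<zero>\<^bsub>M\<^esub>)"
proof -
  interpret M: graded_lmod B M using M by (rule gr_obj_lmod)
  interpret V: module K "restrict_scalars B M"
    by (rule module_restrict_scalars[OF A.k_algebra_axioms M.left_module_axioms])
  obtain S where S: "finite S" "S \<subseteq> carrier M" "carrier M \<subseteq> kspan K (restrict_scalars B M) S"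
    using M V.fin_dim_iff_kspan by (auto simp: gr_obj_iff)
  define I where "I = (\<Union>s\<in>S. {i. component M s i \<noteq> \<zero>\<^bsub>M\<^esub>})"
  have "x \<in> carrier M \<and> (\<forall>i. i \<notin> I \<longrightarrow> component M x i = \<zero>\<^bsub>M\<^esub>)"
    if "x \<in> kspan K (restrict_scalars B M) S" for x
    using that
  proof induction
    case (kspan_smult c x)
    then show ?case using M.component_smult[OF kone_grade[OF kspan_smult.hyps(1)] A.kone_closed[OF kspan_smult.hyps(1)], of x]
      by (simp add: M.lsmult_closed A.kone_closed M.lsmult_zero)
  qed (use S in \<open>auto simp: M.G.component_zero M.G.component_add I_def\<close>)
  moreover have "finite I" using S M.G.component_finite by (auto simp: I_def)
  ultimately show ?thesis using S(3) by blast
qed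

text \<open>A nonzero part raises some degree of \<open>M\<close> to some degree of \<open>N\<close>, so \<open>d\<close> is a difference of such degrees.\<close>

lemma hom_part_finite:
  assumes M: "gr_obj K B M" and N: "gr_obj K B N" and f: "f \<in> lmod_hom B\<sigma> (F M) (F N)"
  shows "finite {d. hom_part M N d f \<noteq> (\<lambda>x\<in>carrier M. \<zero>\<^bsub>N\<^esub>)}"
proof -
  note lM = gr_obj_lmod[OF M] and lN = gr_obj_lmod[OF N]
  interpret M: graded_lmod B M by (rule lM)
  interpret N: graded_lmod B N by (rule lN)
  obtain I where I: "finite I" "\<And>x i. x \<in> carrier M \<Longrightarrow> i \<notin> I \<Longrightarrow> component M x i = \<zero>\<^bsub>M\<^esub>"
    using finite_degrees[OF M] by blast
  obtain J where J: "finite J" "\<And>x i. x \<in> carrier N \<Longrightarrow> i \<notin> J \<Longrightarrow> component N x i = \<zero>\<^bsub>N\<^esub>"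
    using finite_degrees[OF N] by blast
  have "hom_part M N d f = (\<lambda>x\<in>carrier M. \<zero>\<^bsub>N\<^esub>)" if d: "d \<notin> (\<lambda>(j, i). j - i) ` (J \<times> I)" for d
  proof (rule hom_part_eqI[OF lM lN f zero_gr_hom[OF lM lN]])
    fix r x assume x: "x \<in> grade M r"
    have xc: "x \<in> carrier M" using x by (rule M.G.grade_carrier)
    show "(\<lambda>x\<in>carrier M. \<zero>\<^bsub>N\<^esub>) x = component N (f x) (r + d)"
    proof (cases "r \<in> I")
      case True
      then have "r + d \<notin> J" using d by (force simp: image_iff)
      then show ?thesis using J(2) F_hom_closed[OF lM lN f xc] xc by simp
    next
      case False
      then have x0: "x = \<zero>\<^bsub>M\<^esub>" using I(2)[OF xc] M.G.component_homog[OF x, of r] by simp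
      have "f \<zero>\<^bsub>M\<^esub> = \<zero>\<^bsub>N\<^esub>"
        using lmod_hom_zero[OF f abelian_group_cong_struct[OF M.M.abelian_group_axioms]
          abelian_group_cong_struct[OF N.M.abelian_group_axioms]] by simp
      then show ?thesis using x0 by (simp add: N.G.component_zero)
    qed
  qed
  then have "{d. hom_part M N d f \<noteq> (\<lambda>x\<in>carrier M. \<zero>\<^bsub>N\<^esub>)} \<subseteq> (\<lambda>(j, i). j - i) ` (J \<times> I)" by blast
  then show ?thesis using I(1) J(1) by (meson finite_SigmaI finite_imageI finite_subset)
qed

lemma hom_part_precompose:
  assumes M': "graded_lmod B M'" and M: "graded_lmod B M" and N: "graded_lmod B N"
    and f: "f \<in> lmod_hom B\<sigma> (F M) (F N)" and t: "t \<in> gr_hom B M' M"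
  shows "hom_part M' N d (compose (carrier M') f t) = compose (carrier M') (hom_part M N d f) t"
proof (rule hom_part_eqI[OF M' N])
  interpret M': graded_lmod B M' by (rule M')
  show "compose (carrier M') f t \<in> lmod_hom B\<sigma> (F M') (F N)"
    using lmod_hom_compose[OF left_module_F[OF M'] gr_hom_F[OF M' M t] f] by simp
  show "compose (carrier M') (hom_part M N d f) t \<in> gr_hom B M' (twist_shift B \<sigma> d N)"
    by (rule gr_hom_compose[OF M' t hom_part_gr_hom[OF M N f]])
  fix r x assume x: "x \<in> grade M' r"
  show "compose (carrier M') (hom_part M N d f) t x = component N (compose (carrier M') f t x) (r + d)"
    using x hom_part_homog[OF M N f gr_hom_grade[OF t x]] by (simp add: compose_def M'.G.grade_carrier)
qed

lemma hom_part_postcompose: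
  assumes M: "graded_lmod B M" and N: "graded_lmod B N" and N': "graded_lmod B N'"
    and f: "f \<in> lmod_hom B\<sigma> (F M) (F N)" and g: "g \<in> gr_hom B N N'"
  shows "hom_part M N' d (compose (carrier M) g f) = compose (carrier M) g (hom_part M N d f)"
proof (rule hom_part_eqI[OF M N'])
  interpret M: graded_lmod B M by (rule M)
  interpret N: graded_lmod B N by (rule N)
  note gh = gr_hom_lmod_hom[OF g]
  show "compose (carrier M) g f \<in> lmod_hom B\<sigma> (F M) (F N')"
    using lmod_hom_compose[OF left_module_F[OF M] f gr_hom_F[OF N N' g]] by simp
  have "g \<in> gr_hom B (twist_shift B \<sigma> d N) (twist_shift B \<sigma> d N')"
    using g lmod_hom_extensional[OF gh]
    by (auto simp: gr_hom_def lmod_hom_closed[OF gh] lmod_hom_add[OF gh] lmod_hom_smult[OF gh] intro!: lmod_homI)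
  then show "compose (carrier M) g (hom_part M N d f) \<in> gr_hom B M (twist_shift B \<sigma> d N')"
    by (rule gr_hom_compose[OF M hom_part_gr_hom[OF M N f]])
  fix r x assume x: "x \<in> grade M r"
  show "compose (carrier M) g (hom_part M N d f) x = component N' (compose (carrier M) g f x) (r + d)"
    using x gr_hom_component[OF N N' g F_hom_closed[OF M N f]]
    by (simp add: compose_def M.G.grade_carrier hom_part_homog[OF M N f])
qed

end

section \<open>The complex of homomorphisms out of a resolution\<close>

definition hom_complex ::
  "('k, 'b, 'x) module_scheme \<Rightarrow> ('b, 'u, 'm, 'w) resolution \<Rightarrow> ('b, 'n, 'z) module_scheme
    \<Rightarrow> nat \<Rightarrow> ('k, 'u \<Rightarrow> 'n) module"
  where "hom_complex R P N n = hom_module R (obj P n) N"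

definition hom_diff :: "('b, 'u, 'm, 'w) resolution \<Rightarrow> nat \<Rightarrow> ('u \<Rightarrow> 'n) \<Rightarrow> 'u \<Rightarrow> 'n"
  where "hom_diff P n f = compose (carrier (obj P (Suc n))) f (diff P n)"

lemma cochain_complex_hom:
  fixes P :: "('b, 'u, 'm, 'w) resolution"
  assumes R: "k_algebra K R" and P: "\<And>n. left_module R (obj P n)"
    and d: "\<And>n. diff P n \<in> lmod_hom R (obj P (Suc n)) (obj P n)"
    and dd: "\<And>n x. x \<in> carrier (obj P (Suc (Suc n))) \<Longrightarrow> diff P n (diff P (Suc n) x) = \<zero>\<^bsub>obj P n\<^esub>"
    and N: "left_module R N" and H: "\<And>n. H n \<subseteq> lmod_hom R (obj P n) N"
    and H0: "\<And>n. \<zero>\<^bsub>hom_complex R P N n\<^esub> \<in> H n"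
    and Ha: "\<And>n f g. \<lbrakk>f \<in> H n; g \<in> H n\<rbrakk> \<Longrightarrow> f \<oplus>\<^bsub>hom_complex R P N n\<^esub> g \<in> H n"
    and Hs: "\<And>n c f. \<lbrakk>c \<in> carrier K; f \<in> H n\<rbrakk> \<Longrightarrow> c \<odot>\<^bsub>hom_complex R P N n\<^esub> f \<in> H n"
    and Hd: "\<And>n f. f \<in> H n \<Longrightarrow> hom_diff P n f \<in> H (Suc n)"
  shows "cochain_complex K (\<lambda>n. (hom_complex R P N n)\<lparr>carrier := H n\<rparr>) (hom_diff P)"
proof (rule cochain_complex.intro)
  interpret N: left_module R N by fact
  note dcl = lmod_hom_closed[OF d]
  show "module K ((hom_complex R P N n)\<lparr>carrier := H n\<rparr>)" for n
    using module_hom_subspace[OF R P N H] H0 Ha Hs by (simp add: hom_complex_def)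
  fix n f assume f: "f \<in> carrier ((hom_complex R P N n)\<lparr>carrier := H n\<rparr>)"
  then have fH: "f \<in> H n" and fh: "f \<in> lmod_hom R (obj P n) N" using H by auto
  show "hom_diff P n f \<in> carrier ((hom_complex R P N (Suc n))\<lparr>carrier := H (Suc n)\<rparr>)" using Hd fH by simp
  show "hom_diff P (Suc n) (hom_diff P n f) = \<zero>\<^bsub>(hom_complex R P N (Suc (Suc n)))\<lparr>carrier := H (Suc (Suc n))\<rparr>\<^esub>"
    using dcl dd lmod_hom_zero[OF fh left_module_abelian_group[OF P] N.M.abelian_group_axioms]
    by (auto simp: hom_diff_def hom_complex_def hom_module_sel compose_def intro!: restrict_ext)
  show "hom_diff P n (f \<oplus>\<^bsub>(hom_complex R P N n)\<lparr>carrier := H n\<rparr>\<^esub> g) =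
     hom_diff P n f \<oplus>\<^bsub>(hom_complex R P N (Suc n))\<lparr>carrier := H (Suc n)\<rparr>\<^esub> hom_diff P n g" for g
    using dcl by (auto simp: hom_diff_def hom_complex_def hom_module_sel compose_def intro!: restrict_ext)
  show "hom_diff P n (c \<odot>\<^bsub>(hom_complex R P N n)\<lparr>carrier := H n\<rparr>\<^esub> f) =
     c \<odot>\<^bsub>(hom_complex R P N (Suc n))\<lparr>carrier := H (Suc n)\<rparr>\<^esub> hom_diff P n f" for c
    using dcl by (auto simp: hom_diff_def hom_complex_def hom_module_sel compose_def intro!: restrict_ext)
qed

lemma cochain_complex_projective:
  assumes R: "k_algebra K R" and P: "projective_resolution R M P" and N: "left_module R N"
  shows "cochain_complex K (hom_complex R P N) (hom_diff P)"
proof -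
  note pP = projective_resolutionD[OF P]
  note hc = hom_module_closed[OF R pP(5) N]
  have "cochain_complex K (\<lambda>n. (hom_complex R P N n)\<lparr>carrier := lmod_hom R (obj P n) N\<rparr>) (hom_diff P)"
    by (rule cochain_complex_hom[OF R pP(5) pP(2) exact_resolutionD(5)[OF pP(4)] N order_refl])
      (auto simp: hom_complex_def hom_diff_def hc intro: lmod_hom_compose[OF pP(5) pP(2)])
  moreover have "(hom_complex R P N n)\<lparr>carrier := lmod_hom R (obj P n) N\<rparr> = hom_complex R P N n" for n
    by (simp add: hom_complex_def hom_module_def)
  ultimately show ?thesis by simp
qed

lemma is_chain_lift_compose:
  assumes \<phi>: "is_chain_lift (\<lambda>n. H n) P'' P' h' \<phi>" and \<psi>: "is_chain_lift (\<lambda>n. H' n) P' P h \<psi>"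
    and H: "\<And>n f g. \<lbrakk>f \<in> H n; g \<in> H' n\<rbrakk> \<Longrightarrow> compose (carrier (obj P'' n)) g f \<in> H'' n"
    and cl: "\<And>n f x. \<lbrakk>f \<in> H n; x \<in> carrier (obj P'' n)\<rbrakk> \<Longrightarrow> f x \<in> carrier (obj P' n)"
    and d: "\<And>n x. x \<in> carrier (obj P'' (Suc n)) \<Longrightarrow> diff P'' n x \<in> carrier (obj P'' n)"
    and h'': "\<And>x. x \<in> carrier (obj P'' 0) \<Longrightarrow> h'' (aug P'' x) = h (h' (aug P'' x))"
  shows "is_chain_lift H'' P'' P h'' (\<lambda>n. compose (carrier (obj P'' n)) (\<psi> n) (\<phi> n))"
  unfolding is_chain_lift_def
proof (intro conjI allI ballI)
  show "compose (carrier (obj P'' n)) (\<psi> n) (\<phi> n) \<in> H'' n" for n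
    by (rule H[OF is_chain_liftD(1)[OF \<phi>] is_chain_liftD(1)[OF \<psi>]])
qed (use is_chain_liftD[OF \<phi>] is_chain_liftD[OF \<psi>] cl[OF is_chain_liftD(1)[OF \<phi>]] d h''
  in \<open>auto simp: compose_def\<close>)

lemma precompose_chain_map:
  assumes P': "\<And>n. left_module R (obj P' n)" and d': "\<And>n. diff P' n \<in> lmod_hom R (obj P' (Suc n)) (obj P' n)"
    and \<phi>: "is_chain_lift (\<lambda>n. lmod_hom R (obj P' n) (obj P n)) P' P h \<phi>"
    and f: "f \<in> lmod_hom R (obj P n) N"
  shows "hom_diff P' n (compose (carrier (obj P' n)) f (\<phi> n)) =
     compose (carrier (obj P' (Suc n))) (hom_diff P n f) (\<phi> (Suc n))"
  using is_chain_liftD(3)[OF \<phi>] lmod_hom_closed[OF is_chain_liftD(1)[OF \<phi>]] lmod_hom_closed[OF d']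
  by (auto simp: hom_diff_def compose_def intro!: restrict_ext)

lemma hom_complex_carrier: "(\<lambda>n. (hom_complex R P N n)\<lparr>carrier := lmod_hom R (obj P n) N\<rparr>) = hom_complex R P N"
  by (simp add: hom_complex_def hom_module_def fun_eq_iff)

text \<open>The sets \<open>H n\<close> and \<open>H' n\<close> of admissible cochains cover the complexes of degree-preserving maps, too.\<close>

lemma precompose_coboundary_sub:
  assumes cl: "\<And>n x. x \<in> carrier (obj P' n) \<Longrightarrow> \<phi> n x \<in> carrier (obj P n)"
    and d'cl: "\<And>n x. x \<in> carrier (obj P' (Suc n)) \<Longrightarrow> diff P' n x \<in> carrier (obj P' n)"
    and com: "\<And>n x. x \<in> carrier (obj P' (Suc n)) \<Longrightarrow> diff P n (\<phi> (Suc n) x) = \<phi> n (diff P' n x)"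
    and H: "\<And>n u. u \<in> H n \<Longrightarrow> compose (carrier (obj P' n)) u (\<phi> n) \<in> H' n"
    and f: "f \<in> coboundaries (\<lambda>n. (hom_complex R P N n)\<lparr>carrier := H n\<rparr>) (hom_diff P) n"
  shows "compose (carrier (obj P' n)) f (\<phi> n) \<in> coboundaries (\<lambda>n. (hom_complex R P' N n)\<lparr>carrier := H' n\<rparr>) (hom_diff P') n"
proof (cases n)
  case 0
  then show ?thesis using f cl
    by (auto simp: coboundaries_def hom_complex_def hom_module_sel compose_def intro!: restrict_ext)
next
  case (Suc m)
  then obtain u where u: "u \<in> H m" "f = hom_diff P m u"
    using f by (auto simp: coboundaries_def)
  have "compose (carrier (obj P' n)) f (\<phi> n) = hom_diff P' m (compose (carrier (obj P' m)) u (\<phi> m))"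
    using cl d'cl com by (auto simp: Suc u(2) hom_diff_def compose_def intro!: restrict_ext)
  then show ?thesis using H[OF u(1)] by (auto simp: Suc coboundaries_def)
qed

lemma precompose_coboundary:
  assumes P': "\<And>n. left_module R (obj P' n)" and d': "\<And>n. diff P' n \<in> lmod_hom R (obj P' (Suc n)) (obj P' n)"
    and \<phi>: "is_chain_lift (\<lambda>n. lmod_hom R (obj P' n) (obj P n)) P' P h \<phi>"
    and f: "f \<in> coboundaries (hom_complex R P N) (hom_diff P) n"
  shows "compose (carrier (obj P' n)) f (\<phi> n) \<in> coboundaries (hom_complex R P' N) (hom_diff P') n"
  using precompose_coboundary_sub[of P' \<phi> P "\<lambda>n. lmod_hom R (obj P n) N" "\<lambda>n. lmod_hom R (obj P' n) N" f R N n,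
      unfolded hom_complex_carrier] f
    lmod_hom_closed[OF is_chain_liftD(1)[OF \<phi>]] lmod_hom_closed[OF d'] is_chain_liftD(3)[OF \<phi>]
    lmod_hom_compose[OF P' is_chain_liftD(1)[OF \<phi>]]
  by blast

text \<open>If \<open>s\<close> is a homotopy from \<open>\<psi>\<close> to \<open>\<phi>\<close>, then \<open>f \<phi> - f \<psi> = f d s + f s d'\<close>.  The first summand is zero for a
  cocycle \<open>f\<close>, and the second is the coboundary of \<open>f s\<close>; in degree \<open>0\<close> it is absent.\<close>

lemma homotopic_precompose:
  fixes P P' :: "('b, 'm) mod_res" and M M' :: "('b, 'm, 'y) module_scheme"
  assumes P': "projective_resolution R M' P'" and P: "projective_resolution R M P"
    and M': "left_module R M'" and M: "left_module R M" and N: "left_module R N"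
    and \<phi>: "is_chain_lift (\<lambda>n. lmod_hom R (obj P' n) (obj P n)) P' P h \<phi>"
    and \<psi>: "is_chain_lift (\<lambda>n. lmod_hom R (obj P' n) (obj P n)) P' P h \<psi>"
    and f: "f \<in> cocycles (hom_complex R P N) (hom_diff P) n"
  shows "\<exists>w\<in>coboundaries (hom_complex R P' N) (hom_diff P') n.
    compose (carrier (obj P' n)) f (\<phi> n) = w \<oplus>\<^bsub>hom_complex R P' N n\<^esub> compose (carrier (obj P' n)) f (\<psi> n)"
proof -
  interpret N: left_module R N by fact
  note pP = projective_resolutionD[OF P] and pP' = projective_resolutionD[OF P']
  have fh: "f \<in> lmod_hom R (obj P n) N" and fd: "hom_diff P n f = (\<lambda>m\<in>carrier (obj P (Suc n)). \<zero>\<^bsub>N\<^esub>)"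
    using f by (auto simp: cocycles_def hom_complex_def hom_module_sel)
  have fd0: "f (diff P n x) = \<zero>\<^bsub>N\<^esub>" if "x \<in> carrier (obj P (Suc n))" for x
    using fun_cong[OF fd, of x] that by (simp add: hom_diff_def compose_def)
  obtain s where s: "\<And>n. s n \<in> lmod_hom R (obj P' n) (obj P (Suc n))"
    "\<And>p. p\<in>carrier (obj P' 0) \<Longrightarrow> \<phi> 0 p = \<psi> 0 p \<oplus>\<^bsub>obj P 0\<^esub> diff P 0 (s 0 p)"
    "\<And>n p. p\<in>carrier (obj P' (Suc n)) \<Longrightarrow> \<phi> (Suc n) p
       = \<psi> (Suc n) p \<oplus>\<^bsub>obj P (Suc n)\<^esub> diff P (Suc n) (s (Suc n) p) \<oplus>\<^bsub>obj P (Suc n)\<^esub> s n (diff P' n p)"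
    using projective_homotopy[OF P' P M' M \<phi> \<psi>] by blast
  note cl = lmod_hom_closed[OF s(1)] lmod_hom_closed[OF is_chain_liftD(1)[OF \<psi>]] lmod_hom_closed[OF pP(2)]
     lmod_hom_closed[OF pP'(2)] lmod_hom_closed[OF fh]
  have ag: "abelian_group (obj P n)" for n by (rule left_module_abelian_group[OF pP(5)])
  have dcl: "diff P n (s n p) \<in> carrier (obj P n)" if "p \<in> carrier (obj P' n)" for n p
    using cl that by blast
  show ?thesis
  proof (cases n)
    case 0
    have "compose (carrier (obj P' n)) f (\<phi> n) = \<zero>\<^bsub>hom_complex R P' N n\<^esub> \<oplus>\<^bsub>hom_complex R P' N n\<^esub> compose (carrier (obj P' n)) f (\<psi> n)"
      using s(2) fd0 cl dcl lmod_hom_add[OF fh] unfolding 0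
      by (auto simp: hom_complex_def hom_module_sel compose_def intro!: restrict_ext)
    then show ?thesis by (auto simp: coboundaries_def 0)
  next
    case (Suc m)
    let ?u = "compose (carrier (obj P' m)) f (s m)"
    have u: "?u \<in> lmod_hom R (obj P' m) N"
      using lmod_hom_compose[OF pP'(5) s(1)] fh by (simp add: Suc)
    have "f (\<phi> (Suc m) x) = f (s m (diff P' m x)) \<oplus>\<^bsub>N\<^esub> f (\<psi> (Suc m) x)" if x: "x \<in> carrier (obj P' (Suc m))" for x
    proof -
      interpret Pn: abelian_group "obj P (Suc m)" by (rule ag)
      note c = cl(2)[OF x] dcl[OF x] cl(1)[OF cl(4)[OF x]]
      have "f (\<phi> (Suc m) x) = (f (\<psi> (Suc m) x) \<oplus>\<^bsub>N\<^esub> f (diff P (Suc m) (s (Suc m) x))) \<oplus>\<^bsub>N\<^esub> f (s m (diff P' m x))"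
        using lmod_hom_add[OF fh[unfolded Suc]] c by (simp add: s(3)[OF x])
      then show ?thesis using fd0[unfolded Suc] cl(1)[OF x] cl(5)[unfolded Suc] c by (simp add: N.M.a_comm)
    qed
    then have "compose (carrier (obj P' n)) f (\<phi> n) = hom_diff P' m ?u \<oplus>\<^bsub>hom_complex R P' N n\<^esub> compose (carrier (obj P' n)) f (\<psi> n)"
      using cl(4) by (auto simp: Suc hom_complex_def hom_module_sel hom_diff_def compose_def intro!: restrict_ext)
    moreover have "hom_diff P' m ?u \<in> coboundaries (hom_complex R P' N) (hom_diff P') n"
      using u by (auto simp: Suc coboundaries_def hom_complex_def hom_module_sel)
    ultimately show ?thesis by blast
  qed
qed

lemma precompose_cocycle:
  assumes P': "\<And>n. left_module R (obj P' n)" and d': "\<And>n. diff P' n \<in> lmod_hom R (obj P' (Suc n)) (obj P' n)"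
    and \<phi>: "is_chain_lift (\<lambda>n. lmod_hom R (obj P' n) (obj P n)) P' P h \<phi>"
    and f: "f \<in> cocycles (hom_complex R P N) (hom_diff P) n"
  shows "compose (carrier (obj P' n)) f (\<phi> n) \<in> cocycles (hom_complex R P' N) (hom_diff P') n"
proof -
  have fh: "f \<in> lmod_hom R (obj P n) N" and fd: "hom_diff P n f = (\<lambda>m\<in>carrier (obj P (Suc n)). \<zero>\<^bsub>N\<^esub>)"
    using f by (auto simp: cocycles_def hom_complex_def hom_module_sel)
  have "compose (carrier (obj P' n)) f (\<phi> n) \<in> lmod_hom R (obj P' n) N"
    by (rule lmod_hom_compose[OF P' is_chain_liftD(1)[OF \<phi>] fh])
  moreover have "hom_diff P' n (compose (carrier (obj P' n)) f (\<phi> n)) = (\<lambda>m\<in>carrier (obj P' (Suc n)). \<zero>\<^bsub>N\<^esub>)"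
    unfolding precompose_chain_map[OF P' d' \<phi> fh] fd
    using lmod_hom_closed[OF is_chain_liftD(1)[OF \<phi>]] by (auto simp: compose_def intro!: restrict_ext)
  ultimately show ?thesis by (simp add: cocycles_def hom_complex_def hom_module_sel)
qed

lemma postcompose_coboundary_sub:
  assumes dcl: "\<And>n x. x \<in> carrier (obj P (Suc n)) \<Longrightarrow> diff P n x \<in> carrier (obj P n)"
    and g0: "g \<zero>\<^bsub>N\<^esub> = \<zero>\<^bsub>N'\<^esub>"
    and H: "\<And>n u. u \<in> H n \<Longrightarrow> compose (carrier (obj P n)) g u \<in> H' n"
    and f: "f \<in> coboundaries (\<lambda>n. (hom_complex R P N n)\<lparr>carrier := H n\<rparr>) (hom_diff P) n"
  shows "compose (carrier (obj P n)) g f \<in> coboundaries (\<lambda>n. (hom_complex R P N' n)\<lparr>carrier := H' n\<rparr>) (hom_diff P) n"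
proof (cases n)
  case 0
  then show ?thesis using f g0
    by (auto simp: coboundaries_def hom_complex_def hom_module_sel compose_def intro!: restrict_ext)
next
  case (Suc m)
  then obtain u where u: "u \<in> H m" "f = hom_diff P m u"
    using f by (auto simp: coboundaries_def)
  have "compose (carrier (obj P n)) g f = hom_diff P m (compose (carrier (obj P m)) g u)"
    using dcl by (auto simp: Suc u(2) hom_diff_def compose_def intro!: restrict_ext)
  then show ?thesis using H[OF u(1)] by (auto simp: Suc coboundaries_def)
qed

context twist
begin

abbreviation "gres M \<equiv> the_gr_res K B M"
abbreviation "ures M \<equiv> the_res B\<sigma> (F M)"
abbreviation "ts \<equiv> twist_shift B \<sigma>"

text \<open>Three complexes have to be compared: \<open>u_complex\<close>, which defines Ext over \<open>B\<^sup>\<sigma>\<close> by the chosen resolution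
  of \<open>F\<^sub>\<sigma> M\<close>; \<open>F_complex\<close>, which uses \<open>F\<^sub>\<sigma>\<close> of the chosen graded resolution of \<open>M\<close> instead; and, for each \<open>d\<close>,
  \<open>gr_complex\<close>, which defines Ext of graded modules from \<open>M\<close> to the twisted shift of \<open>N\<close> by \<open>d\<close>.\<close>

abbreviation "u_complex M N \<equiv> hom_complex B\<sigma> (ures M) (F N)"
abbreviation "u_cocycles M N \<equiv> cocycles (u_complex M N) (hom_diff (ures M))"
abbreviation "u_coboundaries M N \<equiv> coboundaries (u_complex M N) (hom_diff (ures M))"
abbreviation "u_class M N \<equiv> cohomology_class (u_complex M N) (hom_diff (ures M))"

abbreviation "F_complex M N \<equiv> hom_complex B\<sigma> (F_res (gres M)) (F N)"
abbreviation "F_cocycles M N \<equiv> cocycles (F_complex M N) (hom_diff (gres M))"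
abbreviation "F_coboundaries M N \<equiv> coboundaries (F_complex M N) (hom_diff (gres M))"

definition gr_complex where
  "gr_complex M N d = (\<lambda>n. (hom_complex B (gres M) (ts d N) n)\<lparr>carrier := gr_hom B (obj (gres M) n) (ts d N)\<rparr>)"

abbreviation "gr_cocycles M N d \<equiv> cocycles (gr_complex M N d) (hom_diff (gres M))"
abbreviation "gr_coboundaries M N d \<equiv> coboundaries (gr_complex M N d) (hom_diff (gres M))"
abbreviation "gr_class M N d \<equiv> cohomology_class (gr_complex M N d) (hom_diff (gres M))"

definition to_res :: "('b, 'm, 'y) graded_module_scheme \<Rightarrow> nat \<Rightarrow> (nat \<Rightarrow> 'b) \<Rightarrow> (nat \<Rightarrow> 'b)"
  where "to_res M = chain_lift (\<lambda>n. lmod_hom B\<sigma> (obj (F_res (gres M)) n) (obj (ures M) n))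
    (F_res (gres M)) (ures M) (\<lambda>x\<in>carrier M. x)"

lemma id_F_hom: "graded_lmod B M \<Longrightarrow> (\<lambda>x\<in>carrier M. x) \<in> lmod_hom B\<sigma> (F M) (F M)"
  using graded_lmod.id_gr_hom[OF graded_lmod_F[of M], THEN gr_hom_lmod_hom] by simp

lemma gres_proj: "gr_obj K B M \<Longrightarrow> projective_resolution B\<sigma> (F M) (F_res (gres M))"
  by (rule projective_resolution_F[OF gr_obj_lmod the_gr_res])

lemma to_res:
  assumes M: "gr_obj K B M"
  shows "is_chain_lift (\<lambda>n. lmod_hom B\<sigma> (obj (F_res (gres M)) n) (obj (ures M) n))
    (F_res (gres M)) (ures M) (\<lambda>x\<in>carrier M. x) (to_res M)"
proof -
  note lM = gr_obj_lmod[OF M]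
  obtain \<phi> where "is_chain_lift (\<lambda>n. lmod_hom B\<sigma> (obj (F_res (gres M)) n) (obj (ures M) n))
    (F_res (gres M)) (ures M) (\<lambda>x\<in>carrier M. x) \<phi>"
    using projective_chain_lift_exists[OF gres_proj[OF M] the_res_F[OF M] left_module_F[OF lM] left_module_F[OF lM]
      id_F_hom[OF lM]] by blast
  then show ?thesis unfolding to_res_def by (rule is_chain_lift_chain_lift)
qed

lemma from_res_exists:
  assumes M: "gr_obj K B M"
  shows "\<exists>\<beta>. is_chain_lift (\<lambda>n. lmod_hom B\<sigma> (obj (ures M) n) (obj (F_res (gres M)) n))
    (ures M) (F_res (gres M)) (\<lambda>x\<in>carrier M. x) \<beta>"
proof -
  note lM = gr_obj_lmod[OF M]
  show ?thesis
    using projective_chain_lift_exists[OF the_res_F[OF M] gres_proj[OF M] left_module_F[OF lM] left_module_F[OF lM]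
      id_F_hom[OF lM]] by blast
qed

lemma ext_complex_eq:
  "ext_cochains B\<sigma> (F M) (F N) = u_complex M N" "ext_diff B\<sigma> (F M) = hom_diff (ures M)"
  "gr_ext_cochains K B M (ts d N) = gr_complex M N d" "gr_ext_diff K B M = hom_diff (gres M)"
  by (simp_all add: fun_eq_iff ext_cochains_def hom_complex_def ext_diff_def hom_diff_def gr_ext_cochains_def
     gr_complex_def gr_ext_diff_def gr_hom_module_def)

lemma cochain_complex_ures:
  assumes M: "gr_obj K B M" and N: "gr_obj K B N"
  shows "cochain_complex K (u_complex M N) (hom_diff (ures M))"
  by (rule cochain_complex_projective[OF k_algebra_Bs the_res_F[OF M] left_module_F[OF gr_obj_lmod[OF N]]])

lemma cochain_complex_Fgres:
  assumes M: "gr_obj K B M" and N: "gr_obj K B N"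
  shows "cochain_complex K (F_complex M N) (hom_diff (gres M))"
proof -
  have "(hom_diff (F_res (gres M)) :: nat \<Rightarrow> ((nat \<Rightarrow> 'b) \<Rightarrow> 'd) \<Rightarrow> _) = hom_diff (gres M)"
    by (simp add: hom_diff_def fun_eq_iff)
  then show ?thesis
    using cochain_complex_projective[OF k_algebra_Bs gres_proj[OF M] left_module_F[OF gr_obj_lmod[OF N]]] by simp
qed

lemma hom_diff_F_res: "hom_diff (F_res P) = hom_diff P"
  by (simp add: hom_diff_def fun_eq_iff)

lemma cochain_complex_gr:
  assumes M: "gr_obj K B M" and N: "gr_obj K B N"
  shows "cochain_complex K (gr_complex M N d) (hom_diff (gres M))"
  unfolding gr_complex_def
proof -
  note pP = gr_projective_resolutionD[OF the_gr_res[OF M]]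
  note lN = gr_obj_lmod[OF N]
  interpret N: graded_lmod B N by (rule lN)
  have lP: "left_module B (obj (gres M) n)" for n using pP(5) by (rule graded_lmod.axioms(1))
  have gc: "x \<in> carrier (obj (gres M) n)" if "x \<in> grade (obj (gres M) n) i" for x n i
    using graded_group.grade_carrier[OF _ that] pP(5)[of n] graded_lmod.axioms(1)
    by (meson graded_lmod.M_grading graded_group_axioms.intro graded_group.intro left_module_abelian_group)
  note lt = left_module_twist_shift[OF N.left_module_axioms, of d]
  note hc = hom_module_closed[OF A.k_algebra_axioms lP lt]
  show "cochain_complex K (\<lambda>n. (hom_complex B (gres M) (ts d N) n)\<lparr>carrier := gr_hom B (obj (gres M) n) (ts d N)\<rparr>) (hom_diff (gres M))"
  proof (rule cochain_complex_hom[OF A.k_algebra_axioms lP gr_hom_lmod_hom[OF pP(2)] exact_resolutionD(5)[OF pP(4)] lt])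
    show "gr_hom B (obj (gres M) n) (ts d N) \<subseteq> lmod_hom B (obj (gres M) n) (ts d N)" for n
      using gr_hom_lmod_hom by blast
    show "\<zero>\<^bsub>hom_complex B (gres M) (ts d N) n\<^esub> \<in> gr_hom B (obj (gres M) n) (ts d N)" for n
      using zero_gr_hom[OF pP(5) lN] by (simp add: hom_complex_def hom_module_sel)
    show "f \<oplus>\<^bsub>hom_complex B (gres M) (ts d N) n\<^esub> g \<in> gr_hom B (obj (gres M) n) (ts d N)"
      if f: "f \<in> gr_hom B (obj (gres M) n) (ts d N)" and g: "g \<in> gr_hom B (obj (gres M) n) (ts d N)" for f g n
      using hc(2)[OF gr_hom_lmod_hom[OF f] gr_hom_lmod_hom[OF g]] gr_hom_grade[OF f] gr_hom_grade[OF g] gc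
      by (auto simp: hom_complex_def hom_module_sel gr_hom_def N.G.grade_add)
    show "c \<odot>\<^bsub>hom_complex B (gres M) (ts d N) n\<^esub> f \<in> gr_hom B (obj (gres M) n) (ts d N)"
      if c: "c \<in> carrier K" and f: "f \<in> gr_hom B (obj (gres M) n) (ts d N)" for c f n
      using hc(3)[OF c gr_hom_lmod_hom[OF f]] gr_hom_grade[OF f] gc N.smult_grade[OF kone_grade[OF c]] c
      by (auto simp: hom_complex_def hom_module_sel gr_hom_def spow_kone)
    show "hom_diff (gres M) n f \<in> gr_hom B (obj (gres M) (Suc n)) (ts d N)"
      if f: "f \<in> gr_hom B (obj (gres M) n) (ts d N)" for f n
      unfolding hom_diff_def by (rule gr_hom_compose[OF pP(5) pP(2) f])
  qed
qed

section \<open>Taking homogeneous parts is a map of complexes\<close>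

context
  fixes M :: "('b, 'm, 'y) graded_module_scheme" and N :: "('b, 'n, 'z) graded_module_scheme"
  assumes M: "gr_obj K B M" and N: "gr_obj K B N"
begin

private lemma lM: "graded_lmod B M" by (rule gr_obj_lmod[OF M])
private lemma lN: "graded_lmod B N" by (rule gr_obj_lmod[OF N])
private lemmas pP = gr_projective_resolutionD[OF the_gr_res[OF M]]

lemma FC_sel:
  "carrier (F_complex M N n) = lmod_hom B\<sigma> (F (obj (gres M) n)) (F N)"
  "\<zero>\<^bsub>F_complex M N n\<^esub> = (\<lambda>x\<in>carrier (obj (gres M) n). \<zero>\<^bsub>N\<^esub>)"
  "f \<oplus>\<^bsub>F_complex M N n\<^esub> g = (\<lambda>x\<in>carrier (obj (gres M) n). f x \<oplus>\<^bsub>N\<^esub> g x)"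
  by (simp_all add: hom_complex_def hom_module_sel lmod_hom_F0)

lemma FC_smult:
  assumes "f \<in> lmod_hom B\<sigma> (F (obj (gres M) n)) (F N)" "c \<in> carrier K"
  shows "c \<odot>\<^bsub>F_complex M N n\<^esub> f = (\<lambda>x\<in>carrier (obj (gres M) n). (c \<odot>\<^bsub>B\<^esub> \<one>\<^bsub>B\<^esub>) \<odot>\<^bsub>N\<^esub> f x)"
  using lmod_hom_closed[OF assms(1)] assms(2)
  by (auto simp: hom_complex_def hom_module_sel F_smult_kone[OF lN] intro!: restrict_ext)

lemma gr_complex_sel:
  "carrier (gr_complex M N d n) = gr_hom B (obj (gres M) n) (ts d N)"
  "\<zero>\<^bsub>gr_complex M N d n\<^esub> = (\<lambda>x\<in>carrier (obj (gres M) n). \<zero>\<^bsub>N\<^esub>)"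
  "f \<oplus>\<^bsub>gr_complex M N d n\<^esub> g = (\<lambda>x\<in>carrier (obj (gres M) n). f x \<oplus>\<^bsub>N\<^esub> g x)"
  "c \<in> carrier K \<Longrightarrow> c \<odot>\<^bsub>gr_complex M N d n\<^esub> f = (\<lambda>x\<in>carrier (obj (gres M) n). (c \<odot>\<^bsub>B\<^esub> \<one>\<^bsub>B\<^esub>) \<odot>\<^bsub>N\<^esub> f x)"
  by (simp_all add: gr_complex_def hom_complex_def hom_module_sel spow_kone)

abbreviation (input) "part d n \<equiv> hom_part (obj (gres M) n) N d"

lemma part_closed: "f \<in> carrier (F_complex M N n) \<Longrightarrow> part d n f \<in> carrier (gr_complex M N d n)"
  unfolding FC_sel gr_complex_sel by (rule hom_part_gr_hom[OF pP(5) lN])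

lemma part_add: "\<lbrakk>f \<in> carrier (F_complex M N n); g \<in> carrier (F_complex M N n)\<rbrakk>
    \<Longrightarrow> part d n (f \<oplus>\<^bsub>F_complex M N n\<^esub> g) = part d n f \<oplus>\<^bsub>gr_complex M N d n\<^esub> part d n g"
  unfolding FC_sel gr_complex_sel by (rule hom_part_add[OF pP(5) lN])

lemma part_smult: "\<lbrakk>f \<in> carrier (F_complex M N n); c \<in> carrier K\<rbrakk>
    \<Longrightarrow> part d n (c \<odot>\<^bsub>F_complex M N n\<^esub> f) = c \<odot>\<^bsub>gr_complex M N d n\<^esub> part d n f"
  by (simp add: FC_smult FC_sel gr_complex_sel hom_part_smult[OF pP(5) lN])

lemma part_zero: "part d n \<zero>\<^bsub>F_complex M N n\<^esub> = \<zero>\<^bsub>gr_complex M N d n\<^esub>"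
  unfolding FC_sel gr_complex_sel by (rule hom_part_zero[OF pP(5) lN])

lemma part_diff:
  assumes "f \<in> carrier (F_complex M N n)"
  shows "part d (Suc n) (hom_diff (gres M) n f) = hom_diff (gres M) n (part d n f)"
  using hom_part_precompose[OF pP(5) pP(5) lN _ pP(2)] assms by (simp add: hom_diff_def FC_sel)

lemma part_cocycle:
  assumes "f \<in> F_cocycles M N n"
  shows "part d n f \<in> gr_cocycles M N d n"
  using assms part_diff[of f n d] part_closed[of f n d] part_zero[of "Suc n" d] by (auto simp: cocycles_def)

lemma part_coboundary:
  assumes "f \<in> F_coboundaries M N n"
  shows "part d n f \<in> gr_coboundaries M N d n"
proof (cases n)
  case 0 then show ?thesis using assms part_zero[of 0 d] by (simp add: coboundaries_def)
next
  case (Suc m)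
  then obtain u where u: "u \<in> carrier (F_complex M N m)" "f = hom_diff (gres M) m u" using assms by (auto simp: coboundaries_def)
  then show ?thesis using part_diff[OF u(1), of d] part_closed[OF u(1), of d] by (auto simp: coboundaries_def Suc)
qed

text \<open>Choose a primitive of every part, and the zero primitive wherever the part is zero.  Then almost all of
  them vanish, so they are the parts of one homomorphism, and this is a primitive of \<open>f\<close>.\<close>

lemma coboundary_if_parts:
  assumes f: "f \<in> carrier (F_complex M N n)"
    and parts: "\<And>d. part d n f \<in> gr_coboundaries M N d n"
  shows "f \<in> F_coboundaries M N n"
proof (cases n)
  case 0
  have "part d n f = part d n \<zero>\<^bsub>F_complex M N n\<^esub>" for d
    using parts[of d] part_zero[of 0 d] by (simp add: coboundaries_def 0)
  moreover have "\<zero>\<^bsub>F_complex M N n\<^esub> \<in> carrier (F_complex M N n)"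
    using cochain_complex.cocycles_closed(1,2)[OF cochain_complex_Fgres[OF M N]] by blast
  ultimately have "f = \<zero>\<^bsub>F_complex M N n\<^esub>"
    using f hom_parts_determine[OF pP(5) lN] unfolding FC_sel(1) by blast
  then show ?thesis by (simp add: coboundaries_def 0)
next
  case (Suc m)
  let ?z = "\<lambda>k. \<lambda>x\<in>carrier (obj (gres M) k). \<zero>\<^bsub>N\<^esub>"
  have "\<exists>u. u \<in> gr_hom B (obj (gres M) m) (ts d N) \<and> part d n f = hom_diff (gres M) m u \<and>
     (part d n f = ?z n \<longrightarrow> u = ?z m)" for d
  proof (cases "part d n f = ?z n")
    case True
    have "hom_diff (gres M) m (?z m) = ?z n"
      using lmod_hom_closed[OF gr_hom_lmod_hom[OF pP(2)]]
      by (auto simp: hom_diff_def compose_def Suc intro!: restrict_ext)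
    then show ?thesis using True zero_gr_hom[OF pP(5) lN] by (intro exI[of _ "?z m"]) simp
  next
    case False
    then show ?thesis using parts[of d] by (auto simp: coboundaries_def Suc gr_complex_sel)
  qed
  then obtain u where u: "\<And>d. u d \<in> gr_hom B (obj (gres M) m) (ts d N)"
    "\<And>d. part d n f = hom_diff (gres M) m (u d)" "\<And>d. part d n f = ?z n \<Longrightarrow> u d = ?z m" by metis
  have "{d. u d \<noteq> ?z m} \<subseteq> {d. part d n f \<noteq> ?z n}" using u(3) by blast
  moreover have "finite {d. part d n f \<noteq> ?z n}"
    using hom_part_finite[OF pP(6) N] f by (simp add: FC_sel)
  ultimately have "finite {d. u d \<noteq> ?z m}" by (rule finite_subset)
  from hom_parts_surjective[OF pP(5) lN this u(1)]
  obtain g where g: "g \<in> carrier (F_complex M N m)" "\<And>d. part d m g = u d" by (auto simp: FC_sel)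
  have dg: "hom_diff (gres M) m g \<in> carrier (F_complex M N n)"
    using cochain_complex.d_closed[OF cochain_complex_Fgres[OF M N] g(1)] by (simp add: Suc)
  have "part d n (hom_diff (gres M) m g) = part d n f" for d
    using part_diff[OF g(1), of d] u(2)[of d] g(2) by (simp add: Suc)
  then have "hom_diff (gres M) m g = f"
    using dg f hom_parts_determine[OF pP(5) lN] unfolding FC_sel(1) by blast
  then show ?thesis using g(1) by (auto simp: coboundaries_def Suc)
qed

end

end

section \<open>The comparison map\<close>

lemma is_chain_lift_id:
  assumes P: "projective_resolution R M P"
  shows "is_chain_lift (\<lambda>n. lmod_hom R (obj P n) (obj P n)) P P (\<lambda>x\<in>carrier M. x) (\<lambda>n. \<lambda>x\<in>carrier (obj P n). x)"
  unfolding is_chain_lift_def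
proof (intro conjI allI ballI)
  note pP = projective_resolutionD[OF P]
  show "(\<lambda>x\<in>carrier (obj P n). x) \<in> lmod_hom R (obj P n) (obj P n)" for n
    by (rule lmod_hom_restrictI[OF pP(5)]) auto
  show "aug P ((\<lambda>x\<in>carrier (obj P 0). x) p) = (\<lambda>x\<in>carrier M. x) (aug P p)" if "p \<in> carrier (obj P 0)" for p
    using that lmod_hom_closed[OF pP(3) that] by simp
  show "diff P n ((\<lambda>x\<in>carrier (obj P (Suc n)). x) p) = (\<lambda>x\<in>carrier (obj P n). x) (diff P n p)"
    if "p \<in> carrier (obj P (Suc n))" for n p
    using that lmod_hom_closed[OF pP(2) that] by simp
qed

lemma compose_assoc_on:
  "(\<And>x. x \<in> A \<Longrightarrow> h x \<in> C) \<Longrightarrow> compose A (compose C f g) h = compose A f (compose A g h)"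
  by (auto simp: compose_def intro!: restrict_ext)

lemma projective_is_chain_lift_compose:
  assumes P'': "projective_resolution R M'' P''"
    and \<phi>: "is_chain_lift (\<lambda>n. lmod_hom R (obj P'' n) (obj P' n)) P'' P' h' \<phi>"
    and \<psi>: "is_chain_lift (\<lambda>n. lmod_hom R (obj P' n) (obj P n)) P' P h \<psi>"
    and h'': "\<And>x. x \<in> carrier M'' \<Longrightarrow> h'' x = h (h' x)"
  shows "is_chain_lift (\<lambda>n. lmod_hom R (obj P'' n) (obj P n)) P'' P h'' (\<lambda>n. compose (carrier (obj P'' n)) (\<psi> n) (\<phi> n))"
proof -
  note pP = projective_resolutionD[OF P'']
  show ?thesis
    by (rule is_chain_lift_compose[OF \<phi> \<psi>])
      (auto intro: lmod_hom_compose[OF pP(5)] lmod_hom_closed[OF pP(2)]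
         h'' lmod_hom_closed[OF pP(3)] dest: lmod_hom_closed)
qed

context twist
begin

definition ext_part :: "('b, 'm, 'y) graded_module_scheme \<Rightarrow> ('b, 'n, 'z) graded_module_scheme
    \<Rightarrow> int \<Rightarrow> nat \<Rightarrow> ((nat \<Rightarrow> 'b) \<Rightarrow> 'n) \<Rightarrow> (nat \<Rightarrow> 'b) \<Rightarrow> 'n"
  where "ext_part M N d n f = hom_part (obj (gres M) n) N d (compose (carrier (obj (gres M) n)) f (to_res M n))"

context
  fixes M :: "('b, 'm, 'y) graded_module_scheme" and N :: "('b, 'n, 'z) graded_module_scheme"
  assumes M: "gr_obj K B M" and N: "gr_obj K B N"
begin

private lemmas pF = projective_resolutionD[OF gres_proj[OF M]]
private lemmas pU = projective_resolutionD[OF the_res_F[OF M]]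

abbreviation (input) "pull n f \<equiv> compose (carrier (obj (gres M) n)) f (to_res M n)"

interpretation EC: cochain_complex K "u_complex M N" "hom_diff (ures M)" by (rule cochain_complex_ures[OF M N])
interpretation FC: cochain_complex K "F_complex M N" "hom_diff (gres M)" by (rule cochain_complex_Fgres[OF M N])

private lemma lFM: "left_module B\<sigma> (F M)" by (rule left_module_F[OF gr_obj_lmod[OF M]])
private lemma lFN: "left_module B\<sigma> (F N)" by (rule left_module_F[OF gr_obj_lmod[OF N]])

private lemma to_res_closed: "x \<in> carrier (obj (gres M) n) \<Longrightarrow> to_res M n x \<in> carrier (obj (ures M) n)"
  using lmod_hom_closed[OF is_chain_liftD(1)[OF to_res[OF M]], of x n] by simp

lemma pull_closed: "f \<in> carrier (u_complex M N n) \<Longrightarrow> pull n f \<in> carrier (F_complex M N n)"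
  using lmod_hom_compose[OF pF(5) is_chain_liftD(1)[OF to_res[OF M]], of f n "F N"]
  by (simp add: hom_complex_def hom_module_sel)

lemma pull_add: "\<lbrakk>f \<in> carrier (u_complex M N n); g \<in> carrier (u_complex M N n)\<rbrakk> \<Longrightarrow> pull n (f \<oplus>\<^bsub>u_complex M N n\<^esub> g) = pull n f \<oplus>\<^bsub>F_complex M N n\<^esub> pull n g"
  using to_res_closed by (auto simp: hom_complex_def hom_module_sel compose_def intro!: restrict_ext)

lemma pull_smult: "\<lbrakk>f \<in> carrier (u_complex M N n); c \<in> carrier K\<rbrakk> \<Longrightarrow> pull n (c \<odot>\<^bsub>u_complex M N n\<^esub> f) = c \<odot>\<^bsub>F_complex M N n\<^esub> pull n f"
  using to_res_closed by (auto simp: hom_complex_def hom_module_sel compose_def intro!: restrict_ext)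

lemma pull_coboundary: "f \<in> u_coboundaries M N n \<Longrightarrow> pull n f \<in> F_coboundaries M N n"
  using precompose_coboundary[OF pF(5) pF(2) to_res[OF M], of f "F N" n] by (simp add: hom_diff_F_res)

lemma pull_cocycle: "f \<in> u_cocycles M N n \<Longrightarrow> pull n f \<in> F_cocycles M N n"
  using precompose_cocycle[OF pF(5) pF(2) to_res[OF M], of f "F N" n] by (simp add: hom_diff_F_res)

text \<open>Let \<open>\<beta>\<close> be a chain map in the opposite direction.  The composite of \<open>\<beta>\<close> and \<open>to_res\<close> is homotopic to the
  identity, so the pullback of \<open>f\<close> along it is cohomologous to \<open>f\<close>.  It is also the pullback along \<open>\<beta>\<close> of a
  coboundary.\<close>

lemma pull_reflects_coboundaries:
  assumes f: "f \<in> u_cocycles M N n" and pf: "pull n f \<in> F_coboundaries M N n"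
  shows "f \<in> u_coboundaries M N n"
proof -
  obtain \<beta> where \<beta>: "is_chain_lift (\<lambda>n. lmod_hom B\<sigma> (obj (ures M) n) (obj (F_res (gres M)) n))
    (ures M) (F_res (gres M)) (\<lambda>x\<in>carrier M. x) \<beta>" using from_res_exists[OF M] by blast
  have \<beta>cl: "\<beta> n x \<in> carrier (obj (gres M) n)" if "x \<in> carrier (obj (ures M) n)" for x
    using lmod_hom_closed[OF is_chain_liftD(1)[OF \<beta>] that] by simp
  have idl: "is_chain_lift (\<lambda>n. lmod_hom B\<sigma> (obj (ures M) n) (obj (ures M) n)) (ures M) (ures M)
      (\<lambda>x\<in>carrier M. x) (\<lambda>n. \<lambda>x\<in>carrier (obj (ures M) n). x)"
    using is_chain_lift_id[OF the_res_F[OF M]] by simp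
  have ab: "is_chain_lift (\<lambda>n. lmod_hom B\<sigma> (obj (ures M) n) (obj (ures M) n)) (ures M) (ures M)
      (\<lambda>x\<in>carrier M. x) (\<lambda>n. compose (carrier (obj (ures M) n)) (to_res M n) (\<beta> n))"
    by (rule projective_is_chain_lift_compose[OF the_res_F[OF M] \<beta> to_res[OF M]]) simp
  obtain w where w: "w \<in> u_coboundaries M N n"
    "compose (carrier (obj (ures M) n)) f (\<lambda>x\<in>carrier (obj (ures M) n). x) =
      w \<oplus>\<^bsub>u_complex M N n\<^esub> compose (carrier (obj (ures M) n)) f (compose (carrier (obj (ures M) n)) (to_res M n) (\<beta> n))"
    using homotopic_precompose[OF the_res_F[OF M] the_res_F[OF M] lFM lFM lFN idl ab f] by blast
  have fE: "f \<in> extensional (carrier (obj (ures M) n))"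
    using EC.cocycles_closed(1)[OF f] lmod_hom_extensional by (auto simp: hom_complex_def hom_module_sel)
  have "compose (carrier (obj (ures M) n)) f (\<lambda>x\<in>carrier (obj (ures M) n). x) = f"
    by (rule extensionalityI[OF _ fE]) (auto simp: compose_def)
  moreover have "compose (carrier (obj (ures M) n)) f (compose (carrier (obj (ures M) n)) (to_res M n) (\<beta> n)) =
      compose (carrier (obj (ures M) n)) (pull n f) (\<beta> n)"
    using \<beta>cl by (intro compose_assoc_on[symmetric])
  moreover have "compose (carrier (obj (ures M) n)) (pull n f) (\<beta> n) \<in> u_coboundaries M N n"
    using precompose_coboundary[OF pU(5) pU(2) \<beta>, of "pull n f" "F N" n] pf by (simp add: hom_diff_F_res)
  from EC.coboundaries_closed(3)[OF w(1) this]
  have "w \<oplus>\<^bsub>u_complex M N n\<^esub> compose (carrier (obj (ures M) n)) (pull n f) (\<beta> n) \<in> u_coboundaries M N n" .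
  ultimately show ?thesis using w(2) by simp
qed

text \<open>The pullback of \<open>v\<close> along a chain map \<open>\<beta>\<close> in the opposite direction has the required property, since the
  composite of \<open>to_res\<close> and \<open>\<beta>\<close> is homotopic to the identity.\<close>

lemma pull_surjective_on_classes:
  assumes v: "v \<in> F_cocycles M N n"
  shows "\<exists>f\<in>u_cocycles M N n. \<exists>w\<in>F_coboundaries M N n.
    pull n f = w \<oplus>\<^bsub>F_complex M N n\<^esub> v"
proof -
  obtain \<beta> where \<beta>: "is_chain_lift (\<lambda>n. lmod_hom B\<sigma> (obj (ures M) n) (obj (F_res (gres M)) n))
    (ures M) (F_res (gres M)) (\<lambda>x\<in>carrier M. x) \<beta>" using from_res_exists[OF M] by blast
  let ?P = "F_res (gres M)"
  have v': "v \<in> cocycles (F_complex M N) (hom_diff ?P) n" using v by (simp add: hom_diff_F_res)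
  have idl: "is_chain_lift (\<lambda>n. lmod_hom B\<sigma> (obj ?P n) (obj ?P n)) ?P ?P
      (\<lambda>x\<in>carrier M. x) (\<lambda>n. \<lambda>x\<in>carrier (obj ?P n). x)"
    using is_chain_lift_id[OF gres_proj[OF M]] by simp
  have ba: "is_chain_lift (\<lambda>n. lmod_hom B\<sigma> (obj ?P n) (obj ?P n)) ?P ?P
      (\<lambda>x\<in>carrier M. x) (\<lambda>n. compose (carrier (obj ?P n)) (\<beta> n) (to_res M n))"
    by (rule projective_is_chain_lift_compose[OF gres_proj[OF M] to_res[OF M] \<beta>]) simp
  obtain w where w: "w \<in> coboundaries (F_complex M N) (hom_diff ?P) n"
    "compose (carrier (obj ?P n)) v (compose (carrier (obj ?P n)) (\<beta> n) (to_res M n)) =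
      w \<oplus>\<^bsub>F_complex M N n\<^esub> compose (carrier (obj ?P n)) v (\<lambda>x\<in>carrier (obj ?P n). x)"
    using homotopic_precompose[OF gres_proj[OF M] gres_proj[OF M] lFM lFM lFN ba idl v'] by blast
  have vE: "v \<in> extensional (carrier (obj ?P n))"
    using FC.cocycles_closed(1)[OF v] by (auto simp: hom_complex_def hom_module_sel dest!: lmod_hom_extensional)
  have "compose (carrier (obj ?P n)) v (\<lambda>x\<in>carrier (obj ?P n). x) = v"
    by (rule extensionalityI[OF _ vE]) (auto simp: compose_def)
  moreover have "compose (carrier (obj ?P n)) v (compose (carrier (obj ?P n)) (\<beta> n) (to_res M n)) =
      pull n (compose (carrier (obj (ures M) n)) v (\<beta> n))"
    using to_res_closed compose_assoc_on[of "carrier (obj (gres M) n)" "to_res M n" "carrier (obj (ures M) n)" v "\<beta> n"]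
    by simp
  moreover have "compose (carrier (obj (ures M) n)) v (\<beta> n) \<in> u_cocycles M N n"
    by (rule precompose_cocycle[OF pU(5) pU(2) \<beta> v'])
  ultimately show ?thesis using w by (auto simp: hom_diff_F_res)
qed

lemma ext_part_closed: "f \<in> carrier (u_complex M N n) \<Longrightarrow> ext_part M N d n f \<in> carrier (gr_complex M N d n)"
  unfolding ext_part_def by (rule part_closed[OF M N pull_closed])

lemma ext_part_add: "\<lbrakk>f \<in> carrier (u_complex M N n); g \<in> carrier (u_complex M N n)\<rbrakk>
    \<Longrightarrow> ext_part M N d n (f \<oplus>\<^bsub>u_complex M N n\<^esub> g) = ext_part M N d n f \<oplus>\<^bsub>gr_complex M N d n\<^esub> ext_part M N d n g"
  unfolding ext_part_def by (simp only: pull_add part_add[OF M N] pull_closed)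

lemma ext_part_smult: "\<lbrakk>f \<in> carrier (u_complex M N n); c \<in> carrier K\<rbrakk>
    \<Longrightarrow> ext_part M N d n (c \<odot>\<^bsub>u_complex M N n\<^esub> f) = c \<odot>\<^bsub>gr_complex M N d n\<^esub> ext_part M N d n f"
  unfolding ext_part_def by (simp only: pull_smult part_smult[OF M N] pull_closed)

lemma ext_part_cocycle: "f \<in> u_cocycles M N n
    \<Longrightarrow> ext_part M N d n f \<in> gr_cocycles M N d n"
  unfolding ext_part_def by (rule part_cocycle[OF M N pull_cocycle])

lemma ext_part_coboundary: "f \<in> u_coboundaries M N n
    \<Longrightarrow> ext_part M N d n f \<in> gr_coboundaries M N d n"
  unfolding ext_part_def by (rule part_coboundary[OF M N pull_coboundary])

end

definition ext_iso :: "nat \<Rightarrow> ('b, 'm, 'y) graded_module_scheme \<Rightarrow> ('b, 'n, 'z) graded_module_scheme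
    \<Rightarrow> ((nat \<Rightarrow> 'b) \<Rightarrow> 'n) set \<Rightarrow> int \<Rightarrow> ((nat \<Rightarrow> 'b) \<Rightarrow> 'n) set"
  where "ext_iso n M N = (\<lambda>x\<in>carrier (Ext_F B \<sigma> n M N). \<lambda>d.
    cohomology_map (gr_complex M N d) (hom_diff (gres M)) n (ext_part M N d n) x)"

lemma Ext_F_eq: "Ext_F B \<sigma> n M N = cohomology (u_complex M N) (hom_diff (ures M)) n"
  by (simp add: Ext_F_def Ext_def ext_complex_eq)

lemma gr_Ext_eq: "gr_Ext K B n M (ts d N) = cohomology (gr_complex M N d) (hom_diff (gres M)) n"
  by (simp add: gr_Ext_def ext_complex_eq)

lemma ext_iso_class:
  assumes M: "gr_obj K B M" and N: "gr_obj K B N" and f: "f \<in> u_cocycles M N n"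
  shows "ext_iso n M N (u_class M N n f) d =
    gr_class M N d n (ext_part M N d n f)"
proof -
  interpret EC: cochain_complex K "u_complex M N" "hom_diff (ures M)"
    by (rule cochain_complex_ures[OF M N])
  have "cohomology_map (gr_complex M N d) (hom_diff (gres M)) n (ext_part M N d n)
      (u_class M N n f) =
    gr_class M N d n (ext_part M N d n f)"
    by (rule cohomology_map_class[OF EC.cochain_complex_axioms cochain_complex_gr[OF M N] EC.cocycles_closed(1)[OF f]])
      (use ext_part_closed[OF M N] ext_part_add[OF M N] ext_part_coboundary[OF M N] in blast)+
  moreover have "u_class M N n f \<in> carrier (Ext_F B \<sigma> n M N)"
    using f by (simp add: Ext_F_eq EC.cohomology_carrier)
  ultimately show ?thesis by (simp add: ext_iso_def)
qed

lemma sum_gr_Ext_sel: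
  "carrier (sum_gr_Ext K B \<sigma> n M N) = {s. (\<forall>d. s d \<in> carrier (gr_Ext K B n M (ts d N))) \<and>
     finite {d. s d \<noteq> \<zero>\<^bsub>gr_Ext K B n M (ts d N)\<^esub>}}"
  "s \<oplus>\<^bsub>sum_gr_Ext K B \<sigma> n M N\<^esub> t = (\<lambda>d. s d \<oplus>\<^bsub>gr_Ext K B n M (ts d N)\<^esub> t d)"
  "c \<odot>\<^bsub>sum_gr_Ext K B \<sigma> n M N\<^esub> s = (\<lambda>d. c \<odot>\<^bsub>gr_Ext K B n M (ts d N)\<^esub> s d)"
  by (simp_all add: sum_gr_Ext_def direct_sum_def)

lemma ext_iso_hom:
  assumes M: "gr_obj K B M" and N: "gr_obj K B N"
  shows "ext_iso n M N \<in> lmod_hom K (Ext_F B \<sigma> n M N) (sum_gr_Ext K B \<sigma> n M N)"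
proof (rule lmod_homI)
  interpret EC: cochain_complex K "u_complex M N" "hom_diff (ures M)"
    by (rule cochain_complex_ures[OF M N])
  interpret G: cochain_complex K "gr_complex M N d" "hom_diff (gres M)" for d
    by (rule cochain_complex_gr[OF M N])
  interpret Em: module K "u_complex M N n" by (rule EC.C_module)
  let ?c = "u_class M N n"
  note pP = gr_projective_resolutionD[OF the_gr_res[OF M]]
  note cl = ext_iso_class[OF M N]
  show "ext_iso n M N \<in> extensional (carrier (Ext_F B \<sigma> n M N))" by (simp add: ext_iso_def)
  fix x assume "x \<in> carrier (Ext_F B \<sigma> n M N)"
  then obtain f where f: "f \<in> u_cocycles M N n" "x = ?c f"
    by (auto simp: Ext_F_eq EC.cohomology_carrier)
  have fc: "f \<in> carrier (u_complex M N n)" by (rule EC.cocycles_closed(1)[OF f(1)])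
  have "{d. ext_iso n M N x d \<noteq> \<zero>\<^bsub>gr_Ext K B n M (ts d N)\<^esub>} \<subseteq>
     {d. ext_part M N d n f \<noteq> \<zero>\<^bsub>gr_complex M N d n\<^esub>}"
    using cl[OF f(1)] by (auto simp: f(2) gr_Ext_eq G.cohomology_zero)
  moreover have "finite {d. ext_part M N d n f \<noteq> \<zero>\<^bsub>gr_complex M N d n\<^esub>}"
    using hom_part_finite[OF pP(6) N] pull_closed[OF M N fc]
    by (simp add: ext_part_def gr_complex_sel[OF M N] FC_sel[OF M N])
  ultimately have "finite {d. ext_iso n M N x d \<noteq> \<zero>\<^bsub>gr_Ext K B n M (ts d N)\<^esub>}" by (rule finite_subset)
  then show "ext_iso n M N x \<in> carrier (sum_gr_Ext K B \<sigma> n M N)"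
    using ext_part_cocycle[OF M N f(1)] by (simp add: sum_gr_Ext_sel) (simp add: f(2) cl[OF f(1)] gr_Ext_eq G.cohomology_carrier)
  show "ext_iso n M N (c \<odot>\<^bsub>Ext_F B \<sigma> n M N\<^esub> x) = c \<odot>\<^bsub>sum_gr_Ext K B \<sigma> n M N\<^esub> ext_iso n M N x"
    if c: "c \<in> carrier K" for c
    using cl[OF f(1)] cl[OF EC.cocycles_closed(4)[OF c f(1)]] ext_part_closed[OF M N fc]
    by (simp add: fun_eq_iff sum_gr_Ext_sel gr_Ext_eq Ext_F_eq f(2) EC.cohomology_class_smult[OF fc c]
       G.cohomology_class_smult c ext_part_smult[OF M N fc c])
  fix y assume "y \<in> carrier (Ext_F B \<sigma> n M N)"
  then obtain g where g: "g \<in> u_cocycles M N n" "y = ?c g"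
    by (auto simp: Ext_F_eq EC.cohomology_carrier)
  have gc: "g \<in> carrier (u_complex M N n)" by (rule EC.cocycles_closed(1)[OF g(1)])
  show "ext_iso n M N (x \<oplus>\<^bsub>Ext_F B \<sigma> n M N\<^esub> y) = ext_iso n M N x \<oplus>\<^bsub>sum_gr_Ext K B \<sigma> n M N\<^esub> ext_iso n M N y"
    using cl[OF f(1)] cl[OF g(1)] cl[OF EC.cocycles_closed(3)[OF f(1) g(1)]] ext_part_closed[OF M N fc] ext_part_closed[OF M N gc]
    by (simp add: fun_eq_iff sum_gr_Ext_sel gr_Ext_eq Ext_F_eq f(2) g(2) EC.cohomology_class_add[OF fc gc]
       G.cohomology_class_add ext_part_add[OF M N fc gc])
qed

lemma ext_iso_bij:
  assumes M: "gr_obj K B M" and N: "gr_obj K B N"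
  shows "bij_betw (ext_iso n M N) (carrier (Ext_F B \<sigma> n M N)) (carrier (sum_gr_Ext K B \<sigma> n M N))"
proof -
  interpret EC: cochain_complex K "u_complex M N" "hom_diff (ures M)"
    by (rule cochain_complex_ures[OF M N])
  interpret FC: cochain_complex K "F_complex M N" "hom_diff (gres M)"
    by (rule cochain_complex_Fgres[OF M N])
  interpret G: cochain_complex K "gr_complex M N d" "hom_diff (gres M)" for d
    by (rule cochain_complex_gr[OF M N])
  interpret Em: module K "u_complex M N n" by (rule EC.C_module)
  interpret Gm: module K "gr_complex M N d n" for d by (rule G.C_module)
  let ?E = "u_complex M N"
  let ?FC = "F_complex M N"
  let ?c = "cohomology_class ?E (hom_diff (ures M)) n"
  note pP = gr_projective_resolutionD[OF the_gr_res[OF M]]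
  note lN = gr_obj_lmod[OF N]
  note cl = ext_iso_class[OF M N]
  have "inj_on (ext_iso n M N) (carrier (Ext_F B \<sigma> n M N))"
  proof (rule inj_onI)
    fix x y assume "x \<in> carrier (Ext_F B \<sigma> n M N)" "y \<in> carrier (Ext_F B \<sigma> n M N)"
      and eq: "ext_iso n M N x = ext_iso n M N y"
    then obtain f g where f: "f \<in> cocycles ?E (hom_diff (ures M)) n" "x = ?c f"
      and g: "g \<in> cocycles ?E (hom_diff (ures M)) n" "y = ?c g"
      by (auto simp: Ext_F_eq EC.cohomology_carrier)
    note fc = EC.cocycles_closed(1)[OF f(1)] and gc = EC.cocycles_closed(1)[OF g(1)]
    \<comment> \<open>The difference of \<open>f\<close> and \<open>g\<close>, formed with a scalar multiple so that linearity of the parts applies.\<close>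
    define m where "m = (\<ominus>\<^bsub>K\<^esub> \<one>\<^bsub>K\<^esub>)"
    have m: "m \<in> carrier K" by (simp add: m_def)
    define h where "h = f \<oplus>\<^bsub>?E n\<^esub> m \<odot>\<^bsub>?E n\<^esub> g"
    have h: "h \<in> cocycles ?E (hom_diff (ures M)) n"
      unfolding h_def by (intro EC.cocycles_closed(3,4) f(1) g(1) m)
    have "ext_part M N d n h \<in> gr_coboundaries M N d n" for d
    proof -
      note ec = ext_part_closed[OF M N fc, of d] ext_part_closed[OF M N gc, of d]
      have "gr_class M N d n (ext_part M N d n f) =
         gr_class M N d n (ext_part M N d n g)"
        using fun_cong[OF eq, of d] by (simp add: f(2) g(2) cl[OF f(1)] cl[OF g(1)])
      then obtain w where w: "w \<in> gr_coboundaries M N d n"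
        "ext_part M N d n f = w \<oplus>\<^bsub>gr_complex M N d n\<^esub> ext_part M N d n g"
        by (rule G.cohomology_class_eqD[OF _ ec(1)])
      have wc: "w \<in> carrier (gr_complex M N d n)" by (rule G.coboundaries_carrier[OF w(1)])
      have "ext_part M N d n h = ext_part M N d n f \<oplus>\<^bsub>gr_complex M N d n\<^esub> m \<odot>\<^bsub>gr_complex M N d n\<^esub> ext_part M N d n g"
        using fc gc m by (simp add: h_def ext_part_add[OF M N] ext_part_smult[OF M N])
      also have "\<dots> = (w \<oplus>\<^bsub>gr_complex M N d n\<^esub> ext_part M N d n g) \<oplus>\<^bsub>gr_complex M N d n\<^esub>
          (\<ominus>\<^bsub>gr_complex M N d n\<^esub> ext_part M N d n g)"
        using ec by (simp add: w(2) m_def Gm.smult_l_minus)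
      also have "\<dots> = w" using ec wc by (simp add: Gm.M.a_assoc Gm.M.r_neg)
      finally show ?thesis using w(1) by simp
    qed
    then have "h \<in> coboundaries ?E (hom_diff (ures M)) n"
      using pull_reflects_coboundaries[OF M N h] coboundary_if_parts[OF M N pull_closed[OF M N EC.cocycles_closed(1)[OF h]]]
      by (simp add: ext_part_def)
    moreover have "f = h \<oplus>\<^bsub>?E n\<^esub> g"
      using fc gc by (simp add: h_def m_def Em.smult_l_minus Em.M.a_assoc Em.M.l_neg)
    ultimately show "x = y" using EC.cohomology_class_eqI[OF _ gc] by (simp add: f(2) g(2))
  qed
  moreover have "\<exists>x\<in>carrier (Ext_F B \<sigma> n M N). ext_iso n M N x = s" if s: "s \<in> carrier (sum_gr_Ext K B \<sigma> n M N)" for s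
  proof -
    let ?z = "\<lambda>k. \<lambda>x\<in>carrier (obj (gres M) k). \<zero>\<^bsub>N\<^esub>"
    have sc: "s d \<in> gr_class M N d n ` gr_cocycles M N d n"
      and fin: "finite {d. s d \<noteq> \<zero>\<^bsub>gr_Ext K B n M (ts d N)\<^esub>}" for d
      using s by (auto simp: sum_gr_Ext_sel gr_Ext_eq G.cohomology_carrier)
    \<comment> \<open>The zero class must be represented by zero, so that only finitely many representatives are nonzero.\<close>
    have "\<exists>v. v \<in> gr_cocycles M N d n \<and>
        s d = gr_class M N d n v \<and>
        (s d = \<zero>\<^bsub>gr_Ext K B n M (ts d N)\<^esub> \<longrightarrow> v = ?z n)" for d
    proof (cases "s d = \<zero>\<^bsub>gr_Ext K B n M (ts d N)\<^esub>")
      case True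
      then show ?thesis using G.cocycles_closed(2) G.cohomology_zero
        by (intro exI[of _ "?z n"]) (simp add: gr_Ext_eq gr_complex_sel(2)[OF M N])
    next
      case False then show ?thesis using sc[of d] by blast
    qed
    then obtain v where v: "\<And>d. v d \<in> gr_cocycles M N d n"
      "\<And>d. s d = gr_class M N d n (v d)"
      "\<And>d. s d = \<zero>\<^bsub>gr_Ext K B n M (ts d N)\<^esub> \<Longrightarrow> v d = ?z n" by metis
    have "{d. v d \<noteq> ?z n} \<subseteq> {d. s d \<noteq> \<zero>\<^bsub>gr_Ext K B n M (ts d N)\<^esub>}" using v(3) by blast
    then have "finite {d. v d \<noteq> ?z n}" using fin by (rule finite_subset)
    moreover have "v d \<in> gr_hom B (obj (gres M) n) (ts d N)" for d
      using G.cocycles_closed(1)[OF v(1)] gr_complex_sel(1)[OF M N] by simp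
    ultimately obtain u where u: "u \<in> lmod_hom B\<sigma> (F (obj (gres M) n)) (F N)"
      "\<And>d. hom_part (obj (gres M) n) N d u = v d"
      using hom_parts_surjective[OF pP(5) lN] by meson
    have uc: "u \<in> carrier (?FC n)" using u(1) by (simp add: FC_sel[OF M N])
    have "hom_diff (gres M) n u = \<zero>\<^bsub>?FC (Suc n)\<^esub>"
    proof -
      have "hom_part (obj (gres M) (Suc n)) N d (hom_diff (gres M) n u) = hom_part (obj (gres M) (Suc n)) N d \<zero>\<^bsub>?FC (Suc n)\<^esub>" for d
        using part_diff[OF M N uc, of d] part_zero[OF M N, of "Suc n" d] v(1)[of d] u(2)[of d] by (simp add: cocycles_def)
      moreover have "\<zero>\<^bsub>?FC (Suc n)\<^esub> \<in> carrier (?FC (Suc n))" using FC.cocycles_closed(1,2) by blast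
      ultimately show ?thesis
        using hom_parts_determine[OF pP(5) lN] FC.d_closed[OF uc] unfolding FC_sel(1)[OF M N] by blast
    qed
    then have "u \<in> cocycles ?FC (hom_diff (gres M)) n" using uc by (simp add: cocycles_def)
    then obtain f w where f: "f \<in> cocycles ?E (hom_diff (ures M)) n" and
      w: "w \<in> coboundaries ?FC (hom_diff (gres M)) n" "compose (carrier (obj (gres M) n)) f (to_res M n) = w \<oplus>\<^bsub>?FC n\<^esub> u"
      using pull_surjective_on_classes[OF M N] by blast
    have "ext_iso n M N (?c f) d = s d" for d
    proof -
      have "ext_part M N d n f = hom_part (obj (gres M) n) N d w \<oplus>\<^bsub>gr_complex M N d n\<^esub> v d"
        using part_add[OF M N FC.coboundaries_carrier[OF w(1)] uc] u(2) by (simp add: ext_part_def w(2))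
      then show ?thesis
        using G.cohomology_class_eqI[OF part_coboundary[OF M N w(1)] G.cocycles_closed(1)[OF v(1)]] v(2)
        by (simp add: cl[OF f])
    qed
    moreover have "?c f \<in> carrier (Ext_F B \<sigma> n M N)" using f by (simp add: Ext_F_eq EC.cohomology_carrier)
    ultimately show ?thesis by blast
  qed
  moreover have "ext_iso n M N x \<in> carrier (sum_gr_Ext K B \<sigma> n M N)" if "x \<in> carrier (Ext_F B \<sigma> n M N)" for x
    using lmod_hom_closed[OF ext_iso_hom[OF M N] that] .
  ultimately show ?thesis unfolding bij_betw_def by blast
qed

end

section \<open>Naturality\<close>

context twist
begin

text \<open>A morphism \<open>g\<close> of graded modules commutes with taking homogeneous parts, so both sides are represented by the
  same cocycle.\<close>

lemma ext_iso_covar: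
  assumes M: "gr_obj K B M" and N: "gr_obj K B N" and N': "gr_obj K B N'" and g: "g \<in> gr_hom B N N'"
    and x: "x \<in> carrier (Ext_F B \<sigma> n M N)"
  shows "ext_iso n M N' (Ext_covar B\<sigma> n (F M) (F N') g x) =
    (\<lambda>d. gr_Ext_covar K B n M (ts d N') g (ext_iso n M N x d))"
proof
  fix d
  interpret EC: cochain_complex K "u_complex M N" "hom_diff (ures M)"
    by (rule cochain_complex_ures[OF M N])
  note lM = gr_obj_lmod[OF M] and lN = gr_obj_lmod[OF N] and lN' = gr_obj_lmod[OF N']
  interpret N: graded_lmod B N by (rule lN)
  interpret N': graded_lmod B N' by (rule lN')
  note pU = projective_resolutionD[OF the_res_F[OF M]] and pP = gr_projective_resolutionD[OF the_gr_res[OF M]]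
  note gF = gr_hom_F[OF lN lN' g] and gh = gr_hom_lmod_hom[OF g]
  have g0: "g \<zero>\<^bsub>N\<^esub> = \<zero>\<^bsub>N'\<^esub>"
    by (rule lmod_hom_zero[OF gh N.M.abelian_group_axioms N'.M.abelian_group_axioms])
  have gt: "g \<in> gr_hom B (ts d N) (ts d N')"
    using g lmod_hom_extensional[OF gh]
    by (auto simp: gr_hom_def lmod_hom_closed[OF gh] lmod_hom_add[OF gh] lmod_hom_smult[OF gh] intro!: lmod_homI)
  obtain f where f: "f \<in> u_cocycles M N n"
    and xf: "x = u_class M N n f"
    using x by (auto simp: Ext_F_eq EC.cohomology_carrier)
  have fc: "f \<in> carrier (u_complex M N n)" by (rule EC.cocycles_closed(1)[OF f])
  have fh: "f \<in> lmod_hom B\<sigma> (obj (ures M) n) (F N)" using fc by (simp add: hom_complex_def hom_module_sel)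
  let ?gf = "compose (carrier (obj (ures M) n)) g f"
  have gcl: "compose (carrier (obj (ures M) k)) g u \<in> lmod_hom B\<sigma> (obj (ures M) k) (F N')"
    if "u \<in> lmod_hom B\<sigma> (obj (ures M) k) (F N)" for u k
    by (rule lmod_hom_compose[OF pU(5) that gF])
  have gtcl: "compose (carrier (obj (gres M) k)) g u \<in> gr_hom B (obj (gres M) k) (ts d N')"
    if "u \<in> gr_hom B (obj (gres M) k) (ts d N)" for u k
    by (rule gr_hom_compose[OF pP(5) that gt])
  have "Ext_covar B\<sigma> n (F M) (F N') g x = u_class M N' n ?gf"
    unfolding Ext_covar_def ext_complex_eq xf
  proof (rule cohomology_map_class[OF EC.cochain_complex_axioms cochain_complex_ures[OF M N'] fc])
    fix u v assume uv: "u \<in> carrier (u_complex M N n)"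
    then show "compose (carrier (obj (ures M) n)) g u \<in> carrier (u_complex M N' n)"
      using gcl by (simp add: hom_complex_def hom_module_sel)
    assume v: "v \<in> carrier (u_complex M N n)"
    have "u y \<in> carrier N" "v y \<in> carrier N" if "y \<in> carrier (obj (ures M) n)" for y
      using uv v that lmod_hom_closed[of _ B\<sigma> "obj (ures M) n" "F N" y]
      by (auto simp: hom_complex_def hom_module_sel)
    then show "compose (carrier (obj (ures M) n)) g (u \<oplus>\<^bsub>u_complex M N n\<^esub> v) =
      compose (carrier (obj (ures M) n)) g u \<oplus>\<^bsub>u_complex M N' n\<^esub> compose (carrier (obj (ures M) n)) g v"
      using lmod_hom_add[OF gh]
      by (auto simp: hom_complex_def hom_module_sel compose_def intro!: restrict_ext)
  next
    fix u assume "u \<in> u_coboundaries M N n"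
    then show "compose (carrier (obj (ures M) n)) g u \<in> u_coboundaries M N' n"
      using postcompose_coboundary_sub[of "ures M" g "F N" "F N'" "\<lambda>n. lmod_hom B\<sigma> (obj (ures M) n) (F N)"
          "\<lambda>n. lmod_hom B\<sigma> (obj (ures M) n) (F N')" u B\<sigma> n, unfolded hom_complex_carrier]
        lmod_hom_closed[OF pU(2)] g0 gcl by simp
  qed
  moreover have "?gf \<in> u_cocycles M N' n"
  proof -
    have "hom_diff (ures M) n ?gf = compose (carrier (obj (ures M) (Suc n))) g (hom_diff (ures M) n f)"
      using lmod_hom_closed[OF pU(2)] by (auto simp: hom_diff_def compose_def intro!: restrict_ext)
    moreover have "hom_diff (ures M) n f = (\<lambda>x\<in>carrier (obj (ures M) (Suc n)). \<zero>\<^bsub>N\<^esub>)"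
      using f by (simp add: cocycles_def hom_complex_def hom_module_sel)
    ultimately show ?thesis using gcl[OF fh] g0
      by (auto simp: cocycles_def hom_complex_def hom_module_sel compose_def intro!: restrict_ext)
  qed
  ultimately have L: "ext_iso n M N' (Ext_covar B\<sigma> n (F M) (F N') g x) d =
      gr_class M N' d n (ext_part M N' d n ?gf)"
    using ext_iso_class[OF M N'] by simp
  have R: "gr_Ext_covar K B n M (ts d N') g (ext_iso n M N x d) =
      gr_class M N' d n (compose (carrier (obj (gres M) n)) g (ext_part M N d n f))"
    unfolding gr_Ext_covar_def ext_complex_eq xf ext_iso_class[OF M N f]
  proof (rule cohomology_map_class[OF cochain_complex_gr[OF M N] cochain_complex_gr[OF M N'] ext_part_closed[OF M N fc]])
    fix u v assume uv: "u \<in> carrier (gr_complex M N d n)"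
    then show "compose (carrier (obj (gres M) n)) g u \<in> carrier (gr_complex M N' d n)"
      using gtcl by (simp add: gr_complex_sel[OF M N] gr_complex_sel[OF M N'])
    assume v: "v \<in> carrier (gr_complex M N d n)"
    have "u y \<in> carrier N" "v y \<in> carrier N" if "y \<in> carrier (obj (gres M) n)" for y
      using uv v that gr_hom_lmod_hom[THEN lmod_hom_closed, of _ B "obj (gres M) n" "ts d N" y]
      by (auto simp: gr_complex_sel[OF M N])
    then show "compose (carrier (obj (gres M) n)) g (u \<oplus>\<^bsub>gr_complex M N d n\<^esub> v) =
      compose (carrier (obj (gres M) n)) g u \<oplus>\<^bsub>gr_complex M N' d n\<^esub> compose (carrier (obj (gres M) n)) g v"
      using lmod_hom_add[OF gh]
      by (auto simp: gr_complex_sel[OF M N] gr_complex_sel[OF M N'] compose_def intro!: restrict_ext)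
  next
    fix u assume "u \<in> gr_coboundaries M N d n"
    then show "compose (carrier (obj (gres M) n)) g u \<in> gr_coboundaries M N' d n"
      using postcompose_coboundary_sub[of "gres M" g "ts d N" "ts d N'", OF lmod_hom_closed[OF gr_hom_lmod_hom[OF pP(2)]] _ gtcl,
        where f = u and n = n and R = B] g0 by (simp add: gr_complex_def)
  qed
  have pf: "compose (carrier (obj (gres M) n)) f (to_res M n) \<in> lmod_hom B\<sigma> (F (obj (gres M) n)) (F N)"
    using pull_closed[OF M N fc] by (simp add: FC_sel[OF M N])
  have "compose (carrier (obj (gres M) n)) ?gf (to_res M n) =
      compose (carrier (obj (gres M) n)) g (compose (carrier (obj (gres M) n)) f (to_res M n))"
    by (rule compose_assoc_on) (use lmod_hom_closed[OF is_chain_liftD(1)[OF to_res[OF M]]] in simp)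
  then have "ext_part M N' d n ?gf = compose (carrier (obj (gres M) n)) g (ext_part M N d n f)"
    using hom_part_postcompose[OF pP(5) lN lN' pf g] by (simp add: ext_part_def)
  then show "ext_iso n M N' (Ext_covar B\<sigma> n (F M) (F N') g x) d = gr_Ext_covar K B n M (ts d N') g (ext_iso n M N x d)"
    by (simp add: L R)
qed

text \<open>The representatives on the two sides arise from \<open>f\<close> by pulling back along two chain maps, from \<open>F\<^sub>\<sigma>\<close> of the
  graded resolution of \<open>M'\<close> to the resolution of \<open>F\<^sub>\<sigma> M\<close>.  Both lift \<open>h\<close>, so they are homotopic and the
  pullbacks differ by a coboundary, which has coboundaries as homogeneous parts.\<close>

lemma ext_iso_contra:
  fixes M M' :: "('b, 'm, 'y) graded_module_scheme"
  assumes M: "gr_obj K B M" and M': "gr_obj K B M'" and N: "gr_obj K B N" and h: "h \<in> gr_hom B M' M"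
    and x: "x \<in> carrier (Ext_F B \<sigma> n M N)"
  shows "ext_iso n M' N (Ext_contra B\<sigma> n (F M') (F M) h (F N) x) =
    (\<lambda>d. gr_Ext_contra K B n M' M h (ts d N) (ext_iso n M N x d))"
proof
  fix d
  interpret EC: cochain_complex K "u_complex M N" "hom_diff (ures M)"
    by (rule cochain_complex_ures[OF M N])
  interpret FC': cochain_complex K "F_complex M' N" "hom_diff (gres M')"
    by (rule cochain_complex_Fgres[OF M' N])
  interpret G': cochain_complex K "gr_complex M' N d" "hom_diff (gres M')"
    by (rule cochain_complex_gr[OF M' N])
  note lM = gr_obj_lmod[OF M] and lM' = gr_obj_lmod[OF M'] and lN = gr_obj_lmod[OF N]
  interpret M: graded_lmod B M by (rule lM)
  note pU = projective_resolutionD[OF the_res_F[OF M]] and pU' = projective_resolutionD[OF the_res_F[OF M']]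
  note pP = gr_projective_resolutionD[OF the_gr_res[OF M]] and pP' = gr_projective_resolutionD[OF the_gr_res[OF M']]
  note hF = gr_hom_F[OF lM' lM h]
  define \<theta> where "\<theta> = chain_lift (\<lambda>i. lmod_hom B\<sigma> (obj (ures M') i) (obj (ures M) i)) (ures M') (ures M) h"
  define \<tau> where "\<tau> = chain_lift (\<lambda>i. gr_hom B (obj (gres M') i) (obj (gres M) i)) (gres M') (gres M) h"
  have \<theta>: "is_chain_lift (\<lambda>i. lmod_hom B\<sigma> (obj (ures M') i) (obj (ures M) i)) (ures M') (ures M) h \<theta>"
    using projective_chain_lift_exists[OF the_res_F[OF M'] the_res_F[OF M] left_module_F[OF lM'] left_module_F[OF lM] hF]
    unfolding \<theta>_def by (elim exE) (rule is_chain_lift_chain_lift)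
  have \<tau>: "is_chain_lift (\<lambda>i. gr_hom B (obj (gres M') i) (obj (gres M) i)) (gres M') (gres M) h \<tau>"
    using gr_chain_lift_exists[OF the_gr_res[OF M'] the_gr_res[OF M] lM' lM h]
    unfolding \<tau>_def by (elim exE) (rule is_chain_lift_chain_lift)
  have \<tau>F: "is_chain_lift (\<lambda>i. lmod_hom B\<sigma> (obj (F_res (gres M')) i) (obj (F_res (gres M)) i))
      (F_res (gres M')) (F_res (gres M)) h \<tau>"
    using \<tau> gr_hom_F[OF pP'(5) pP(5)] by (simp add: is_chain_lift_def lmod_hom_F0)
  obtain f where f: "f \<in> u_cocycles M N n"
    and xf: "x = u_class M N n f"
    using x by (auto simp: Ext_F_eq EC.cohomology_carrier)
  have fc: "f \<in> carrier (u_complex M N n)" by (rule EC.cocycles_closed(1)[OF f])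
  let ?ft = "compose (carrier (obj (ures M') n)) f (\<theta> n)"
  have \<theta>cl: "\<theta> k y \<in> carrier (obj (ures M) k)" if "y \<in> carrier (obj (ures M') k)" for k y
    using lmod_hom_closed[OF is_chain_liftD(1)[OF \<theta>] that] .
  have \<tau>cl: "\<tau> k y \<in> carrier (obj (gres M) k)" if "y \<in> carrier (obj (gres M') k)" for k y
    using lmod_hom_closed[OF gr_hom_lmod_hom[OF is_chain_liftD(1)[OF \<tau>]] that] .
  have "Ext_contra B\<sigma> n (F M') (F M) h (F N) x =
      u_class M' N n ?ft"
    unfolding Ext_contra_def ext_complex_eq xf \<theta>_def[symmetric]
  proof (rule cohomology_map_class[OF EC.cochain_complex_axioms cochain_complex_ures[OF M' N] fc])
    fix u v assume uv: "u \<in> carrier (u_complex M N n)"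
    then show "compose (carrier (obj (ures M') n)) u (\<theta> n) \<in> carrier (u_complex M' N n)"
      using lmod_hom_compose[OF pU'(5) is_chain_liftD(1)[OF \<theta>]] by (simp add: hom_complex_def hom_module_sel)
    show "compose (carrier (obj (ures M') n)) (u \<oplus>\<^bsub>u_complex M N n\<^esub> v) (\<theta> n) =
      compose (carrier (obj (ures M') n)) u (\<theta> n) \<oplus>\<^bsub>u_complex M' N n\<^esub> compose (carrier (obj (ures M') n)) v (\<theta> n)"
      using \<theta>cl by (auto simp: hom_complex_def hom_module_sel compose_def intro!: restrict_ext)
  next
    fix u assume "u \<in> u_coboundaries M N n"
    then show "compose (carrier (obj (ures M') n)) u (\<theta> n) \<in> u_coboundaries M' N n"
      by (rule precompose_coboundary[OF pU'(5) pU'(2) \<theta>])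
  qed
  moreover have ftc: "?ft \<in> u_cocycles M' N n"
    by (rule precompose_cocycle[OF pU'(5) pU'(2) \<theta> f])
  ultimately have L: "ext_iso n M' N (Ext_contra B\<sigma> n (F M') (F M) h (F N) x) d =
      gr_class M' N d n (ext_part M' N d n ?ft)"
    using ext_iso_class[OF M' N] by simp
  have R: "gr_Ext_contra K B n M' M h (ts d N) (ext_iso n M N x d) =
      gr_class M' N d n (compose (carrier (obj (gres M') n)) (ext_part M N d n f) (\<tau> n))"
    unfolding gr_Ext_contra_def ext_complex_eq xf ext_iso_class[OF M N f] \<tau>_def[symmetric]
  proof (rule cohomology_map_class[OF cochain_complex_gr[OF M N] cochain_complex_gr[OF M' N] ext_part_closed[OF M N fc]])
    fix u v assume uv: "u \<in> carrier (gr_complex M N d n)"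
    then show "compose (carrier (obj (gres M') n)) u (\<tau> n) \<in> carrier (gr_complex M' N d n)"
      using gr_hom_compose[OF pP'(5) is_chain_liftD(1)[OF \<tau>]] by (simp add: gr_complex_sel[OF M N] gr_complex_sel[OF M' N])
    show "compose (carrier (obj (gres M') n)) (u \<oplus>\<^bsub>gr_complex M N d n\<^esub> v) (\<tau> n) =
      compose (carrier (obj (gres M') n)) u (\<tau> n) \<oplus>\<^bsub>gr_complex M' N d n\<^esub> compose (carrier (obj (gres M') n)) v (\<tau> n)"
      using \<tau>cl by (auto simp: gr_complex_sel[OF M N] gr_complex_sel[OF M' N] compose_def intro!: restrict_ext)
  next
    fix u assume "u \<in> gr_coboundaries M N d n"
    then show "compose (carrier (obj (gres M') n)) u (\<tau> n) \<in> gr_coboundaries M' N d n"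
      unfolding gr_complex_def
      using \<tau>cl lmod_hom_closed[OF gr_hom_lmod_hom[OF pP'(2)]] is_chain_liftD(3)[OF \<tau>]
        gr_hom_compose[OF pP'(5) is_chain_liftD(1)[OF \<tau>]]
      by (intro precompose_coboundary_sub)
  qed
  let ?P = "F_res (gres M')"
  have l1: "is_chain_lift (\<lambda>n. lmod_hom B\<sigma> (obj ?P n) (obj (ures M) n)) ?P (ures M) h
      (\<lambda>n. compose (carrier (obj ?P n)) (\<theta> n) (to_res M' n))"
    by (rule projective_is_chain_lift_compose[OF gres_proj[OF M'] to_res[OF M'] \<theta>]) simp
  have l2: "is_chain_lift (\<lambda>n. lmod_hom B\<sigma> (obj ?P n) (obj (ures M) n)) ?P (ures M) h
      (\<lambda>n. compose (carrier (obj ?P n)) (to_res M n) (\<tau> n))"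
    by (rule projective_is_chain_lift_compose[OF gres_proj[OF M'] \<tau>F to_res[OF M]])
      (use lmod_hom_closed[OF gr_hom_lmod_hom[OF h]] in simp)
  obtain w where w: "w \<in> coboundaries (hom_complex B\<sigma> ?P (F N)) (hom_diff ?P) n"
    "compose (carrier (obj ?P n)) f (compose (carrier (obj ?P n)) (\<theta> n) (to_res M' n)) =
      w \<oplus>\<^bsub>hom_complex B\<sigma> ?P (F N) n\<^esub> compose (carrier (obj ?P n)) f (compose (carrier (obj ?P n)) (to_res M n) (\<tau> n))"
    using homotopic_precompose[OF gres_proj[OF M'] the_res_F[OF M] left_module_F[OF lM'] left_module_F[OF lM]
      left_module_F[OF lN] l1 l2 f] by blast
  have e1: "compose (carrier (obj ?P n)) f (compose (carrier (obj ?P n)) (\<theta> n) (to_res M' n)) =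
      compose (carrier (obj (gres M') n)) ?ft (to_res M' n)"
    using lmod_hom_closed[OF is_chain_liftD(1)[OF to_res[OF M']]]
      compose_assoc_on[of "carrier (obj (gres M') n)" "to_res M' n" "carrier (obj (ures M') n)" f "\<theta> n"] by simp
  let ?v = "compose (carrier (obj (gres M') n)) (compose (carrier (obj (gres M) n)) f (to_res M n)) (\<tau> n)"
  have e2: "compose (carrier (obj ?P n)) f (compose (carrier (obj ?P n)) (to_res M n) (\<tau> n)) = ?v"
    using \<tau>cl compose_assoc_on[of "carrier (obj (gres M') n)" "\<tau> n" "carrier (obj (gres M) n)" f "to_res M n"] by simp
  have pf: "compose (carrier (obj (gres M) n)) f (to_res M n) \<in> lmod_hom B\<sigma> (F (obj (gres M) n)) (F N)"
    using pull_closed[OF M N fc] by (simp add: FC_sel[OF M N])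
  have vc: "?v \<in> carrier (hom_complex B\<sigma> ?P (F N) n)"
    using lmod_hom_compose[OF left_module_F[OF pP'(5)] gr_hom_F[OF pP'(5) pP(5) is_chain_liftD(1)[OF \<tau>]] pf]
    by (simp add: FC_sel[OF M' N])
  have w': "w \<in> coboundaries (hom_complex B\<sigma> ?P (F N)) (hom_diff (gres M')) n" using w(1) by (simp add: hom_diff_F_res)
  have hv: "hom_part (obj (gres M') n) N d ?v = compose (carrier (obj (gres M') n)) (ext_part M N d n f) (\<tau> n)"
    using hom_part_precompose[OF pP'(5) pP(5) lN pf is_chain_liftD(1)[OF \<tau>]] by (simp add: ext_part_def)
  have "ext_part M' N d n ?ft = hom_part (obj (gres M') n) N d w \<oplus>\<^bsub>gr_complex M' N d n\<^esub> hom_part (obj (gres M') n) N d ?v"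
    using part_add[OF M' N FC'.coboundaries_carrier[OF w'] vc] by (simp add: ext_part_def w(2)[unfolded e1 e2])
  then show "ext_iso n M' N (Ext_contra B\<sigma> n (F M') (F M) h (F N) x) d =
      gr_Ext_contra K B n M' M h (ts d N) (ext_iso n M N x d)"
    using G'.cohomology_class_eqI[OF part_coboundary[OF M' N w'] part_closed[OF M' N vc]] by (simp add: L R hv)
qed

end

theorem proposition3p5:
  fixes K :: "'k ring" and B :: "('k, 'b) graded_module" and \<sigma> :: "'b \<Rightarrow> 'b" and n :: nat
  assumes "field K"
    and "graded_algebra K B" and "fin_dim K B"
    and "graded_aut K B \<sigma>"
  shows "\<exists>\<Phi>. natural_family K B \<sigma> n \<Phi> \<and>
    (\<forall>M :: ('b, 'm) graded_module. gr_obj K B M \<longrightarrow>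
       \<Phi> M M \<in> lmod_iso K
         (Ext (twisted_algebra B \<sigma>) n (F_twist B \<sigma> M) (F_twist B \<sigma> M))
         (direct_sum (\<lambda>d::int. gr_Ext K B n M (twist_shift B \<sigma> d M))))"
proof -
  interpret twist K B \<sigma> by (rule twist.intro[OF assms])
  have "natural_family K B \<sigma> n (ext_iso n)"
    unfolding natural_family_def
    by (intro conjI allI impI ballI; elim conjE; rule ext_iso_hom ext_iso_covar ext_iso_contra; assumption)
  moreover have "ext_iso n M M \<in> lmod_iso K (Ext (twisted_algebra B \<sigma>) n (F_twist B \<sigma> M) (F_twist B \<sigma> M))
         (direct_sum (\<lambda>d::int. gr_Ext K B n M (twist_shift B \<sigma> d M)))"
    if "gr_obj K B M" for M :: "('b, 'm) graded_module"
    using ext_iso_hom[OF that that, of n] ext_iso_bij[OF that that, of n]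
    by (simp add: lmod_iso_def Ext_F_def sum_gr_Ext_def)
  ultimately show ?thesis by blast
qed

end
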